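(* Let $K$ be an algebraically closed field of characteristic $0$ and $t<m\le n$. Then (1) $\Phi_0$ has cardinality $mn$; (2) $K[\Phi_0][F^{-1}]=A_t[F^{-1}]$; (3) $A_t[F^{-1}]$ is a regular ring.
   Context: $X$ is an $m\times n$ matrix of indeterminates, $A_t\subseteq K[X]$ the $K$-subalgebra generated by the $t$-minors. $\delta_i$ is the minor of $X$ on the first $i$ rows and first $i$ columns ($\delta_0=1$), and $F=\delta_{t-1}\delta_t\delta_{t+1}$. $\Phi_0$ is the set of $t$-minors $[a_1\dots a_t\,|\,b_1\dots b_t]$ ($1\le a_1<\dots<a_t\le m$ rows, $1\le b_1<\dots<b_t\le n$ columns) satisfying at least one of: (i) $a_t\le t+1$ and $b_t\le t+1$; (ii) $a_{t-1}=t-1$ and $b_{t-1}=t-1$; (iii) $a_t=t$ and $b_{t-1}\le t$; (iv) $a_{t-1}\le t$ and $b_t=t$ (for $t=1$ read $a_0=b_0=0$). $K[\Phi_0]$ is the $K$-subalgebra generated by $\Phi_0$. *)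

theory Defs
  imports "HOL-Library.Poly_Mapping" "HOL-Library.Product_Lexorder"
    "HOL-Library.Extended_Nat"
    "HOL-Computational_Algebra.Polynomial" "HOL-Computational_Algebra.Fraction_Field"
    "HOL-Combinatorics.Permutations"
begin

text \<open>Polynomials in the indeterminates x_(i,j) (i = row, j = column, both 1-based)
  with coefficients in 'k: finitely supported maps from monomials to coefficients.\<close>
type_synonym 'k mpoly = "((nat \<times> nat) \<Rightarrow>\<^sub>0 nat) \<Rightarrow>\<^sub>0 'k"

definition Xvar :: "nat \<Rightarrow> nat \<Rightarrow> 'k::comm_ring_1 mpoly" where
  "Xvar i j = Poly_Mapping.single (Poly_Mapping.single (i, j) 1) 1"

definition Const :: "'k::comm_ring_1 \<Rightarrow> 'k mpoly" where
  "Const c = Poly_Mapping.single 0 c"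

text \<open>k-th smallest element (1-based) of a finite set of indices; index 0 gives 0
  (the convention a_0 = b_0 = 0).\<close>
definition sel :: "nat set \<Rightarrow> nat \<Rightarrow> nat" where
  "sel R k = (if k = 0 then 0 else sorted_list_of_set R ! (k - 1))"

definition minor :: "nat set \<Rightarrow> nat set \<Rightarrow> 'k::comm_ring_1 mpoly" where
  "minor R C = (\<Sum>\<sigma> | \<sigma> permutes {..<card R}.
      of_int (sign \<sigma>) * (\<Prod>i<card R. Xvar (sorted_list_of_set R ! i)
                                          (sorted_list_of_set C ! \<sigma> i)))"

definition is_index_set :: "nat \<Rightarrow> nat \<Rightarrow> nat set \<Rightarrow> bool" where
  "is_index_set t N R \<longleftrightarrow> R \<subseteq> {1..N} \<and> card R = t"

definition tminors :: "nat \<Rightarrow> nat \<Rightarrow> nat \<Rightarrow> 'k::comm_ring_1 mpoly set" where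
  "tminors m n t = {minor R C | R C. is_index_set t m R \<and> is_index_set t n C}"

text \<open>delta_i: minor on first i rows and first i columns (delta_0 = 1).\<close>
definition delta :: "nat \<Rightarrow> 'k::comm_ring_1 mpoly" where
  "delta i = minor {1..i} {1..i}"

definition Fpoly :: "nat \<Rightarrow> 'k::comm_ring_1 mpoly" where
  "Fpoly t = delta (t - 1) * delta t * delta (t + 1)"

definition Phi0_cond :: "nat \<Rightarrow> nat set \<Rightarrow> nat set \<Rightarrow> bool" where
  "Phi0_cond t a b \<longleftrightarrow>
     (sel a t \<le> t + 1 \<and> sel b t \<le> t + 1) \<or>
     (sel a (t - 1) = t - 1 \<and> sel b (t - 1) = t - 1) \<or>
     (sel a t = t \<and> sel b (t - 1) \<le> t) \<or>
     (sel a (t - 1) \<le> t \<and> sel b t = t)"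

definition Phi0 :: "nat \<Rightarrow> nat \<Rightarrow> nat \<Rightarrow> 'k::comm_ring_1 mpoly set" where
  "Phi0 m n t = {minor R C | R C. is_index_set t m R \<and> is_index_set t n C \<and> Phi0_cond t R C}"

inductive_set alg_gen :: "'k::comm_ring_1 mpoly set \<Rightarrow> 'k mpoly set" for S where
  gen: "x \<in> S \<Longrightarrow> x \<in> alg_gen S"
| const: "Const c \<in> alg_gen S"
| add: "x \<in> alg_gen S \<Longrightarrow> y \<in> alg_gen S \<Longrightarrow> x + y \<in> alg_gen S"
| mult: "x \<in> alg_gen S \<Longrightarrow> y \<in> alg_gen S \<Longrightarrow> x * y \<in> alg_gen S"

definition invert :: "'a::idom set \<Rightarrow> 'a \<Rightarrow> 'a fract set" where
  "invert A f = {Fract a (f ^ k) | a k. a \<in> A}"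

definition ideal_in :: "'f::field set \<Rightarrow> 'f set \<Rightarrow> bool" where
  "ideal_in S I \<longleftrightarrow> I \<subseteq> S \<and> 0 \<in> I \<and> (\<forall>x\<in>I. \<forall>y\<in>I. x + y \<in> I) \<and> (\<forall>r\<in>S. \<forall>x\<in>I. r * x \<in> I)"

definition prime_in :: "'f::field set \<Rightarrow> 'f set \<Rightarrow> bool" where
  "prime_in S P \<longleftrightarrow> ideal_in S P \<and> P \<noteq> S \<and> (\<forall>x\<in>S. \<forall>y\<in>S. x * y \<in> P \<longrightarrow> x \<in> P \<or> y \<in> P)"

definition maximal_in :: "'f::field set \<Rightarrow> 'f set \<Rightarrow> bool" where
  "maximal_in S M \<longleftrightarrow> ideal_in S M \<and> M \<noteq> S \<and>
     (\<forall>J. ideal_in S J \<and> M \<subseteq> J \<longrightarrow> J = M \<or> J = S)"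

definition gen_ideal :: "'f::field set \<Rightarrow> 'f list \<Rightarrow> 'f set" where
  "gen_ideal S gs = {\<Sum>i<length gs. r i * gs ! i | r. \<forall>i<length gs. r i \<in> S}"

definition noetherian :: "'f::field set \<Rightarrow> bool" where
  "noetherian S \<longleftrightarrow> (\<forall>I. ideal_in S I \<longrightarrow> (\<exists>gs. set gs \<subseteq> I \<and> I = gen_ideal S gs))"

definition min_gens :: "'f::field set \<Rightarrow> 'f set \<Rightarrow> nat" where
  "min_gens S I = (LEAST k. \<exists>gs. length gs = k \<and> set gs \<subseteq> I \<and> I = gen_ideal S gs)"

definition krull_dim :: "'f::field set \<Rightarrow> enat" where
  "krull_dim S = Sup {enat n | n. \<exists>c. (\<forall>i\<le>n. prime_in S (c i)) \<and> (\<forall>i<n. c i \<subset> c (Suc i))}"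

definition local_ring :: "'f::field set \<Rightarrow> bool" where
  "local_ring S \<longleftrightarrow> (\<exists>!M. maximal_in S M)"

definition regular_local :: "'f::field set \<Rightarrow> bool" where
  "regular_local S \<longleftrightarrow> noetherian S \<and> local_ring S \<and>
     krull_dim S = enat (min_gens S (THE M. maximal_in S M))"

definition localize :: "'f::field set \<Rightarrow> 'f set \<Rightarrow> 'f set" where
  "localize S P = {x / y | x y. x \<in> S \<and> y \<in> S - P}"

definition regular_ring :: "'f::field set \<Rightarrow> bool" where
  "regular_ring S \<longleftrightarrow> noetherian S \<and> (\<forall>P. prime_in S P \<longrightarrow> regular_local (localize S P))"

definition alg_closed :: "'k::field itself \<Rightarrow> bool" where
  "alg_closed _ \<longleftrightarrow> (\<forall>p :: 'k poly. degree p > 0 \<longrightarrow> (\<exists>x. poly p x = 0))"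

end

theory Submission
  imports Defs "Jordan_Normal_Form.Char_Poly"
begin

text \<open>A localization of a polynomial ring \<open>K[z\<^sub>1, \<dots>, z\<^sub>N]\<close> is regular: given a prime \<open>P\<close>, choose a maximal
  set of variables that are independent modulo \<open>P\<close> and adjoin the others one at a time. Each of them
  contributes one element to a chain of primes below \<open>P\<close> in which every member is principal
  modulo its predecessor after localizing at \<open>P\<close>. The length of the chain is the height of \<open>P\<close>,
  because strict inclusions of primes lower the number of independent variables, and these elements
  minimally generate the maximal ideal of the local ring at \<open>P\<close>.

  The \<open>mn\<close> elements of \<open>\<Phi>\<^sub>0\<close> are distinct and algebraically independent since, in characteristic \<open>0\<close>,
  their linear terms at the matrix \<open>diag(1, \<dots>, 1, 0, \<dots>)\<close> with \<open>t + 1\<close> ones are linearly independent.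

  Let \<open>Y\<close> be the leading block of size \<open>t\<close> and \<open>X = Q Y P + R\<close> with \<open>P = Y\<^sup>-\<^sup>1 X\<close> and \<open>Q = X Y\<^sup>-\<^sup>1\<close>, so that \<open>R\<close>
  is the Schur complement, and let \<open>\<rho> = \<delta>\<^sub>t\<^sub>+\<^sub>1 / \<delta>\<^sub>t\<close>. The entries of \<open>P\<close>, \<open>Q\<close>, \<open>R / \<rho>\<close> and \<open>\<rho> Y\<^sup>-\<^sup>1\<close> lie in
  \<open>K[\<Phi>\<^sub>0][F\<^sup>-\<^sup>1]\<close>, and the \<open>t\<close>-minor of \<open>X\<close> with rows \<open>a\<close> and columns \<open>b\<close> is \<open>\<delta>\<^sub>t\<close> times the determinant of the block matrix
  with rows \<open>(\<rho> Y\<^sup>-\<^sup>1, P\<^sub>b)\<close> and \<open>(- Q\<^sub>a, R\<^sub>a\<^sub>b / \<rho>)\<close>.\<close>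

section \<open>Polynomial extensions of subrings of a field\<close>

text \<open>The scaling by \<rho> is forced by degrees. Elements of A_t[F^-1] have homogeneous
  components only in degrees divisible by t, while the entries of \<open>Y\<^sup>-\<^sup>1\<close>
  and R have degrees -1 and 1; as \<rho> has degree 1, all four blocks become homogeneous of degree
  0. For the same reason delta_(t-1) and delta_(t+1) are available only as a product when t > 1. The
  shape of F fits this: Sylvester's identity writes delta_(t-1) delta_t R_rc through minors of
  \<open>\<Phi>\<^sub>0\<close>, and r = c = t + 1 turns it into delta_(t-1) delta_(t+1). So F lies
  in the algebra of \<open>\<Phi>\<^sub>0\<close>, and inverting F inverts exactly what is needed:
  delta_t for P and Q, the outer product for R / \<rho>. The diagonal point needs t + 1 ones: with t
  ones and t > 1, the principal minors omitting some k \<le> t would all have the linear term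
  x_(t+1,t+1). With t + 1 ones these linear terms have a coefficient matrix of determinant t up to
  sign. All rings are subsets of one field, so contraction is intersection and fractions are honest
  quotients.\<close>

locale sub_ring =
  fixes R :: "'f::field set"
  assumes zero [simp, intro]: "0 \<in> R" and one [simp, intro]: "1 \<in> R"
    and add [intro]: "x \<in> R \<Longrightarrow> y \<in> R \<Longrightarrow> x + y \<in> R"
    and mult [intro]: "x \<in> R \<Longrightarrow> y \<in> R \<Longrightarrow> x * y \<in> R"
    and uminus [intro]: "x \<in> R \<Longrightarrow> - x \<in> R"
begin

lemma diff [intro]: "x \<in> R \<Longrightarrow> y \<in> R \<Longrightarrow> x - y \<in> R"
  using add[of x "- y"] uminus[of y] by simp

lemma sum: "(\<And>i. i \<in> A \<Longrightarrow> f i \<in> R) \<Longrightarrow> sum f A \<in> R"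
  by (induction A rule: infinite_finite_induct) auto

lemma prod: "(\<And>i. i \<in> A \<Longrightarrow> f i \<in> R) \<Longrightarrow> prod f A \<in> R"
  by (induction A rule: infinite_finite_induct) auto

lemma power [intro]: "x \<in> R \<Longrightarrow> x ^ k \<in> R"
  by (induction k) auto

lemma of_int [intro]: "of_int k \<in> R"
proof -
  have "of_nat n \<in> R" for n :: nat
    by (induction n) auto
  then show ?thesis
    by (cases k) (auto simp del: of_nat_Suc)
qed

end

lemma ideal_inD:
  assumes "ideal_in S I"
  shows "I \<subseteq> S" "0 \<in> I" "x \<in> I \<Longrightarrow> y \<in> I \<Longrightarrow> x + y \<in> I" "r \<in> S \<Longrightarrow> x \<in> I \<Longrightarrow> r * x \<in> I"
    "r \<in> S \<Longrightarrow> x \<in> I \<Longrightarrow> x * r \<in> I"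
  using assms by (auto simp: ideal_in_def mult.commute)

lemma (in sub_ring) ideal_uminus: "ideal_in R I \<Longrightarrow> x \<in> I \<Longrightarrow> - x \<in> I"
  using ideal_inD(4)[of R I "-1" x] by auto

lemma (in sub_ring) ideal_diff: "ideal_in R I \<Longrightarrow> x \<in> I \<Longrightarrow> y \<in> I \<Longrightarrow> x - y \<in> I"
  using ideal_inD(3)[of R I x "-y"] ideal_uminus[of I y] by auto

lemma ideal_sum: "ideal_in S I \<Longrightarrow> (\<And>i. i \<in> A \<Longrightarrow> f i \<in> I) \<Longrightarrow> sum f A \<in> I"
  by (induction A rule: infinite_finite_induct) (auto simp: ideal_inD)

lemma prime_inD:
  assumes "prime_in S P"
  shows "ideal_in S P" "P \<noteq> S" "x \<in> S \<Longrightarrow> y \<in> S \<Longrightarrow> x * y \<in> P \<Longrightarrow> x \<in> P \<or> y \<in> P"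
  using assms by (auto simp: prime_in_def)

lemma prime_not_one: "prime_in S P \<Longrightarrow> 1 \<notin> P"
  using ideal_inD(4)[of S P _ 1] ideal_inD(1)[of S P] by (fastforce simp: prime_in_def)

lemma prime_compl_mult: "prime_in S P \<Longrightarrow> x \<in> S - P \<Longrightarrow> y \<in> S - P \<Longrightarrow> x * y \<notin> P"
  by (auto simp: prime_in_def)

lemma (in sub_ring) prime_compl_power: "prime_in R P \<Longrightarrow> x \<in> R - P \<Longrightarrow> x ^ k \<in> R - P"
  by (induction k) (auto simp: prime_not_one dest: prime_inD(3))

lemma (in sub_ring) prime_compl_prod:
  "prime_in R P \<Longrightarrow> (\<And>i. i \<in> A \<Longrightarrow> f i \<in> R - P) \<Longrightarrow> prod f A \<in> R - P"
  by (induction A rule: infinite_finite_induct) (auto simp: prime_not_one dest: prime_inD(3))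

lemma ideal_contract:
  "sub_ring R \<Longrightarrow> R \<subseteq> S \<Longrightarrow> ideal_in S I \<Longrightarrow> ideal_in R (I \<inter> R)"
  by (auto simp: ideal_in_def sub_ring.zero sub_ring.add sub_ring.mult)

lemma prime_contract:
  assumes "sub_ring R" "R \<subseteq> S" "prime_in S P" shows "prime_in R (P \<inter> R)"
proof -
  have "1 \<in> R - P \<inter> R"
    using sub_ring.one[OF assms(1)] prime_not_one[OF assms(3)] by auto
  then show ?thesis
    using ideal_contract[of R S P] assms unfolding prime_in_def by blast
qed

lemma (in sub_ring) zero_prime: "prime_in R {0}"
proof -
  have "{0} \<noteq> R" using one by force
  then show ?thesis by (auto simp: prime_in_def ideal_in_def)
qed

text \<open>Finite generation as a minimality property instead of linear combinations: passing to
  contracted ideals then needs no bookkeeping of coefficients. \<open>fg_ideal_iff\<close> connects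
  it with \<open>gen_ideal\<close>.\<close>

definition fg_ideal :: "'f::field set \<Rightarrow> 'f set \<Rightarrow> bool" where
  "fg_ideal S I \<longleftrightarrow> (\<exists>A. finite A \<and> A \<subseteq> I \<and> (\<forall>J. ideal_in S J \<and> A \<subseteq> J \<longrightarrow> I \<subseteq> J))"

lemma (in sub_ring) ideal_gen_ideal:
  assumes "set gs \<subseteq> R" shows "ideal_in R (gen_ideal R gs)"
proof -
  have "0 \<in> gen_ideal R gs"
    unfolding gen_ideal_def by (rule CollectI, rule exI[of _ "\<lambda>_. 0"]) simp
  moreover have "x + y \<in> gen_ideal R gs"
    if x: "x \<in> gen_ideal R gs" and y: "y \<in> gen_ideal R gs" for x y
  proof -
    from x y obtain r s where "x = (\<Sum>i<length gs. r i * gs ! i)" "\<forall>i<length gs. r i \<in> R"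
      "y = (\<Sum>i<length gs. s i * gs ! i)" "\<forall>i<length gs. s i \<in> R"
      unfolding gen_ideal_def by auto
    then show ?thesis
      unfolding gen_ideal_def
      by (intro CollectI exI[of _ "\<lambda>i. r i + s i"]) (auto simp: sum.distrib algebra_simps)
  qed
  moreover have "c * x \<in> gen_ideal R gs" if c: "c \<in> R" and x: "x \<in> gen_ideal R gs" for c x
  proof -
    from x obtain r where "x = (\<Sum>i<length gs. r i * gs ! i)" "\<forall>i<length gs. r i \<in> R"
      unfolding gen_ideal_def by auto
    then show ?thesis
      unfolding gen_ideal_def using c
      by (intro CollectI exI[of _ "\<lambda>i. c * r i"]) (auto simp: sum_distrib_left mult.assoc)
  qed
  moreover have "gen_ideal R gs \<subseteq> R"
  proof
    fix x assume "x \<in> gen_ideal R gs"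
    then obtain r where r: "x = (\<Sum>i<length gs. r i * gs ! i)" "\<forall>i<length gs. r i \<in> R"
      unfolding gen_ideal_def by auto
    have "gs ! i \<in> R" if "i < length gs" for i using assms nth_mem[OF that] by blast
    then show "x \<in> R" unfolding r(1) using r(2) by (intro sum mult) auto
  qed
  ultimately show ?thesis unfolding ideal_in_def by blast
qed

lemma (in sub_ring) gen_ideal_incl: "set gs \<subseteq> gen_ideal R gs"
proof
  fix x assume "x \<in> set gs"
  then obtain j where j: "j < length gs" "x = gs ! j" by (auto simp: in_set_conv_nth)
  have "(\<Sum>i<length gs. (if i = j then 1 else 0) * gs ! i) = (\<Sum>i<length gs. if i = j then gs ! i else 0)"
    by (intro sum.cong) auto
  then have "x = (\<Sum>i<length gs. (if i = j then 1 else 0) * gs ! i)"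
    using j by simp
  then show "x \<in> gen_ideal R gs"
    unfolding gen_ideal_def by (intro CollectI exI[of _ "\<lambda>i. if i = j then 1 else 0"]) auto
qed

lemma gen_ideal_least: "ideal_in S I \<Longrightarrow> set gs \<subseteq> I \<Longrightarrow> gen_ideal S gs \<subseteq> I"
  unfolding gen_ideal_def by (auto intro!: ideal_sum[of S] ideal_inD(4)[of S])

lemma (in sub_ring) fg_ideal_iff:
  assumes "ideal_in R I"
  shows "fg_ideal R I \<longleftrightarrow> (\<exists>gs. set gs \<subseteq> I \<and> I = gen_ideal R gs)"
proof
  assume "fg_ideal R I"
  then obtain A where A: "finite A" "A \<subseteq> I" "\<And>J. ideal_in R J \<Longrightarrow> A \<subseteq> J \<Longrightarrow> I \<subseteq> J"
    unfolding fg_ideal_def by auto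
  obtain gs where gs: "set gs = A" using finite_list[OF A(1)] by auto
  have "set gs \<subseteq> R" using gs A(2) ideal_inD(1)[OF assms] by auto
  then have "I \<subseteq> gen_ideal R gs"
    using A(3)[OF ideal_gen_ideal] gen_ideal_incl[of gs] gs by auto
  then have "I = gen_ideal R gs"
    using gen_ideal_least[OF assms, of gs] gs A(2) by auto
  then show "\<exists>gs. set gs \<subseteq> I \<and> I = gen_ideal R gs" using gs A by auto
next
  assume "\<exists>gs. set gs \<subseteq> I \<and> I = gen_ideal R gs"
  then obtain gs where "set gs \<subseteq> I" "I = gen_ideal R gs" by auto
  then show "fg_ideal R I"
    unfolding fg_ideal_def using gen_ideal_least by (intro exI[of _ "set gs"]) blast
qed

lemma (in sub_ring) noetherian_iff: "noetherian R \<longleftrightarrow> (\<forall>I. ideal_in R I \<longrightarrow> fg_ideal R I)"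
  unfolding noetherian_def using fg_ideal_iff by blast

text \<open>The argument is meant to be a subring or an ideal: for an ideal \<open>I\<close> of
  \<open>R\<close>, \<open>polys I\<close> and \<open>adj I y\<close> are its extensions to R[T] and
  R[y].\<close>

definition polys :: "'f::field set \<Rightarrow> 'f poly set" where
  "polys R = {h. \<forall>i. coeff h i \<in> R}"

definition adj :: "'f::field set \<Rightarrow> 'f \<Rightarrow> 'f set" where
  "adj R y = (\<lambda>h. poly h y) ` polys R"

definition transc :: "'f::field set \<Rightarrow> 'f \<Rightarrow> bool" where
  "transc R y \<longleftrightarrow> (\<forall>h\<in>polys R. poly h y = 0 \<longrightarrow> h = 0)"

lemma polysD: "h \<in> polys R \<Longrightarrow> coeff h i \<in> R"
  by (simp add: polys_def)

lemma adjI: "h \<in> polys R \<Longrightarrow> poly h y \<in> adj R y"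
  by (auto simp: adj_def)

lemma transcD:
  assumes "transc R y" "sub_ring R" "g \<in> polys R" "h \<in> polys R" "poly g y = poly h y"
  shows "g = h"
proof -
  have "g - h \<in> polys R" using assms by (auto simp: polys_def sub_ring.diff)
  then show ?thesis using assms(1,5) by (auto simp: transc_def)
qed

lemma ideal_polys_mult:
  assumes "ideal_in R I" "f \<in> polys R" "g \<in> polys I" shows "f * g \<in> polys I"
  unfolding polys_def
  by (auto simp: coeff_mult intro!: ideal_sum[OF assms(1)] ideal_inD(4)[OF assms(1)]
      polysD[OF assms(2)] polysD[OF assms(3)])

lemma ideal_polys_add:
  assumes "ideal_in R I" "f \<in> polys I" "g \<in> polys I" shows "f + g \<in> polys I"
  using assms by (auto simp: polys_def ideal_inD(3))

context sub_ring
begin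

lemma polys_const: "c \<in> R \<Longrightarrow> [:c:] \<in> polys R"
  by (auto simp: polys_def coeff_pCons split: nat.split)

lemma polys_monom: "c \<in> R \<Longrightarrow> monom c d \<in> polys R"
  by (auto simp: polys_def)

lemma polys_add: "f \<in> polys R \<Longrightarrow> g \<in> polys R \<Longrightarrow> f + g \<in> polys R"
  by (auto simp: polys_def)

lemma polys_diff: "f \<in> polys R \<Longrightarrow> g \<in> polys R \<Longrightarrow> f - g \<in> polys R"
  by (auto simp: polys_def)

lemma polys_mult: "f \<in> polys R \<Longrightarrow> g \<in> polys R \<Longrightarrow> f * g \<in> polys R"
  by (auto simp: polys_def coeff_mult intro!: sum)

lemma polys_smult: "c \<in> R \<Longrightarrow> g \<in> polys R \<Longrightarrow> Polynomial.smult c g \<in> polys R"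
  by (auto simp: polys_def)

lemma sub_adj: "R \<subseteq> adj R y"
proof
  fix c assume "c \<in> R"
  from adjI[OF polys_const[OF this], of y] show "c \<in> adj R y" by simp
qed

lemma gen_adj: "y \<in> adj R y"
proof -
  have "monom 1 1 \<in> polys R" by (intro polys_monom) simp
  from adjI[OF this, of y] show ?thesis by (simp add: poly_monom)
qed

lemma sub_ring_adj: "sub_ring (adj R y)"
proof
  show "0 \<in> adj R y" "1 \<in> adj R y" using sub_adj by auto
  fix u v assume "u \<in> adj R y" "v \<in> adj R y"
  then obtain f g where fg: "f \<in> polys R" "g \<in> polys R" "u = poly f y" "v = poly g y"
    by (auto simp: adj_def)
  show "u + v \<in> adj R y" using adjI[OF polys_add[OF fg(1,2)], of y] fg by simp
  show "u * v \<in> adj R y" using adjI[OF polys_mult[OF fg(1,2)], of y] fg by simp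
  have "Polynomial.smult (-1) f \<in> polys R" using fg by (intro polys_smult) auto
  from adjI[OF this, of y] show "- u \<in> adj R y" using fg by simp
qed

text \<open>By transcendence, an element of \<open>R\<close> is the value of its constant polynomial
  only.\<close>

lemma adj_contract:
  assumes "transc R y" "p \<subseteq> R" "0 \<in> p" shows "adj p y \<inter> R = p"
proof
  show "adj p y \<inter> R \<subseteq> p"
  proof
    fix c assume c: "c \<in> adj p y \<inter> R"
    then obtain h where h: "h \<in> polys p" "c = poly h y" by (auto simp: adj_def)
    have "h \<in> polys R" using h assms by (auto simp: polys_def)
    then have "h = [:c:]"
      using transcD[OF assms(1) sub_ring_axioms _ polys_const[of c]] c h by auto
    then show "c \<in> p" using polysD[OF h(1), of 0] by simp
  qed
  show "p \<subseteq> adj p y \<inter> R"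
  proof
    fix c assume c: "c \<in> p"
    have "[:c:] \<in> polys p" using c assms by (auto simp: polys_def coeff_pCons split: nat.split)
    from adjI[OF this, of y] show "c \<in> adj p y \<inter> R" using c assms by auto
  qed
qed

lemma ideal_adj:
  assumes "ideal_in R I" shows "ideal_in (adj R y) (adj I y)"
proof -
  have "adj I y \<subseteq> adj R y"
    using ideal_inD(1)[OF assms] by (auto simp: adj_def polys_def)
  moreover have "0 \<in> adj I y"
    using adjI[of 0 I y] ideal_inD(2)[OF assms] by (auto simp: polys_def)
  moreover have "u + v \<in> adj I y" if uv: "u \<in> adj I y" "v \<in> adj I y" for u v
  proof -
    from uv obtain f g where fg: "f \<in> polys I" "g \<in> polys I" "u = poly f y" "v = poly g y"
      by (auto simp: adj_def)
    show ?thesis using adjI[OF ideal_polys_add[OF assms fg(1,2)], of y] fg by simp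
  qed
  moreover have "u * v \<in> adj I y" if uv: "u \<in> adj R y" "v \<in> adj I y" for u v
  proof -
    from uv obtain f g where fg: "f \<in> polys R" "g \<in> polys I" "u = poly f y" "v = poly g y"
      by (auto simp: adj_def)
    show ?thesis using adjI[OF ideal_polys_mult[OF assms fg(1,2)], of y] fg by simp
  qed
  ultimately show ?thesis unfolding ideal_in_def by blast
qed

text \<open>Gauss: the product of the lowest coefficients outside the prime survives modulo the prime.\<close>
lemma polys_prime:
  assumes p: "prime_in R p" and f: "f \<in> polys R" "f \<notin> polys p" and g: "g \<in> polys R" "g \<notin> polys p"
  shows "f * g \<notin> polys p"
proof
  assume fg: "f * g \<in> polys p"
  note ip = prime_inD(1)[OF p]
  define i where "i = (LEAST i. coeff f i \<notin> p)"
  define j where "j = (LEAST i. coeff g i \<notin> p)"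
  have i: "coeff f i \<notin> p" using LeastI_ex[of "\<lambda>i. coeff f i \<notin> p"] f(2) unfolding i_def polys_def by blast
  have j: "coeff g j \<notin> p" using LeastI_ex[of "\<lambda>i. coeff g i \<notin> p"] g(2) unfolding j_def polys_def by blast
  have li: "coeff f k \<in> p" if "k < i" for k using not_less_Least[OF that[unfolded i_def]] by simp
  have lj: "coeff g k \<in> p" if "k < j" for k using not_less_Least[OF that[unfolded j_def]] by simp
  have "coeff (f * g) (i + j) = (\<Sum>k\<le>i+j. coeff f k * coeff g (i + j - k))"
    by (rule coeff_mult)
  also have "\<dots> = coeff f i * coeff g j + (\<Sum>k\<in>{..i+j}-{i}. coeff f k * coeff g (i + j - k))"
    by (subst sum.remove[of _ i]) auto
  finally have e: "coeff f i * coeff g j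
      = coeff (f * g) (i + j) - (\<Sum>k\<in>{..i+j}-{i}. coeff f k * coeff g (i + j - k))" by simp
  have "(\<Sum>k\<in>{..i+j}-{i}. coeff f k * coeff g (i + j - k)) \<in> p"
  proof (rule ideal_sum[OF ip])
    fix k assume "k \<in> {..i+j} - {i}"
    then consider "k < i" | "k > i" "i + j - k < j" by fastforce
    then show "coeff f k * coeff g (i + j - k) \<in> p"
      by cases (auto intro: ideal_inD(4,5)[OF ip] li lj polysD[OF f(1)] polysD[OF g(1)])
  qed
  then have ij: "coeff f i * coeff g j \<in> p"
    unfolding e using polysD[OF fg] by (intro ideal_diff[OF ip]) auto
  then show False using prime_inD(3)[OF p _ _ ij] i j polysD[OF f(1)] polysD[OF g(1)] by auto
qed

text \<open>Representing polynomials are unique by transcendence, so if a product lies in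
  \<open>adj p y\<close>, the product of the representing polynomials has coefficients in
  \<open>p\<close>, and \<open>polys_prime\<close> applies.\<close>

lemma prime_adj:
  assumes p: "prime_in R p" and y: "transc R y" shows "prime_in (adj R y) (adj p y)"
proof -
  note ip = prime_inD(1)[OF p]
  have "1 \<notin> adj p y"
    using adj_contract[OF y ideal_inD(1,2)[OF ip]] prime_not_one[OF p] one by blast
  then have "adj p y \<noteq> adj R y" using sub_adj one by blast
  moreover have "u \<in> adj p y \<or> v \<in> adj p y"
    if uv: "u \<in> adj R y" "v \<in> adj R y" "u * v \<in> adj p y" for u v
  proof -
    from uv obtain f g h where fg: "f \<in> polys R" "g \<in> polys R" "h \<in> polys p"
      "u = poly f y" "v = poly g y" "u * v = poly h y" by (auto simp: adj_def)
    have "h \<in> polys R" using fg(3) ideal_inD(1)[OF ip] by (auto simp: polys_def)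
    then have "f * g = h"
      using transcD[OF y sub_ring_axioms polys_mult[OF fg(1,2)], of h] fg by auto
    then have "f \<in> polys p \<or> g \<in> polys p" using polys_prime[OF p fg(1) _ fg(2)] fg(3) by auto
    then show ?thesis using fg by (auto intro: adjI)
  qed
  ultimately show ?thesis using ideal_adj[OF ip] unfolding prime_in_def by blast
qed

text \<open>The leading coefficient of \<open>f\<close> need not be invertible in \<open>R\<close>;
  every reduction step therefore costs one factor \<open>lead_coeff f\<close> on the side of
  \<open>h\<close>.\<close>

lemma pseudo_division:
  assumes f: "f \<in> polys R" "degree f > 0" and h: "h \<in> polys R"
  shows "\<exists>k. \<exists>g\<in>polys R. \<exists>r\<in>polys R. Polynomial.smult (lead_coeff f ^ k) h = f * g + r \<and> degree r < degree f"
  using h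
proof (induction "degree h" arbitrary: h rule: less_induct)
  case less
  show ?case
  proof (cases "degree h < degree f")
    case True
    then show ?thesis
      using less.prems by (intro exI[of _ 0] bexI[of _ 0] bexI[of _ h]) (auto simp: polys_def)
  next
    case False
    define c d where "c = lead_coeff f" and "d = degree h - degree f"
    have cR: "c \<in> R" unfolding c_def using f polysD by blast
    have lR: "lead_coeff h \<in> R" using less.prems polysD by blast
    define q where "q = monom (lead_coeff h) d"
    have q: "q \<in> polys R" unfolding q_def using lR by (rule polys_monom)
    define h' where "h' = Polynomial.smult c h - f * q"
    have h': "h' \<in> polys R" unfolding h'_def
      using cR q f less.prems by (intro polys_diff polys_mult polys_smult) auto
    have "degree (f * q) \<le> degree h"
      using degree_mult_le[of f q] degree_monom_le[of "lead_coeff h" d] False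
      unfolding q_def d_def by linarith
    then have "degree h' \<le> degree h"
      unfolding h'_def by (intro degree_diff_le) (auto intro: order_trans[OF degree_smult_le])
    moreover have "coeff h' (degree h) = 0"
      unfolding h'_def q_def using False
      by (simp add: c_def d_def coeff_monom_mult mult.commute[of f])
    ultimately have "degree h' < degree h"
      using f(2) False coeff_0_degree_minus_1[of h' "degree h"] by auto
    from less.hyps[OF this h'] obtain k g r where IH: "g \<in> polys R" "r \<in> polys R"
      "Polynomial.smult (c ^ k) h' = f * g + r" "degree r < degree f" unfolding c_def by blast
    have "Polynomial.smult (c ^ Suc k) h = Polynomial.smult (c ^ k) (h' + f * q)"
      by (simp add: h'_def mult.commute)
    also have "\<dots> = f * (g + Polynomial.smult (c ^ k) q) + r"
      by (simp add: smult_add_right IH(3) algebra_simps)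
    finally show ?thesis
      using IH q cR unfolding c_def
      by (intro exI[of _ "Suc k"] bexI[of _ "g + Polynomial.smult (lead_coeff f ^ k) q"] bexI[of _ r])
        (auto intro!: polys_add polys_smult)
  qed
qed

text \<open>A leading term with coefficient in \<open>p\<close> has its value in \<open>Q\<close>,
  so removing it preserves membership in \<open>Q\<close>. The process stops because some
  coefficient lies outside \<open>p\<close>.\<close>

lemma drop_top_coeffs:
  assumes Q: "ideal_in (adj R y) Q" and p: "p \<subseteq> Q" "p \<subseteq> R"
    and h: "h \<in> polys R" "h \<notin> polys p" "poly h y \<in> Q" and p0: "0 \<in> p"
  shows "\<exists>h'\<in>polys R. poly h' y \<in> Q \<and> lead_coeff h' \<notin> p \<and> degree h' \<le> degree h"
  using h
proof (induction "degree h" arbitrary: h rule: less_induct)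
  case less
  interpret A: sub_ring "adj R y" by (rule sub_ring_adj)
  show ?case
  proof (cases "lead_coeff h \<in> p")
    case False
    then show ?thesis using less.prems by auto
  next
    case True
    define h' where "h' = h - monom (lead_coeff h) (degree h)"
    have h': "h' \<in> polys R" unfolding h'_def
      using less.prems True p by (intro polys_diff polys_monom) auto
    have d: "degree h' < degree h"
    proof -
      have "degree h \<noteq> 0"
      proof
        assume "degree h = 0"
        then have "coeff h i \<in> p" for i
          using True p0 by (cases i) (auto simp: coeff_eq_0)
        then show False using less.prems by (auto simp: polys_def)
      qed
      moreover have "degree h' \<le> degree h"
        unfolding h'_def by (intro degree_diff_le) (auto simp: degree_monom_le)
      moreover have "coeff h' (degree h) = 0" by (simp add: h'_def)
      ultimately show ?thesis using coeff_0_degree_minus_1[of h' "degree h"] by auto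
    qed
    have n: "h' \<notin> polys p"
    proof
      assume a: "h' \<in> polys p"
      have "coeff h i \<in> p" for i
        using polysD[OF a, of i] True by (cases "i = degree h") (auto simp: h'_def)
      then show False using less.prems by (auto simp: polys_def)
    qed
    have "lead_coeff h * y ^ degree h \<in> Q"
      using ideal_inD(5)[OF Q, of "y ^ degree h"] A.power[OF gen_adj] True p by auto
    then have "poly h' y \<in> Q"
      unfolding h'_def using less.prems(3) A.ideal_diff[OF Q] by (auto simp: poly_monom)
    from less.hyps[OF d h' n this] d show ?thesis by (meson less_imp_le order_trans)
  qed
qed

text \<open>The residue class of \<open>y\<close> is algebraic over that of \<open>R\<close> modulo
  \<open>Q\<close>: the relation \<open>h\<close> must not vanish coefficientwise modulo
  \<open>Q\<close>.\<close>

definition alg_mod where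
  "alg_mod Q y \<longleftrightarrow> (\<exists>h\<in>polys R. h \<notin> polys Q \<and> poly h y \<in> Q)"

text \<open>\<open>f\<close> is the minimal polynomial of \<open>y\<close> modulo \<open>Q\<close>,
  cleared of denominators. A remainder of smaller degree whose value lies in \<open>Q\<close>
  vanishes coefficientwise modulo \<open>Q\<close>, so up to multipliers outside \<open>Q\<close>
  the single element \<open>poly f y\<close> generates \<open>Q\<close> over its
  contraction.\<close>

lemma min_poly_mod:
  assumes Q: "prime_in (adj R y) Q" and alg: "alg_mod Q y"
  obtains f where "f \<in> polys R" "poly f y \<in> Q" "lead_coeff f \<notin> Q" "degree f > 0"
    "\<And>h. h \<in> polys R \<Longrightarrow> poly h y \<in> Q \<Longrightarrow> degree h < degree f \<Longrightarrow> h \<in> polys Q"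
    "\<And>h. h \<in> polys R \<Longrightarrow> poly h y \<in> Q \<Longrightarrow>
      \<exists>s\<in>R - Q. \<exists>g\<in>polys R. \<exists>r\<in>polys R. r \<in> polys Q \<and> Polynomial.smult s h = f * g + r \<and> degree r < degree f"
proof -
  interpret A: sub_ring "adj R y" by (rule sub_ring_adj)
  note iQ = prime_inD(1)[OF Q]
  define p where "p = Q \<inter> R"
  have p: "prime_in R p"
    unfolding p_def by (rule prime_contract[OF sub_ring_axioms sub_adj Q])
  have ppQ: "polys R \<inter> polys Q = polys R \<inter> polys p" by (auto simp: polys_def p_def)
  note drop = drop_top_coeffs[OF iQ, of p, OF _ _ _ _ _ ideal_inD(2)[OF prime_inD(1)[OF p]]]
  define M where "M = {f \<in> polys R. poly f y \<in> Q \<and> lead_coeff f \<notin> p}"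
  obtain h where "h \<in> polys R" "h \<notin> polys p" "poly h y \<in> Q"
    using alg ppQ unfolding alg_mod_def by blast
  with drop[of h] have "M \<noteq> {}" unfolding M_def p_def by auto
  then obtain f where f: "f \<in> M" "\<And>g. g \<in> M \<Longrightarrow> degree f \<le> degree g"
    using ex_has_least_nat[of "\<lambda>f. f \<in> M" _ degree] by blast
  have f1: "f \<in> polys R" "poly f y \<in> Q" "lead_coeff f \<notin> p" using f(1) by (auto simp: M_def)
  then have f2: "lead_coeff f \<in> R - Q" using polysD[of f R] by (auto simp: p_def)
  have f3: "degree f > 0"
  proof (rule ccontr)
    assume "\<not> degree f > 0"
    then obtain c where "f = [:c:]" by (auto elim: degree_eq_zeroE)
    then show False using f1 f2 by auto
  qed
  have mn: "h \<in> polys Q" if h: "h \<in> polys R" "poly h y \<in> Q" "degree h < degree f" for h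
  proof (rule ccontr)
    assume "h \<notin> polys Q"
    then have "h \<notin> polys p" using h ppQ by blast
    from drop[OF _ _ h(1) this h(2)] obtain h' where "h' \<in> M" "degree h' \<le> degree h"
      unfolding M_def p_def by auto
    then show False using f(2)[of h'] h(3) by auto
  qed
  show ?thesis
  proof (rule that[OF f1(1,2) _ f3 mn])
    show "lead_coeff f \<notin> Q" using f2 by auto
    fix h assume h: "h \<in> polys R" "poly h y \<in> Q"
    from pseudo_division[OF f1(1) f3 h(1)] obtain k g r where gr: "g \<in> polys R" "r \<in> polys R"
      "Polynomial.smult (lead_coeff f ^ k) h = f * g + r" "degree r < degree f" by blast
    have s: "lead_coeff f ^ k \<in> R - Q"
      using prime_compl_power[OF p, of "lead_coeff f" k] f2 by (auto simp: p_def)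
    have "poly r y = lead_coeff f ^ k * poly h y - poly f y * poly g y"
      using arg_cong[OF gr(3), of "\<lambda>q. poly q y"] by simp
    also have "\<dots> \<in> Q"
      using s sub_adj[of y] h f1 gr
      by (intro A.ideal_diff[OF iQ] ideal_inD(4,5)[OF iQ]) (auto intro: adjI)
    finally have "r \<in> polys Q" using mn gr by auto
    then show "\<exists>s\<in>R - Q. \<exists>g\<in>polys R. \<exists>r\<in>polys R. r \<in> polys Q \<and> Polynomial.smult s h = f * g + r \<and> degree r < degree f"
      using s gr by blast
  qed
qed

text \<open>Let \<open>f\<close> and \<open>f'\<close> be minimal polynomials modulo
  \<open>P\<close> and \<open>Q\<close>. Dividing \<open>f\<close> by \<open>f'\<close> shows that
  \<open>f' * g\<close> has its value in \<open>P\<close>. A degree count excludes that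
  \<open>g\<close> is responsible, so the value of \<open>f'\<close> is in \<open>P\<close>, and
  with it every element of \<open>Q\<close>.\<close>

lemma prime_eq_if_contract_eq:
  assumes P: "prime_in (adj R y) P" and Q: "prime_in (adj R y) Q" and PQ: "P \<subseteq> Q"
    and eq: "P \<inter> R = Q \<inter> R" and alg: "alg_mod P y"
  shows "P = Q"
proof -
  note iP = prime_inD(1)[OF P] note iQ = prime_inD(1)[OF Q]
  interpret A: sub_ring "adj R y" by (rule sub_ring_adj)
  have pe: "h \<in> polys P \<longleftrightarrow> h \<in> polys Q" if "h \<in> polys R" for h
    using that eq by (auto simp: polys_def)
  have polyP: "poly h y \<in> P" if "h \<in> polys R" "h \<in> polys P" for h
  proof -
    have "poly h y = (\<Sum>i\<le>degree h. coeff h i * y ^ i)" by (simp add: poly_altdef)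
    also have "\<dots> \<in> P"
      using that by (intro ideal_sum[OF iP] ideal_inD(5)[OF iP] A.power gen_adj) (auto simp: polys_def)
    finally show ?thesis .
  qed
  have algQ: "alg_mod Q y" using alg pe PQ unfolding alg_mod_def by blast
  from min_poly_mod[OF P alg] obtain f where f: "f \<in> polys R" "poly f y \<in> P" "lead_coeff f \<notin> P" 
    "degree f > 0" "\<And>h. h \<in> polys R \<Longrightarrow> poly h y \<in> P \<Longrightarrow> degree h < degree f \<Longrightarrow> h \<in> polys P"
    by metis
  from min_poly_mod[OF Q algQ] obtain f' where f': "f' \<in> polys R" "poly f' y \<in> Q" "lead_coeff f' \<notin> Q" 
    "degree f' > 0" "\<And>h. h \<in> polys R \<Longrightarrow> poly h y \<in> Q \<Longrightarrow> degree h < degree f' \<Longrightarrow> h \<in> polys Q"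
    "\<And>h. h \<in> polys R \<Longrightarrow> poly h y \<in> Q \<Longrightarrow>
      \<exists>s\<in>R - Q. \<exists>g\<in>polys R. \<exists>r\<in>polys R. r \<in> polys Q \<and> Polynomial.smult s h = f' * g + r \<and> degree r < degree f'"
    by metis
  from f'(6)[OF f(1)] f(2) PQ obtain s g r where g: "s \<in> R - Q" "g \<in> polys R" "r \<in> polys R"
    "r \<in> polys Q" "Polynomial.smult s f = f' * g + r" "degree r < degree f'" by blast
  have rP: "poly r y \<in> P" using g pe polyP by auto
  have "poly f' y * poly g y = s * poly f y - poly r y"
    using arg_cong[OF g(5), of "\<lambda>q. poly q y"] by simp
  also have "\<dots> \<in> P"
    using g(1) f(2) rP sub_adj[of y] by (intro A.ideal_diff[OF iP] ideal_inD(4)[OF iP]) auto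
  finally have fg: "poly f' y \<in> P \<or> poly g y \<in> P"
    using prime_inD(3)[OF P _ _ ] f'(1) g(2) adjI by blast
  have f'P: "poly f' y \<in> P"
  proof (rule ccontr)
    assume "poly f' y \<notin> P"
    then have gP: "poly g y \<in> P" using fg by auto
    have sfQ: "Polynomial.smult s f \<notin> polys Q"
    proof
      assume "Polynomial.smult s f \<in> polys Q"
      then have "s * lead_coeff f \<in> Q" using polysD[of "Polynomial.smult s f" Q "degree f"] by simp
      then have "lead_coeff f \<in> Q" 
        using prime_inD(3)[OF Q, of s "lead_coeff f"] g(1) polysD[OF f(1)] sub_adj by blast
      then show False using f(3) eq polysD[OF f(1)] by auto
    qed
    have gQ: "g \<notin> polys Q"
    proof
      assume "g \<in> polys Q"
      then have "f' * g \<in> polys (Q \<inter> R)"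
        using g(2) f'(1) by (intro ideal_polys_mult[OF ideal_contract[OF sub_ring_axioms sub_adj iQ]])
          (auto simp: polys_def)
      then have "f' * g + r \<in> polys Q" using g(3,4) ideal_inD(3)[OF iQ] by (auto simp: polys_def)
      then show False using sfQ g(5) by simp
    qed
    \<comment> \<open>By minimality of \<open>f\<close> the factor \<open>g\<close> is no shorter
      than \<open>f\<close>, so \<open>f' * g\<close> would have degree above
      \<open>degree f\<close>; yet it equals a multiple of \<open>f\<close> minus a short
      remainder.\<close>
    have dg: "degree g \<ge> degree f"
      using f(5)[OF g(2) gP] gQ pe[OF g(2)] by (meson not_less)
    have "degree f' \<le> degree f"
    proof (rule ccontr)
      assume "\<not> degree f' \<le> degree f"
      then have "f \<in> polys Q" using f'(5)[OF f(1)] f(2) PQ by auto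
      then show False using f(3) pe[OF f(1)] polysD by blast
    qed
    then have "degree (Polynomial.smult s f - r) \<le> degree f"
      using g(6) by (intro degree_diff_le) (auto intro: order_trans[OF degree_smult_le])
    moreover have "Polynomial.smult s f - r = f' * g" using g(5) by simp
    moreover have "f' \<noteq> 0" "g \<noteq> 0" using f'(4) dg f(4) by auto
    ultimately show False using f'(4) dg by (simp add: degree_mult_eq)
  qed
  show ?thesis
  proof (rule antisym[OF PQ], rule subsetI)
    fix x assume x: "x \<in> Q"
    then obtain h where h: "h \<in> polys R" "x = poly h y" using ideal_inD(1)[OF iQ] by (auto simp: adj_def)
    from f'(6)[OF h(1)] x h obtain s g r where g: "s \<in> R - Q" "g \<in> polys R" "r \<in> polys R"
      "r \<in> polys Q" "Polynomial.smult s h = f' * g + r" by blast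
    have "s * x = poly f' y * poly g y + poly r y"
      using arg_cong[OF g(5), of "\<lambda>q. poly q y"] h by simp
    also have "\<dots> \<in> P"
      using f'P g pe polyP by (intro ideal_inD(3)[OF iP] ideal_inD(5)[OF iP]) (auto intro: adjI)
    finally show "x \<in> P"
      using prime_inD(3)[OF P, of s x] g(1) PQ sub_adj[of y] x ideal_inD(1)[OF iQ] by blast
  qed
qed

end

section \<open>Hilbert's basis theorem and noetherian rings of fractions\<close>

context sub_ring
begin

text \<open>Bounding the degree by \<open>d\<close> instead of fixing it keeps 0 and sums inside, so
  this is an ideal. As \<open>y\<close> may be algebraic, one element of \<open>J\<close> can
  contribute through several polynomials.\<close>

definition lead_coeffs :: "'f \<Rightarrow> 'f set \<Rightarrow> nat \<Rightarrow> 'f set" where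
  "lead_coeffs y J d = {coeff g d | g. g \<in> polys R \<and> poly g y \<in> J \<and> (\<forall>i>d. coeff g i = 0)}"

lemma ideal_lead_coeffs:
  assumes J: "ideal_in (adj R y) J" shows "ideal_in R (lead_coeffs y J d)"
  unfolding ideal_in_def
proof (intro conjI ballI)
  note L = lead_coeffs_def[of y J d]
  show "lead_coeffs y J d \<subseteq> R" by (auto simp: L polys_def)
  show "0 \<in> lead_coeffs y J d"
    unfolding L using ideal_inD(2)[OF J] by (intro CollectI exI[of _ 0]) (auto simp: polys_def)
  fix a assume "a \<in> lead_coeffs y J d"
  then obtain f where f: "f \<in> polys R" "poly f y \<in> J" "\<forall>i>d. coeff f i = 0" "a = coeff f d"
    by (auto simp: L)
  show "a + b \<in> lead_coeffs y J d" if "b \<in> lead_coeffs y J d" for b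
  proof -
    from that obtain g where g: "g \<in> polys R" "poly g y \<in> J" "\<forall>i>d. coeff g i = 0" "b = coeff g d"
      by (auto simp: L)
    show ?thesis
      unfolding L using f g ideal_inD(3)[OF J]
      by (intro CollectI exI[of _ "f + g"]) (auto intro: polys_add)
  qed
  show "c * a \<in> lead_coeffs y J d" if "c \<in> R" for c
    unfolding L using f that ideal_inD(4)[OF J subsetD[OF sub_adj that] f(2)]
    by (intro CollectI exI[of _ "Polynomial.smult c f"]) (auto intro: polys_smult)
qed

lemma lead_coeffs_mono:
  assumes J: "ideal_in (adj R y) J" and de: "d \<le> e"
  shows "lead_coeffs y J d \<subseteq> lead_coeffs y J e"
proof
  fix a assume "a \<in> lead_coeffs y J d"
  then obtain f where f: "f \<in> polys R" "poly f y \<in> J" "\<forall>i>d. coeff f i = 0" "a = coeff f d"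
    by (auto simp: lead_coeffs_def)
  have m: "monom 1 (e - d) \<in> polys R" by (intro polys_monom) simp
  have "poly (monom 1 (e - d) * f) y \<in> J"
    using ideal_inD(4)[OF J adjI[OF m] f(2)] by simp
  then show "a \<in> lead_coeffs y J e"
    unfolding lead_coeffs_def using f de polys_mult[OF m f(1)]
    by (intro CollectI exI[of _ "monom 1 (e - d) * f"]) (auto simp: coeff_monom_mult)
qed

lemma ideal_Int: "ideal_in S I \<Longrightarrow> ideal_in S J \<Longrightarrow> ideal_in S (I \<inter> J)"
  by (auto simp: ideal_in_def)

text \<open>Descent on the degree bound: subtracting an element of \<open>J\<close> with the same
  top coefficient shortens the representing polynomial.\<close>

lemma subset_if_lead_coeffs_subset:
  assumes I: "ideal_in (adj R y) I" and J: "ideal_in (adj R y) J" and JI: "J \<subseteq> I"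
    and L: "\<And>d. lead_coeffs y I d \<subseteq> lead_coeffs y J d"
  shows "I \<subseteq> J"
proof -
  interpret A: sub_ring "adj R y" by (rule sub_ring_adj)
  have *: "poly f y \<in> J" if "f \<in> polys R" "poly f y \<in> I" "\<forall>i\<ge>d. coeff f i = 0" for f d
    using that
  proof (induction d arbitrary: f)
    case 0
    then have "f = 0" by (simp add: poly_eq_iff)
    then show ?case using ideal_inD(2)[OF J] by simp
  next
    case (Suc d)
    then have "coeff f d \<in> lead_coeffs y I d" by (auto simp: lead_coeffs_def)
    then obtain g where g: "g \<in> polys R" "poly g y \<in> J" "\<forall>i>d. coeff g i = 0" "coeff f d = coeff g d"
      using L[of d] by (auto simp: lead_coeffs_def)
    have "\<forall>i\<ge>d. coeff (f - g) i = 0"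
    proof (intro allI impI)
      fix i assume "i \<ge> d"
      then show "coeff (f - g) i = 0"
        using Suc.prems(3) g(3,4) by (cases "i = d") auto
    qed
    moreover have "poly (f - g) y \<in> I"
      using A.ideal_diff[OF I Suc.prems(2), of "poly g y"] g(2) JI by auto
    ultimately have "poly (f - g) y \<in> J" using Suc.IH polys_diff Suc.prems(1) g(1) by blast
    then show ?case using ideal_inD(3)[OF J _ g(2)] by force
  qed
  show ?thesis
  proof
    fix x assume "x \<in> I"
    then obtain h where h: "h \<in> polys R" "x = poly h y" using ideal_inD(1)[OF I] by (auto simp: adj_def)
    show "x \<in> J" using *[of h "Suc (degree h)"] h \<open>x \<in> I\<close> by (auto simp: coeff_eq_0)
  qed
qed

text \<open>Hilbert's argument: the ideals of leading coefficients increase with the degree and are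
  constant from some \<open>D\<close> on, because their union is finitely generated. Lifts
  \<open>G d b\<close> of generators for all degrees up to \<open>D\<close> recover every leading
  coefficient.\<close>

lemma noetherian_adj:
  assumes N: "noetherian R" shows "noetherian (adj R y)"
proof -
  interpret A: sub_ring "adj R y" by (rule sub_ring_adj)
  have "fg_ideal (adj R y) I" if I: "ideal_in (adj R y) I" for I
  proof -
    let ?L = "lead_coeffs y I"
    have fg: "fg_ideal R J" if "ideal_in R J" for J using N that noetherian_iff by blast
    have mono: "?L d \<subseteq> ?L e" if "d \<le> e" for d e using lead_coeffs_mono[OF I that] .
    have iL: "ideal_in R (?L d)" for d by (rule ideal_lead_coeffs[OF I])
    have "ideal_in R (\<Union>d. ?L d)"
      unfolding ideal_in_def
    proof (intro conjI ballI)
      show "(\<Union>d. ?L d) \<subseteq> R" "0 \<in> (\<Union>d. ?L d)" using ideal_inD(1,2)[OF iL] by auto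
      fix a assume "a \<in> (\<Union>d. ?L d)"
      then obtain d where d: "a \<in> ?L d" by auto
      show "a + b \<in> (\<Union>d. ?L d)" if "b \<in> (\<Union>d. ?L d)" for b
      proof -
        from that obtain e where e: "b \<in> ?L e" by auto
        have "a + b \<in> ?L (max d e)"
          using d e mono[of d "max d e"] mono[of e "max d e"] by (intro ideal_inD(3)[OF iL]) auto
        then show ?thesis by auto
      qed
      show "c * a \<in> (\<Union>d. ?L d)" if "c \<in> R" for c using ideal_inD(4)[OF iL that d] by auto
    qed
    from fg[OF this] obtain A where A: "finite A" "A \<subseteq> (\<Union>d. ?L d)"
      "\<And>J. ideal_in R J \<Longrightarrow> A \<subseteq> J \<Longrightarrow> (\<Union>d. ?L d) \<subseteq> J" unfolding fg_ideal_def by auto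
    have "\<exists>D. A \<subseteq> ?L D"
      using A(1,2)
    proof (induction A)
      case (insert a A)
      then obtain D d where D: "A \<subseteq> ?L D" "a \<in> ?L d" by auto
      then have "insert a A \<subseteq> ?L (max D d)" using mono[of D "max D d"] mono[of d "max D d"] by auto
      then show ?case by blast
    qed auto
    then obtain D where "A \<subseteq> ?L D" by auto
    from A(3)[OF iL this] have D: "?L d \<subseteq> ?L D" for d by auto
    have "\<forall>d. \<exists>B. finite B \<and> B \<subseteq> ?L d \<and> (\<forall>J. ideal_in R J \<and> B \<subseteq> J \<longrightarrow> ?L d \<subseteq> J)"
      using fg[OF iL] unfolding fg_ideal_def by blast
    then obtain B where B: "\<And>d. finite (B d)" "\<And>d. B d \<subseteq> ?L d"
      "\<And>d J. ideal_in R J \<Longrightarrow> B d \<subseteq> J \<Longrightarrow> ?L d \<subseteq> J" by metis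
    have "\<forall>d. \<forall>b\<in>B d. \<exists>g. g \<in> polys R \<and> poly g y \<in> I \<and> (\<forall>i>d. coeff g i = 0) \<and> b = coeff g d"
    proof (intro allI ballI)
      fix d b assume "b \<in> B d"
      then have "b \<in> ?L d" using B(2) by auto
      then show "\<exists>g. g \<in> polys R \<and> poly g y \<in> I \<and> (\<forall>i>d. coeff g i = 0) \<and> b = coeff g d"
        by (auto simp: lead_coeffs_def)
    qed
    then obtain G where G: "\<And>d b. b \<in> B d \<Longrightarrow> G d b \<in> polys R" "\<And>d b. b \<in> B d \<Longrightarrow> poly (G d b) y \<in> I"
      "\<And>d b. b \<in> B d \<Longrightarrow> \<forall>i>d. coeff (G d b) i = 0" "\<And>d b. b \<in> B d \<Longrightarrow> b = coeff (G d b) d"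
      by metis
    define E where "E = (\<Union>d\<le>D. (\<lambda>b. poly (G d b) y) ` B d)"
    have "I \<subseteq> J" if J: "ideal_in (adj R y) J" "E \<subseteq> J" for J
    proof -
      \<comment> \<open>The comparison of leading coefficients needs a subideal of \<open>I\<close>,
        hence \<open>I \<inter> J\<close> in place of \<open>J\<close>.\<close>
      have i: "ideal_in (adj R y) (I \<inter> J)" using ideal_Int[OF I J(1)] .
      have 1: "?L d \<subseteq> lead_coeffs y (I \<inter> J) d" if "d \<le> D" for d
      proof (rule B(3)[OF ideal_lead_coeffs[OF i]], rule subsetI)
        fix b assume b: "b \<in> B d"
        then have "poly (G d b) y \<in> I \<inter> J" using G(2)[OF b] J(2) that unfolding E_def by auto
        then show "b \<in> lead_coeffs y (I \<inter> J) d"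
          unfolding lead_coeffs_def using G[OF b] by blast
      qed
      have 2: "?L d \<subseteq> lead_coeffs y (I \<inter> J) d" for d
      proof (cases "d \<le> D")
        case False
        have "?L d \<subseteq> ?L D" by (rule D)
        also have "\<dots> \<subseteq> lead_coeffs y (I \<inter> J) D" by (rule 1) simp
        also have "\<dots> \<subseteq> lead_coeffs y (I \<inter> J) d" using lead_coeffs_mono[OF i] False by simp
        finally show ?thesis .
      qed (rule 1)
      have "I \<subseteq> I \<inter> J" by (rule subset_if_lead_coeffs_subset[OF I i _ 2]) auto
      then show ?thesis by auto
    qed
    moreover have "finite E" "E \<subseteq> I" unfolding E_def using B(1) G(2) by auto
    ultimately show ?thesis unfolding fg_ideal_def by blast
  qed
  then show ?thesis using A.noetherian_iff by blast
qed

text \<open>Denominators are units of \<open>T\<close>, so an ideal of \<open>T\<close> is generated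
  by its contraction to \<open>R\<close>.\<close>

lemma noetherian_fractions:
  assumes N: "noetherian R" and T: "sub_ring T" "R \<subseteq> T"
    and frac: "\<And>x. x \<in> T \<Longrightarrow> \<exists>s\<in>R. s \<noteq> 0 \<and> 1 / s \<in> T \<and> s * x \<in> R"
  shows "noetherian T"
proof -
  interpret T: sub_ring T by fact
  have "fg_ideal T I" if I: "ideal_in T I" for I
  proof -
    have "ideal_in R (I \<inter> R)" by (rule ideal_contract[OF sub_ring_axioms T(2) I])
    then obtain A where A: "finite A" "A \<subseteq> I \<inter> R" "\<And>J. ideal_in R J \<Longrightarrow> A \<subseteq> J \<Longrightarrow> I \<inter> R \<subseteq> J"
      using N noetherian_iff unfolding fg_ideal_def by metis
    have "I \<subseteq> J" if J: "ideal_in T J" "A \<subseteq> J" for J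
    proof
      fix x assume x: "x \<in> I"
      then have "x \<in> T" using ideal_inD(1)[OF I] by auto
      from frac[OF this] obtain s where s: "s \<in> R" "s \<noteq> 0" "1 / s \<in> T" "s * x \<in> R" by blast
      have "s * x \<in> I \<inter> R" using ideal_inD(4)[OF I _ x] s T(2) by auto
      then have "s * x \<in> J"
        using A(3)[OF ideal_contract[OF sub_ring_axioms T(2) J(1)]] A(2) J(2) by auto
      from ideal_inD(4)[OF J(1) s(3) this] s(2) show "x \<in> J" by simp
    qed
    then show ?thesis unfolding fg_ideal_def using A by blast
  qed
  then show ?thesis using T.noetherian_iff by blast
qed

end

text \<open>The primes \<open>q i\<close> become principal modulo \<open>q (i - 1)\<close> after localizing at \<open>P\<close>:
  the \<open>f i\<close> will be a regular system of parameters of the local ring at \<open>P\<close>.\<close>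
definition parameter_chain ::
    "'f::field set \<Rightarrow> 'f set \<Rightarrow> nat \<Rightarrow> (nat \<Rightarrow> 'f set) \<Rightarrow> (nat \<Rightarrow> 'f) \<Rightarrow> bool" where
  "parameter_chain R P e q f \<longleftrightarrow> q 0 = {0} \<and> q e = P \<and> (\<forall>i\<le>e. prime_in R (q i)) \<and>
     (\<forall>i<e. q i \<subseteq> q (Suc i) \<and> f i \<in> q (Suc i) - q i \<and>
        (\<forall>x\<in>q (Suc i). \<exists>s\<in>R - P. \<exists>a\<in>q i. \<exists>b\<in>R. s * x = a + b * f i))"

text \<open>Extending each member of the chain to polynomials in \<open>y\<close> leads up to the
  extension of \<open>Q \<inter> R\<close>. One step to \<open>Q\<close> remains, and the minimal
  polynomial of \<open>y\<close> modulo \<open>Q\<close> supplies its generator.\<close>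

lemma (in sub_ring) parameter_chain_adj:
  assumes ch: "parameter_chain R (Q \<inter> R) e q f" and y: "transc R y"
    and Q: "prime_in (adj R y) Q" and alg: "alg_mod Q y"
  shows "\<exists>q f. parameter_chain (adj R y) Q (Suc e) q f"
proof -
  interpret A: sub_ring "adj R y" by (rule sub_ring_adj)
  note iQ = prime_inD(1)[OF Q]
  have qp: "prime_in R (q i)" if "i \<le> e" for i using ch that by (auto simp: parameter_chain_def)
  have qe: "q e = Q \<inter> R" and q0: "q 0 = {0}" using ch by (auto simp: parameter_chain_def)
  have "R - Q \<inter> R = R - Q" by auto
  then have "\<forall>i<e. \<forall>x\<in>q (Suc i). \<exists>s\<in>R - Q. \<exists>a\<in>q i. \<exists>b\<in>R. s * x = a + b * f i"
    using ch by (simp add: parameter_chain_def)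
  then have qs: "q i \<subseteq> q (Suc i)" "f i \<in> q (Suc i) - q i"
    "\<And>x. x \<in> q (Suc i) \<Longrightarrow> \<exists>s\<in>R - Q. \<exists>a\<in>q i. \<exists>b\<in>R. s * x = a + b * f i" if "i < e" for i
    using ch that by (auto simp: parameter_chain_def)
  have qR: "q i \<subseteq> R" if "i \<le> e" for i using qp[OF that] by (simp add: prime_in_def ideal_in_def)
  have con: "adj (q i) y \<inter> R = q i" if "i \<le> e" for i
    using adj_contract[OF y qR[OF that]] ideal_inD(2)[OF prime_inD(1)[OF qp[OF that]]] by simp
  obtain g where g: "g \<in> polys R" "poly g y \<in> Q" "lead_coeff g \<notin> Q"
    "\<And>h. h \<in> polys R \<Longrightarrow> poly h y \<in> Q \<Longrightarrow>
      \<exists>s\<in>R - Q. \<exists>k\<in>polys R. \<exists>r\<in>polys R. r \<in> polys Q \<and> Polynomial.smult s h = g * k + r \<and> degree r < degree g"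
    using min_poly_mod[OF Q alg] by metis
  have polyQ: "poly h y \<in> Q" if "h \<in> polys (Q \<inter> R)" for h
  proof -
    have "poly h y = (\<Sum>i\<le>degree h. coeff h i * y ^ i)" by (simp add: poly_altdef)
    also have "\<dots> \<in> Q"
      using that by (intro ideal_sum[OF iQ] ideal_inD(5)[OF iQ] A.power gen_adj) (auto simp: polys_def)
    finally show ?thesis .
  qed
  define q' where "q' i = (if i \<le> e then adj (q i) y else Q)" for i
  define f' where "f' i = (if i < e then f i else poly g y)" for i
  have "parameter_chain (adj R y) Q (Suc e) q' f'"
    unfolding parameter_chain_def
  proof (intro conjI allI impI ballI)
    have "polys {0} = {0::'f poly}" by (auto simp: polys_def poly_eq_iff)
    then show "q' 0 = {0}" by (simp add: q'_def q0 adj_def)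
    show "q' (Suc e) = Q" by (simp add: q'_def)
    show "prime_in (adj R y) (q' i)" if "i \<le> Suc e" for i
      using that prime_adj[OF qp y] Q by (cases "i \<le> e") (auto simp: q'_def)
    fix i assume i: "i < Suc e"
    show "q' i \<subseteq> q' (Suc i)"
    proof (cases "i < e")
      case True
      then show ?thesis using qs(1)[OF True] by (auto simp: q'_def adj_def polys_def)
    next
      case False
      then have "i = e" using i by simp
      then show ?thesis using polyQ by (auto simp: q'_def qe adj_def)
    qed
    show "f' i \<in> q' (Suc i) - q' i"
    proof (cases "i < e")
      case True
      then show ?thesis using qs(2)[OF True] con[of i] con[of "Suc i"] qR[of "Suc i"]
        by (auto simp: q'_def f'_def)
    next
      case False
      then have ie: "i = e" using i by simp
      have "poly g y \<notin> adj (Q \<inter> R) y"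
      proof
        assume "poly g y \<in> adj (Q \<inter> R) y"
        then obtain h where h: "h \<in> polys (Q \<inter> R)" "poly g y = poly h y" by (auto simp: adj_def)
        have "h \<in> polys R" using h by (auto simp: polys_def)
        from transcD[OF y sub_ring_axioms g(1) this h(2)] have "lead_coeff g \<in> Q"
          using polysD[OF h(1), of "degree g"] by simp
        then show False using g(3) by simp
      qed
      then show ?thesis using ie g(2) by (simp add: q'_def f'_def qe)
    qed
    fix x assume x: "x \<in> q' (Suc i)"
    show "\<exists>s\<in>adj R y - Q. \<exists>a\<in>q' i. \<exists>b\<in>adj R y. s * x = a + b * f' i"
    proof (cases "i < e")
      case False
      then have ie: "i = e" using i by simp
      then have xQ: "x \<in> Q" using x by (simp add: q'_def)
      then obtain h where h: "h \<in> polys R" "x = poly h y" using ideal_inD(1)[OF iQ] by (auto simp: adj_def)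
      with g(4)[OF h(1)] xQ obtain s k r where skr: "s \<in> R - Q" "k \<in> polys R" "r \<in> polys R" "r \<in> polys Q"
        "Polynomial.smult s h = g * k + r" by blast
      have "s * x = poly r y + poly k y * poly g y"
        using arg_cong[OF skr(5), of "\<lambda>q. poly q y"] h by simp
      moreover have "poly r y \<in> q' i" using ie skr(3,4) by (auto simp: q'_def qe intro!: adjI simp: polys_def)
      moreover have "poly g y = f' i" "s \<in> adj R y - Q" using ie skr(1) sub_adj[of y] by (auto simp: f'_def)
      ultimately show ?thesis using adjI[OF skr(2), of y] by metis
    next
      case True
      then obtain h where h: "h \<in> polys (q (Suc i))" "x = poly h y" using x by (auto simp: q'_def adj_def)
      have "\<forall>j. \<exists>s\<in>R - Q. \<exists>a\<in>q i. \<exists>b\<in>R. s * coeff h j = a + b * f i"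
        using qs(3)[OF True polysD[OF h(1)]] by blast
      then obtain s a b where sab: "\<And>j. s j \<in> R - Q" "\<And>j. a j \<in> q i" "\<And>j. b j \<in> R"
        "\<And>j. s j * coeff h j = a j + b j * f i" by metis
      \<comment> \<open>Each coefficient of \<open>h\<close> comes with its own multiplier
        \<open>s j\<close>; the product \<open>S\<close> serves all of them and stays outside the
        prime.\<close>
      define S where "S = (\<Prod>j\<le>degree h. s j)"
      define c where "c j = (\<Prod>k\<in>{..degree h} - {j}. s k)" for j
      have Sc: "S = c j * s j" if "j \<le> degree h" for j
        unfolding S_def c_def using that by (subst prod.remove[of _ j]) (auto simp: mult.commute)
      have cR: "c j \<in> R" for j unfolding c_def using sab(1) by (intro prod) auto
      have "prime_in R (Q \<inter> R)" using qp[of e] qe by simp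
      then have SR: "S \<in> R - Q" unfolding S_def
        using prime_compl_prod[of "Q \<inter> R" "{..degree h}" s] sab(1) by auto
      have iq: "ideal_in R (q i)" using prime_inD(1)[OF qp[of i]] True by simp
      have qi: "ideal_in (adj R y) (adj (q i) y)" by (rule ideal_adj[OF iq])
      have "S * x = (\<Sum>j\<le>degree h. (c j * a j) * y ^ j) + (\<Sum>j\<le>degree h. c j * b j * y ^ j) * f i"
      proof -
        have "S * x = (\<Sum>j\<le>degree h. S * coeff h j * y ^ j)"
          by (simp add: h(2) poly_altdef sum_distrib_left mult.assoc)
        also have "\<dots> = (\<Sum>j\<le>degree h. (c j * a j) * y ^ j + c j * b j * y ^ j * f i)"
        proof (intro sum.cong refl)
          fix j assume "j \<in> {..degree h}"
          then have "S * coeff h j = c j * (a j + b j * f i)" using Sc[of j] sab(4)[of j] by (simp add: mult.assoc)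
          then show "S * coeff h j * y ^ j = (c j * a j) * y ^ j + c j * b j * y ^ j * f i"
            by (simp add: algebra_simps)
        qed
        finally show ?thesis by (simp add: sum.distrib sum_distrib_right)
      qed
      moreover have "(\<Sum>j\<le>degree h. (c j * a j) * y ^ j) \<in> q' i"
      proof -
        have "c j * a j \<in> adj (q i) y" for j
          using ideal_inD(4)[OF iq cR sab(2)] con[of i] True by auto
        from ideal_sum[OF qi ideal_inD(5)[OF qi A.power[OF gen_adj] this]] True
        show ?thesis unfolding q'_def by simp
      qed
      moreover have "(\<Sum>j\<le>degree h. c j * b j * y ^ j) \<in> adj R y"
        using cR sab(3) sub_adj by (intro A.sum A.mult A.power gen_adj) auto
      ultimately show ?thesis using SR sub_adj[of y] True unfolding f'_def by (simp add: subset_iff) blast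
    qed
  qed
  then show ?thesis by blast
qed

section \<open>Dimension and regularity of polynomial rings\<close>

inductive_set ralg :: "'f::field set \<Rightarrow> 'f set \<Rightarrow> 'f set" for K Z where
  base: "c \<in> K \<Longrightarrow> c \<in> ralg K Z"
| gen: "z \<in> Z \<Longrightarrow> z \<in> ralg K Z"
| add: "x \<in> ralg K Z \<Longrightarrow> y \<in> ralg K Z \<Longrightarrow> x + y \<in> ralg K Z"
| mult: "x \<in> ralg K Z \<Longrightarrow> y \<in> ralg K Z \<Longrightarrow> x * y \<in> ralg K Z"

lemma sub_ring_ralg:
  assumes "sub_ring K" shows "sub_ring (ralg K Z)"
proof -
  interpret K: sub_ring K by fact
  show ?thesis
  proof
    show "- x \<in> ralg K Z" if "x \<in> ralg K Z" for x
      using ralg.mult[OF ralg.base[of "-1" K Z] that] K.uminus[of 1] by simp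
  qed (auto intro: ralg.intros)
qed

lemma ralg_least: "sub_ring S \<Longrightarrow> K \<subseteq> S \<Longrightarrow> Z \<subseteq> S \<Longrightarrow> ralg K Z \<subseteq> S"
proof
  fix x assume S: "sub_ring S" "K \<subseteq> S" "Z \<subseteq> S" and "x \<in> ralg K Z"
  from this(4) show "x \<in> S"
    by induction (use S in \<open>auto intro: sub_ring.add sub_ring.mult\<close>)
qed

lemma ralg_mono: "sub_ring K \<Longrightarrow> Z \<subseteq> Z' \<Longrightarrow> ralg K Z \<subseteq> ralg K Z'"
  by (rule ralg_least[OF sub_ring_ralg]) (auto intro: ralg.intros)

lemma ralg_empty: "sub_ring K \<Longrightarrow> ralg K {} = K"
  using ralg_least[of K K "{}"] by (auto intro: ralg.base)

lemma ralg_insert: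
  assumes K: "sub_ring K" shows "ralg K (insert y Z) = adj (ralg K Z) y"
proof
  interpret R: sub_ring "ralg K Z" by (rule sub_ring_ralg[OF K])
  interpret R': sub_ring "ralg K (insert y Z)" by (rule sub_ring_ralg[OF K])
  have m: "ralg K Z \<subseteq> ralg K (insert y Z)" by (rule ralg_mono[OF K]) auto
  show "ralg K (insert y Z) \<subseteq> adj (ralg K Z) y"
    using R.sub_adj[of y] R.gen_adj[of y] 
    by (intro ralg_least[OF R.sub_ring_adj]) (auto intro: ralg.intros)
  show "adj (ralg K Z) y \<subseteq> ralg K (insert y Z)"
  proof
    fix x assume "x \<in> adj (ralg K Z) y"
    then obtain h where h: "h \<in> polys (ralg K Z)" "x = poly h y" by (auto simp: adj_def)
    have "x = (\<Sum>i\<le>degree h. coeff h i * y ^ i)" by (simp add: h poly_altdef)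
    also have "\<dots> \<in> ralg K (insert y Z)"
      using subsetD[OF m polysD[OF h(1)]] by (intro R'.sum R'.mult R'.power) (auto intro: ralg.gen)
    finally show "x \<in> ralg K (insert y Z)" .
  qed
qed

lemma transc_mono: "transc R' y \<Longrightarrow> R \<subseteq> R' \<Longrightarrow> transc R y"
  unfolding transc_def polys_def by blast

text \<open>A polynomial ring over a field. Algebraic independence of \<open>Z\<close> is stated as
  transcendence of each generator over the others, which is what adjoining the generators one at a
  time requires.\<close>

locale affine_ring =
  fixes K Z :: "'f::field set"
  assumes K: "sub_ring K" and K_inverse: "c \<in> K \<Longrightarrow> c \<noteq> 0 \<Longrightarrow> 1 / c \<in> K"
    and fin: "finite Z" and indep: "z \<in> Z \<Longrightarrow> transc (ralg K (Z - {z})) z"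
begin

lemma transc_ralg: "B \<subseteq> Z \<Longrightarrow> y \<in> Z - B \<Longrightarrow> transc (ralg K B) y"
  using transc_mono[OF indep ralg_mono[OF K, of B "Z - {y}"]] by blast

lemma noetherian_ralg: "noetherian (ralg K Z)"
proof -
  interpret K: sub_ring K by (rule K)
  have "fg_ideal K I" if I: "ideal_in K I" for I
  proof (cases "I \<subseteq> {0}")
    case True
    then show ?thesis
      unfolding fg_ideal_def by (intro exI[of _ "{}"]) (auto simp: ideal_in_def)
  next
    case False
    then obtain x where x: "x \<in> I" "x \<noteq> 0" by auto
    have "I \<subseteq> J" if J: "ideal_in K J" "x \<in> J" for J
    proof
      fix y assume "y \<in> I"
      then have "y \<in> K" "1 / x \<in> K" using K_inverse x ideal_inD(1)[OF I] by auto
      from ideal_inD(4)[OF J(1) K.mult[OF this] J(2)] x(2) show "y \<in> J" by simp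
    qed
    then show ?thesis
      unfolding fg_ideal_def using x by (intro exI[of _ "{x}"]) auto
  qed
  then have nK: "noetherian K" using K.noetherian_iff by blast
  have "noetherian (ralg K B)" if "finite B" for B
    using that
  proof (induction B)
    case (insert y B)
    interpret R: sub_ring "ralg K B" by (rule sub_ring_ralg[OF K])
    show ?case using insert R.noetherian_adj by (simp add: ralg_insert[OF K])
  qed (simp add: ralg_empty[OF K] nK)
  then show ?thesis using fin by blast
qed

definition free_mod :: "'f set \<Rightarrow> 'f set \<Rightarrow> bool" where
  "free_mod P B \<longleftrightarrow> B \<subseteq> Z \<and> P \<inter> ralg K B \<subseteq> {0}"

text \<open>This is the transcendence degree over \<open>K\<close> of the residue ring modulo \<open>P\<close>, defined through subsets
  of the given variables only.\<close>
definition rank_mod :: "'f set \<Rightarrow> nat" where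
  "rank_mod P = Max (card ` {B. free_mod P B})"

lemma finite_free_mod: "finite {B. free_mod P B}"
  using fin by (auto simp: free_mod_def)

lemma card_le_rank_mod: "free_mod P B \<Longrightarrow> card B \<le> rank_mod P"
  unfolding rank_mod_def using finite_free_mod by (intro Max_ge) auto

lemma free_mod_empty:
  assumes P: "prime_in (ralg K Z) P" shows "free_mod P {}"
proof -
  have "c = 0" if c: "c \<in> P" "c \<in> K" for c
  proof (rule ccontr)
    assume "c \<noteq> 0"
    then have "1 / c * c \<in> P"
      using ideal_inD(4)[OF prime_inD(1)[OF P] ralg.base[OF K_inverse] c(1)] c by blast
    then show False using \<open>c \<noteq> 0\<close> prime_not_one[OF P] by simp
  qed
  then show ?thesis by (auto simp: free_mod_def ralg_empty[OF K])
qed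

lemma obtain_free_mod:
  assumes P: "prime_in (ralg K Z) P"
  obtains B where "free_mod P B" "card B = rank_mod P"
proof -
  have "card ` {B. free_mod P B} \<noteq> {}" using free_mod_empty[OF P] by auto
  then have "rank_mod P \<in> card ` {B. free_mod P B}"
    unfolding rank_mod_def using finite_free_mod by (intro Max_in) auto
  then show ?thesis using that by auto
qed

lemma rank_mod_le: "prime_in (ralg K Z) P \<Longrightarrow> rank_mod P \<le> card Z"
  using obtain_free_mod[of P] fin by (metis card_mono free_mod_def)

lemma rank_mod_antimono:
  assumes "prime_in (ralg K Z) Q" "P \<subseteq> Q" shows "rank_mod Q \<le> rank_mod P"
proof -
  obtain B where B: "free_mod Q B" "card B = rank_mod Q" using obtain_free_mod[OF assms(1)] .
  then have "free_mod P B" using assms(2) by (auto simp: free_mod_def)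
  then show ?thesis using card_le_rank_mod B by metis
qed

text \<open>By maximality of \<open>B\<close>, the prime contains a nonzero polynomial in
  \<open>y\<close> over \<open>ralg K B\<close>. Its leading coefficient avoids \<open>P\<close>
  because \<open>B\<close> is free, so the relation stays nontrivial modulo \<open>P\<close>, also
  over the larger \<open>B'\<close>.\<close>

lemma alg_mod_free:
  assumes B: "free_mod P B" "card B = rank_mod P" and B': "B \<subseteq> B'" "B' \<subseteq> Z" and y: "y \<in> Z - B'"
  shows "sub_ring.alg_mod (ralg K B') (P \<inter> ralg K (insert y B')) y"
proof -
  interpret R: sub_ring "ralg K B'" by (rule sub_ring_ralg[OF K])
  have BZ: "B \<subseteq> Z" "y \<notin> B" using B' y by auto
  have "card (insert y B) > rank_mod P"
    using B(2) BZ fin by (simp add: finite_subset)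
  then have "\<not> free_mod P (insert y B)" using card_le_rank_mod by (meson not_le)
  then obtain x where x: "x \<in> P" "x \<in> ralg K (insert y B)" "x \<noteq> 0"
    using y BZ by (auto simp: free_mod_def)
  then obtain h where h: "h \<in> polys (ralg K B)" "x = poly h y"
    by (auto simp: ralg_insert[OF K] adj_def)
  have m: "ralg K B \<subseteq> ralg K B'" "ralg K (insert y B) \<subseteq> ralg K (insert y B')"
    using ralg_mono[OF K B'(1)] ralg_mono[OF K, of "insert y B" "insert y B'"] B' by auto
  have "h \<noteq> 0" using h x by auto
  then have "lead_coeff h \<notin> P" using B(1) polysD[OF h(1)] by (auto simp: free_mod_def)
  then show ?thesis
    unfolding R.alg_mod_def using h m x by (intro bexI[of _ h]) (auto simp: polys_def)
qed

lemma prime_Int_ralg: "prime_in (ralg K Z) P \<Longrightarrow> B \<subseteq> Z \<Longrightarrow> prime_in (ralg K B) (P \<inter> ralg K B)"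
  by (rule prime_contract[OF sub_ring_ralg[OF K] ralg_mono[OF K]])

text \<open>On a maximal free set \<open>B\<close> the contraction of \<open>P\<close> is zero and
  the chain has length 0. Every variable outside \<open>B\<close> is algebraic modulo
  \<open>P\<close> and lengthens the chain by one.\<close>

lemma parameter_chain_exists:
  assumes P: "prime_in (ralg K Z) P"
  shows "\<exists>q f. parameter_chain (ralg K Z) P (card Z - rank_mod P) q f"
proof -
  obtain B where B: "free_mod P B" "card B = rank_mod P" using obtain_free_mod[OF P] .
  then have BZ: "B \<subseteq> Z" by (simp add: free_mod_def)
  have *: "\<exists>q f. parameter_chain (ralg K (B \<union> C)) (P \<inter> ralg K (B \<union> C)) (card C) q f"
    if "finite C" "C \<subseteq> Z - B" for C
    using that
  proof (induction C)
    case empty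
    interpret R: sub_ring "ralg K B" by (rule sub_ring_ralg[OF K])
    have "P \<inter> ralg K B = {0}"
      using B(1) R.zero ideal_inD(2)[OF prime_inD(1)[OF P]] by (auto simp: free_mod_def)
    then show ?case using R.zero_prime
      by (intro exI[of _ "\<lambda>_. {0}"]) (auto simp: parameter_chain_def)
  next
    case (insert y C)
    interpret R: sub_ring "ralg K (B \<union> C)" by (rule sub_ring_ralg[OF K])
    let ?Q = "P \<inter> ralg K (insert y (B \<union> C))"
    have sub: "ralg K (B \<union> C) \<subseteq> ralg K (insert y (B \<union> C))" by (rule ralg_mono[OF K]) auto
    then have "?Q \<inter> ralg K (B \<union> C) = P \<inter> ralg K (B \<union> C)" by auto
    then obtain q f where "parameter_chain (ralg K (B \<union> C)) (?Q \<inter> ralg K (B \<union> C)) (card C) q f"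
      using insert by auto
    moreover have "transc (ralg K (B \<union> C)) y"
      using transc_ralg[of "B \<union> C" y] insert BZ by auto
    moreover have "prime_in (adj (ralg K (B \<union> C)) y) ?Q"
      using prime_Int_ralg[OF P, of "insert y (B \<union> C)"] insert BZ by (auto simp: ralg_insert[OF K])
    moreover have "R.alg_mod ?Q y"
      using alg_mod_free[OF B, of "B \<union> C" y] insert BZ by auto
    ultimately have "\<exists>q f. parameter_chain (adj (ralg K (B \<union> C)) y) ?Q (Suc (card C)) q f"
      by (rule R.parameter_chain_adj)
    then show ?case using insert by (simp add: ralg_insert[OF K])
  qed
  have "B \<union> (Z - B) = Z" "P \<inter> ralg K Z = P" "card (Z - B) = card Z - rank_mod P"
    using BZ ideal_inD(1)[OF prime_inD(1)[OF P]] B(2) fin finite_subset[OF BZ]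
    by (auto simp: card_Diff_subset)
  with *[of "Z - B"] fin show ?thesis by simp
qed

text \<open>If the ranks agreed, a maximal free set modulo \<open>Q\<close> would also be one modulo
  \<open>P\<close>. There both contractions are zero, and \<open>prime_eq_if_contract_eq\<close>
  carries their equality through every further variable up to \<open>P = Q\<close>.\<close>

lemma rank_mod_strict:
  assumes P: "prime_in (ralg K Z) P" and Q: "prime_in (ralg K Z) Q" and PQ: "P \<subset> Q"
  shows "rank_mod Q < rank_mod P"
proof (rule ccontr)
  assume "\<not> rank_mod Q < rank_mod P"
  then have eq: "rank_mod Q = rank_mod P" using rank_mod_antimono[OF Q] PQ by (meson psubset_imp_subset le_antisym not_le)
  obtain B where B: "free_mod Q B" "card B = rank_mod Q" using obtain_free_mod[OF Q] .
  then have BZ: "B \<subseteq> Z" by (simp add: free_mod_def)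
  have BP: "free_mod P B" using B(1) PQ by (auto simp: free_mod_def)
  have *: "P \<inter> ralg K (B \<union> C) = Q \<inter> ralg K (B \<union> C)" if "finite C" "C \<subseteq> Z - B" for C
    using that
  proof (induction C)
    case empty
    have "0 \<in> P" "0 \<in> Q" using ideal_inD(2)[OF prime_inD(1)] P Q by auto
    then show ?case using B(1) BP by (auto simp: free_mod_def)
  next
    case (insert y C)
    interpret R: sub_ring "ralg K (B \<union> C)" by (rule sub_ring_ralg[OF K])
    let ?S = "ralg K (insert y (B \<union> C))"
    have sub: "ralg K (B \<union> C) \<subseteq> ?S" by (rule ralg_mono[OF K]) auto
    have pr: "prime_in (adj (ralg K (B \<union> C)) y) (J \<inter> ?S)" if "prime_in (ralg K Z) J" for J
      using prime_Int_ralg[OF that, of "insert y (B \<union> C)"] insert BZ by (auto simp: ralg_insert[OF K])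
    have "P \<inter> ?S = Q \<inter> ?S"
    proof (rule R.prime_eq_if_contract_eq[OF pr[OF P] pr[OF Q]])
      show "P \<inter> ?S \<subseteq> Q \<inter> ?S" using PQ by auto
      show "P \<inter> ?S \<inter> ralg K (B \<union> C) = Q \<inter> ?S \<inter> ralg K (B \<union> C)" using insert sub by blast
      show "R.alg_mod (P \<inter> ?S) y"
        using alg_mod_free[OF BP, of "B \<union> C" y] insert BZ B(2) eq by auto
    qed
    then show ?case by simp
  qed
  have "B \<union> (Z - B) = Z" "P \<inter> ralg K Z = P" "Q \<inter> ralg K Z = Q"
    using BZ ideal_inD(1)[OF prime_inD(1)[OF P]] ideal_inD(1)[OF prime_inD(1)[OF Q]] by auto
  with *[of "Z - B"] fin PQ show False by auto
qed

text \<open>Keeping the rank of the top prime in the estimate bounds the height of that prime, not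
  merely the dimension of the ring.\<close>

lemma prime_chain_length:
  assumes "\<forall>i\<le>n. prime_in (ralg K Z) (c i)" "\<forall>i<n. c i \<subset> c (Suc i)"
  shows "n + rank_mod (c n) \<le> card Z"
  using assms
proof (induction n)
  case 0
  then show ?case using rank_mod_le by simp
next
  case (Suc n)
  then have "n + rank_mod (c n) \<le> card Z" by simp
  moreover have "rank_mod (c (Suc n)) < rank_mod (c n)"
    using Suc.prems by (intro rank_mod_strict) auto
  ultimately show ?case by simp
qed

end

section \<open>Localization at a prime\<close>

locale prime_localization = sub_ring R for R :: "'f::field set" +
  fixes P assumes P: "prime_in R P"
begin

abbreviation T where "T \<equiv> localize R P"

definition ext :: "'f set \<Rightarrow> 'f set" where
  "ext q = {x / s | x s. x \<in> q \<and> s \<in> R - P}"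

lemma T_eq_ext: "T = ext R"
  by (simp add: localize_def ext_def)

lemma compl_nonzero: "s \<in> R - P \<Longrightarrow> s \<noteq> 0"
  using ideal_inD(2)[OF prime_inD(1)[OF P]] by auto

lemma one_compl: "1 \<in> R - P"
  using prime_not_one[OF P] by auto

lemma mult_compl: "s \<in> R - P \<Longrightarrow> s' \<in> R - P \<Longrightarrow> s * s' \<in> R - P"
  using prime_compl_mult[OF P] by auto

lemma subset_ext: "q \<subseteq> ext q"
  unfolding ext_def using one_compl by force

lemma ext_mono: "q \<subseteq> q' \<Longrightarrow> ext q \<subseteq> ext q'"
  unfolding ext_def by blast

lemma ideal_R: "ideal_in R R"
  by (auto simp: ideal_in_def)

lemma ext_add:
  assumes q: "ideal_in R q" and "u \<in> ext q" "v \<in> ext q" shows "u + v \<in> ext q"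
proof -
  from assms obtain x s y s' where xs: "x \<in> q" "s \<in> R - P" "u = x / s" "y \<in> q" "s' \<in> R - P" "v = y / s'"
    unfolding ext_def by blast
  have "u + v = (x * s' + y * s) / (s * s')"
    using xs compl_nonzero by (simp add: add_frac_eq)
  moreover have "x * s' + y * s \<in> q"
    using xs by (intro ideal_inD(3)[OF q] ideal_inD(5)[OF q]) auto
  ultimately show ?thesis unfolding ext_def using mult_compl[OF xs(2,5)] by blast
qed

lemma ext_mult:
  assumes q: "ideal_in R q" and "u \<in> T" "v \<in> ext q" shows "u * v \<in> ext q"
proof -
  from assms obtain x s y s' where xs: "x \<in> R" "s \<in> R - P" "u = x / s" "y \<in> q" "s' \<in> R - P" "v = y / s'"
    unfolding ext_def localize_def by blast
  have "u * v = (x * y) / (s * s')" using xs by simp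
  moreover have "x * y \<in> q" using xs by (intro ideal_inD(4)[OF q]) auto
  ultimately show ?thesis unfolding ext_def using mult_compl[OF xs(2,5)] by blast
qed

lemma sub_T: "R \<subseteq> T"
  unfolding T_eq_ext by (rule subset_ext)

lemma inverse_T: "s \<in> R - P \<Longrightarrow> 1 / s \<in> T"
  unfolding localize_def using one by blast

lemma sub_ring_T: "sub_ring T"
proof
  show "0 \<in> T" "1 \<in> T" using sub_T by auto
  show "x + y \<in> T" if "x \<in> T" "y \<in> T" for x y
    using ext_add[OF ideal_R] that by (simp add: T_eq_ext)
  show mult: "x * y \<in> T" if "x \<in> T" "y \<in> T" for x y
    using ext_mult[OF ideal_R] that by (simp add: T_eq_ext)
  show "- x \<in> T" if "x \<in> T" for x
    using mult[of "-1" x] that uminus[OF one] sub_T by auto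
qed

sublocale T: sub_ring T by (rule sub_ring_T)

lemma T_fraction: "x \<in> T \<Longrightarrow> \<exists>s\<in>R - P. s * x \<in> R"
  unfolding localize_def using compl_nonzero by force

lemma noetherian_T: "noetherian R \<Longrightarrow> noetherian T"
  using noetherian_fractions[OF _ sub_ring_T sub_T] T_fraction inverse_T compl_nonzero
  by (metis DiffD1)

lemma ideal_ext: assumes q: "ideal_in R q" shows "ideal_in T (ext q)"
  unfolding ideal_in_def
  using ext_mono[OF ideal_inD(1)[OF q]] subsetD[OF subset_ext ideal_inD(2)[OF q]]
    ext_add[OF q] ext_mult[OF q] by (auto simp: T_eq_ext)

lemma ext_contract:
  assumes q: "prime_in R q" "q \<subseteq> P" shows "ext q \<inter> R = q"
proof
  show "ext q \<inter> R \<subseteq> q"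
  proof
    fix u assume u: "u \<in> ext q \<inter> R"
    then obtain x s where xs: "x \<in> q" "s \<in> R - P" "u = x / s" by (auto simp: ext_def)
    then have "s * u \<in> q" using compl_nonzero[OF xs(2)] by simp
    then show "u \<in> q" using prime_inD(3)[OF q(1), of s u] xs u q(2) by auto
  qed
  show "q \<subseteq> ext q \<inter> R" using subset_ext ideal_inD(1)[OF prime_inD(1)[OF q(1)]] by auto
qed

lemma prime_ext:
  assumes q: "prime_in R q" "q \<subseteq> P" shows "prime_in T (ext q)"
  unfolding prime_in_def
proof (intro conjI ballI impI)
  show "ideal_in T (ext q)" by (rule ideal_ext[OF prime_inD(1)[OF q(1)]])
  show "ext q \<noteq> T" using ext_contract[OF q] prime_not_one[OF q(1)] sub_T by blast
  fix u v assume uv: "u \<in> T" "v \<in> T" "u * v \<in> ext q"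
  obtain s s' where s: "s \<in> R - P" "s * u \<in> R" "s' \<in> R - P" "s' * v \<in> R"
    using T_fraction[OF uv(1)] T_fraction[OF uv(2)] by blast
  have "s * s' \<in> R" using s by auto
  then have "(s * s') * (u * v) \<in> ext q"
    by (intro ext_mult[OF prime_inD(1)[OF q(1)] _ uv(3)] subsetD[OF sub_T])
  moreover have "(s * s') * (u * v) = (s * u) * (s' * v)" by (simp add: mult_ac)
  ultimately have "(s * u) * (s' * v) \<in> ext q \<inter> R" using mult[OF s(2,4)] by simp
  then have "s * u \<in> q \<or> s' * v \<in> q" using ext_contract[OF q] prime_inD(3)[OF q(1) s(2,4)] by auto
  moreover have "u = (s * u) / s" "v = (s' * v) / s'" using s compl_nonzero by auto
  ultimately show "u \<in> ext q \<or> v \<in> ext q" unfolding ext_def using s by blast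
qed

lemma contract_subset:
  assumes J: "ideal_in T J" "J \<noteq> T" shows "J \<inter> R \<subseteq> P"
proof (rule ccontr)
  assume "\<not> J \<inter> R \<subseteq> P"
  then obtain s where s: "s \<in> J" "s \<in> R - P" by auto
  have "1 / s * s \<in> J" by (rule ideal_inD(4)[OF J(1) inverse_T[OF s(2)] s(1)])
  then have "1 \<in> J" using compl_nonzero[OF s(2)] by simp
  then have "T \<subseteq> J" using ideal_inD(4)[OF J(1), of _ 1] by auto
  then show False using J ideal_inD(1)[OF J(1)] by auto
qed

lemma ideal_subset_ext_contract:
  assumes J: "ideal_in T J" shows "J \<subseteq> ext (J \<inter> R)"
proof
  fix x assume x: "x \<in> J"
  then obtain s where s: "s \<in> R - P" "s * x \<in> R"
    using T_fraction[of x] ideal_inD(1)[OF J] by auto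
  have "s * x \<in> J \<inter> R" using s ideal_inD(4)[OF J _ x, of s] sub_T by auto
  moreover have "x = (s * x) / s" using compl_nonzero[OF s(1)] by simp
  ultimately show "x \<in> ext (J \<inter> R)" unfolding ext_def using s by blast
qed

text \<open>A proper ideal contracts into \<open>P\<close>, since elements of \<open>R\<close>
  outside \<open>P\<close> are units of \<open>T\<close>; extending again puts it inside
  \<open>ext P\<close>.\<close>

lemma maximal_iff: "maximal_in T M \<longleftrightarrow> M = ext P"
proof -
  have pP: "prime_in T (ext P)" by (rule prime_ext[OF P order_refl])
  have sub: "J \<subseteq> ext P" if "ideal_in T J" "J \<noteq> T" for J
    using ideal_subset_ext_contract[OF that(1)] ext_mono[OF contract_subset[OF that]] by blast
  show ?thesis
    using prime_inD(1,2)[OF pP] sub unfolding maximal_in_def by (metis subset_antisym)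
qed

lemma local_ring_T: "local_ring T"
  using maximal_iff by (auto simp: local_ring_def)

text \<open>Extension recovers an ideal of the local ring from its contraction, so chains can be
  measured in \<open>R\<close> without loss of length.\<close>

lemma contract_strict:
  assumes "ideal_in T J" "ideal_in T J'" "J \<subset> J'" shows "J \<inter> R \<subset> J' \<inter> R"
proof -
  have "ext (J \<inter> R) \<subseteq> J"
  proof
    fix x assume "x \<in> ext (J \<inter> R)"
    then obtain y s where ys: "y \<in> J" "s \<in> R - P" "x = y / s" by (auto simp: ext_def)
    then show "x \<in> J" using ideal_inD(4)[OF assms(1) inverse_T[OF ys(2)] ys(1)] by simp
  qed
  moreover have "\<not> ext (J' \<inter> R) \<subseteq> J"
    using ideal_subset_ext_contract[OF assms(2)] assms(3) by blast
  ultimately have "J \<inter> R \<noteq> J' \<inter> R" by metis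
  then show ?thesis using assms(3) by auto
qed

lemma inverse_outside_ext: assumes "x \<in> T" "x \<notin> ext P" shows "1 / x \<in> T"
proof -
  from assms(1) obtain y s where ys: "y \<in> R" "s \<in> R - P" "x = y / s" by (auto simp: localize_def)
  then have "y \<notin> P" using assms(2) by (auto simp: ext_def)
  then have "s / y \<in> T" using ys by (auto simp: localize_def)
  then show ?thesis using ys by simp
qed

end

text \<open>Gaussian elimination modulo the maximal ideal: elements outside \<open>M\<close> can serve as pivots.\<close>
lemma local_linear_dependence:
  fixes b :: "'i \<Rightarrow> nat \<Rightarrow> 'f::field"
  assumes T: "sub_ring T" and M: "ideal_in T M" "1 \<notin> M"
    and units: "\<And>x. x \<in> T \<Longrightarrow> x \<notin> M \<Longrightarrow> 1 / x \<in> T"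
    and "finite I" "card I > k" "\<And>i j. i \<in> I \<Longrightarrow> b i j \<in> T"
  shows "\<exists>c. (\<forall>i. c i \<in> T) \<and> (\<exists>i\<in>I. c i \<notin> M) \<and> (\<forall>j<k. (\<Sum>i\<in>I. c i * b i j) \<in> M)"
  using assms(5-7)
proof (induction k arbitrary: I b)
  case 0
  then show ?case
    using sub_ring.one[OF T] M(2) by (intro exI[of _ "\<lambda>_. 1"]) (auto simp: card_gt_0_iff)
next
  case (Suc k)
  interpret T: sub_ring T by fact
  show ?case
  proof (cases "\<forall>i\<in>I. b i k \<in> M")
    case True
    obtain c where c: "\<forall>i. c i \<in> T" "\<exists>i\<in>I. c i \<notin> M" "\<forall>j<k. (\<Sum>i\<in>I. c i * b i j) \<in> M"
      using Suc.IH[of I b] Suc.prems by auto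
    have "(\<Sum>i\<in>I. c i * b i k) \<in> M" 
      using True c(1) by (intro ideal_sum[OF M(1)] ideal_inD(4)[OF M(1)]) auto
    then have "\<forall>j<Suc k. (\<Sum>i\<in>I. c i * b i j) \<in> M" using c(3) by (auto simp: less_Suc_eq)
    then show ?thesis using c by blast
  next
    case False
    then obtain p where p: "p \<in> I" "b p k \<notin> M" by auto
    define u where "u = 1 / b p k"
    have bp: "b p k \<in> T" "b p k \<noteq> 0" using p Suc.prems(3) ideal_inD(2)[OF M(1)] by auto
    have u: "u \<in> T" "u * b p k = 1" unfolding u_def using units[OF bp(1) p(2)] bp by auto
    define b' where "b' i j = b i j - b i k * u * b p j" for i j
    have b'T: "b' i j \<in> T" if "i \<in> I" for i j
      unfolding b'_def using Suc.prems(3)[OF that] Suc.prems(3)[OF p(1)] u(1) by (intro T.diff T.mult) auto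
    let ?I = "I - {p}"
    have "\<exists>c. (\<forall>i. c i \<in> T) \<and> (\<exists>i\<in>?I. c i \<notin> M) \<and> (\<forall>j<k. (\<Sum>i\<in>?I. c i * b' i j) \<in> M)"
      using Suc.prems p u(1) by (intro Suc.IH) (auto simp: b'T)
    then obtain c where c: "\<forall>i. c i \<in> T" "\<exists>i\<in>?I. c i \<notin> M" "\<forall>j<k. (\<Sum>i\<in>?I. c i * b' i j) \<in> M" by blast
    \<comment> \<open>Giving the pivot row the coefficient \<open>- w\<close> undoes the
      elimination: the combination of the original rows equals that of the reduced rows
      \<open>b'\<close>.\<close>
    define w where "w = (\<Sum>i\<in>?I. c i * b i k * u)"
    have w: "w \<in> T" unfolding w_def using c(1) Suc.prems(3) u(1) by (intro T.sum T.mult) auto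
    define c' where "c' i = (if i = p then - w else c i)" for i
    have eq: "(\<Sum>i\<in>I. c' i * b i j) = (\<Sum>i\<in>?I. c i * b' i j)" for j
    proof -
      have "(\<Sum>i\<in>I. c' i * b i j) = - w * b p j + (\<Sum>i\<in>?I. c' i * b i j)"
        using p(1) Suc.prems(1) by (subst sum.remove[of _ p]) (auto simp: c'_def)
      also have "(\<Sum>i\<in>?I. c' i * b i j) = (\<Sum>i\<in>?I. c i * b i j)"
        by (intro sum.cong) (auto simp: c'_def)
      also have "- w * b p j = (\<Sum>i\<in>?I. - (c i * b i k * u * b p j))"
        by (simp add: w_def sum_distrib_right sum_negf)
      finally show ?thesis by (simp add: b'_def algebra_simps sum.distrib[symmetric] sum_subtractf)
    qed
    have "b' i k = 0" for i unfolding b'_def using u(2) by (simp add: mult.assoc)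
    then have "\<forall>j<Suc k. (\<Sum>i\<in>I. c' i * b i j) \<in> M"
      using c(3) ideal_inD(2)[OF M(1)] by (auto simp: eq less_Suc_eq)
    moreover have "\<forall>i. c' i \<in> T" using c(1) w by (auto simp: c'_def)
    moreover have "\<exists>i\<in>I. c' i \<notin> M" using c(2) by (auto simp: c'_def)
    ultimately show ?thesis by blast
  qed
qed

text \<open>What a \<open>parameter_chain\<close> becomes in the local ring with maximal ideal
  \<open>Q e\<close>: the multipliers are now units and disappear from \<open>step\<close>.\<close>

locale regular_chain =
  fixes T :: "'f::field set" and e :: nat and Q :: "nat \<Rightarrow> 'f set" and f :: "nat \<Rightarrow> 'f"
  assumes T: "sub_ring T" and Q0: "Q 0 = {0}" and prime: "i \<le> e \<Longrightarrow> prime_in T (Q i)"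
    and mono: "i < e \<Longrightarrow> Q i \<subseteq> Q (Suc i)" and f: "i < e \<Longrightarrow> f i \<in> Q (Suc i) - Q i"
    and step: "i < e \<Longrightarrow> x \<in> Q (Suc i) \<Longrightarrow> \<exists>a\<in>Q i. \<exists>b\<in>T. x = a + b * f i"
    and units: "x \<in> T \<Longrightarrow> x \<notin> Q e \<Longrightarrow> 1 / x \<in> T"
begin

sublocale T: sub_ring T by (rule T)

lemma ideal_Q: "i \<le> e \<Longrightarrow> ideal_in T (Q i)"
  using prime prime_inD(1) by blast

lemma mono_le: "j \<le> e \<Longrightarrow> i \<le> j \<Longrightarrow> Q i \<subseteq> Q j"
proof (induction j)
  case (Suc j)
  then show ?case using mono[of j] by (cases "i = Suc j") auto
qed simp

lemma f_in: "i < j \<Longrightarrow> j \<le> e \<Longrightarrow> f i \<in> Q j"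
  using f[of i] mono_le[of j "Suc i"] by auto

lemma f_T: "i < e \<Longrightarrow> f i \<in> T"
  using f[of i] ideal_inD(1)[OF ideal_Q[of "Suc i"]] by auto

lemma generated: "n \<le> e \<Longrightarrow> x \<in> Q n \<Longrightarrow> \<exists>r. (\<forall>i. r i \<in> T) \<and> x = (\<Sum>i<n. r i * f i)"
proof (induction n arbitrary: x)
  case 0
  then show ?case by (intro exI[of _ "\<lambda>_. 0"]) (auto simp: Q0)
next
  case (Suc n)
  obtain a b where ab: "a \<in> Q n" "b \<in> T" "x = a + b * f n" using step[of n x] Suc.prems by auto
  then obtain r where r: "\<forall>i. r i \<in> T" "a = (\<Sum>i<n. r i * f i)" using Suc.IH[of a] Suc.prems by auto
  have "x = (\<Sum>i<Suc n. (r(n := b)) i * f i)" using ab r by simp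
  moreover have "\<forall>i. (r(n := b)) i \<in> T" using r ab by simp
  ultimately show ?case by blast
qed

text \<open>Since the other terms lie in the prime \<open>Q n\<close>, so does
  \<open>g n * f n\<close>, hence \<open>g n\<close>, which is thus a combination of earlier
  \<open>f i\<close>. Substituting it shortens the relation and changes the other coefficients only
  by multiples of \<open>f n\<close>, an element of the maximal ideal.\<close>

lemma relation:
  "n \<le> e \<Longrightarrow> (\<And>i. i < n \<Longrightarrow> g i \<in> T) \<Longrightarrow> (\<Sum>i<n. g i * f i) = 0 \<Longrightarrow> i < n \<Longrightarrow> g i \<in> Q e"
proof (induction n arbitrary: g i)
  case 0
  then show ?case by simp
next
  case (Suc n)
  have ne: "n < e" using Suc.prems by simp
  have "g n * f n = (\<Sum>i<n. (- g i) * f i)"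
    using Suc.prems(3) by (simp add: sum_negf eq_neg_iff_add_eq_0 add.commute)
  also have "\<dots> \<in> Q n"
    using Suc.prems(2) ne by (intro ideal_sum[OF ideal_Q] ideal_inD(4)[OF ideal_Q]) (auto intro: f_in)
  finally have gn: "g n \<in> Q n"
    using prime_inD(3)[OF prime[of n], of "g n" "f n"] Suc.prems(2)[of n] f[OF ne] f_T[OF ne] ne by auto
  then obtain r where r: "\<forall>i. r i \<in> T" "g n = (\<Sum>i<n. r i * f i)" using generated[of n] ne by auto
  have fT: "f n \<in> Q e" using f_in[OF ne] by simp
  show ?case
  proof (cases "i = n")
    case True
    then show ?thesis using gn mono_le[of e n] ne by auto
  next
    case False
    have "(\<Sum>i<n. (g i + r i * f n) * f i) = 0"
    proof -
      have "(\<Sum>i<n. (g i + r i * f n) * f i) = (\<Sum>i<n. g i * f i) + (\<Sum>i<n. r i * f i) * f n"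
        unfolding sum_distrib_right sum.distrib[symmetric]
        by (intro sum.cong) (auto simp: algebra_simps)
      then show ?thesis using Suc.prems(3) r(2) by simp
    qed
    moreover have "g j + r j * f n \<in> T" if "j < n" for j
      using Suc.prems(2)[of j] that r(1) f_T[OF ne] by (intro T.add T.mult) auto
    ultimately have "g i + r i * f n \<in> Q e"
      using Suc.IH[of "\<lambda>i. g i + r i * f n" i] Suc.prems(4) ne False by auto
    then have "(g i + r i * f n) - r i * f n \<in> Q e"
      by (rule T.ideal_diff[OF ideal_Q[OF order_refl]])
        (use r(1) fT ideal_inD(4)[OF ideal_Q[OF order_refl]] in auto)
    then show ?thesis by simp
  qed
qed

text \<open>If \<open>k < e\<close> generators sufficed, \<open>local_linear_dependence\<close>
  would give a combination of the \<open>f i\<close> with a coefficient outside the maximal ideal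
  but all coordinates in the generators inside it. Writing the generators in terms of the
  \<open>f i\<close> again contradicts \<open>relation\<close>.\<close>

lemma length_generators:
  assumes gs: "Q e = gen_ideal T gs" "set gs \<subseteq> Q e" shows "e \<le> length gs"
proof (rule ccontr)
  define k where "k = length gs"
  assume "\<not> e \<le> length gs"
  then have ke: "k < e" by (simp add: k_def)
  note iM = ideal_Q[OF order_refl]
  have "\<forall>i<e. \<exists>r. (\<forall>j. r j \<in> T) \<and> f i = (\<Sum>j<k. r j * gs ! j)"
  proof (intro allI impI)
    fix i assume "i < e"
    then have "f i \<in> gen_ideal T gs" using f_in[of i e] gs by simp
    then obtain r where r: "f i = (\<Sum>j<k. r j * gs ! j)" "\<forall>j<k. r j \<in> T"
      by (auto simp: gen_ideal_def k_def)
    then show "\<exists>r. (\<forall>j. r j \<in> T) \<and> f i = (\<Sum>j<k. r j * gs ! j)"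
      by (intro exI[of _ "\<lambda>j. if j < k then r j else 0"]) auto
  qed
  then obtain b where b: "\<And>i j. i < e \<Longrightarrow> b i j \<in> T" "\<And>i. i < e \<Longrightarrow> f i = (\<Sum>j<k. b i j * gs ! j)"
    by metis
  have "\<forall>j<k. \<exists>r. (\<forall>i. r i \<in> T) \<and> gs ! j = (\<Sum>i<e. r i * f i)"
  proof (intro allI impI)
    fix j assume "j < k"
    then have "gs ! j \<in> Q e" using gs(2) by (auto simp: k_def)
    from generated[OF order_refl this] show "\<exists>r. (\<forall>i. r i \<in> T) \<and> gs ! j = (\<Sum>i<e. r i * f i)" .
  qed
  then obtain a where a: "\<And>j i. j < k \<Longrightarrow> a j i \<in> T" "\<And>j. j < k \<Longrightarrow> gs ! j = (\<Sum>i<e. a j i * f i)"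
    by metis
  obtain c where c: "\<forall>i. c i \<in> T" "\<exists>i<e. c i \<notin> Q e" "\<forall>j<k. (\<Sum>i<e. c i * b i j) \<in> Q e"
    using local_linear_dependence[OF T iM prime_not_one[OF prime[OF order_refl]] units, of "{..<e}" k b]
      ke b(1) by auto
  define w where "w j = (\<Sum>i<e. c i * b i j)" for j
  define d where "d i = (\<Sum>j<k. w j * a j i)" for i
  have dM: "d i \<in> Q e" for i
    unfolding d_def using c(3) a(1) by (intro ideal_sum[OF iM] ideal_inD(5)[OF iM]) (auto simp: w_def)
  have "(\<Sum>i<e. c i * f i) = (\<Sum>i<e. \<Sum>j<k. c i * b i j * gs ! j)"
    using b(2) by (intro sum.cong refl) (simp add: sum_distrib_left mult.assoc)
  also have "\<dots> = (\<Sum>j<k. w j * gs ! j)"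
    unfolding w_def by (subst sum.swap) (simp add: sum_distrib_right)
  also have "\<dots> = (\<Sum>j<k. \<Sum>i<e. w j * a j i * f i)"
    using a(2) by (intro sum.cong refl) (simp add: sum_distrib_left mult.assoc)
  also have "\<dots> = (\<Sum>i<e. d i * f i)"
    unfolding d_def by (subst sum.swap) (simp add: sum_distrib_right)
  finally have 0: "(\<Sum>i<e. (c i - d i) * f i) = 0" by (simp add: algebra_simps sum_subtractf)
  have dT: "d i \<in> T" for i using dM ideal_inD(1)[OF iM] by auto
  have "c i \<in> Q e" if "i < e" for i
  proof -
    have "c i - d i \<in> Q e" using relation[OF order_refl _ 0 that] c(1) dT by auto
    then have "c i - d i + d i \<in> Q e" using dM by (rule ideal_inD(3)[OF iM])
    then show ?thesis by simp
  qed
  then show False using c(2) by auto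
qed

lemma min_gens_eq: "min_gens T (Q e) = e"
  unfolding min_gens_def
proof (rule Least_equality)
  let ?gs = "map f [0..<e]"
  note iM = ideal_Q[OF order_refl]
  have 1: "set ?gs \<subseteq> Q e" using f_in by auto
  have "x \<in> gen_ideal T ?gs" if x: "x \<in> Q e" for x
  proof -
    obtain r where "\<forall>i. r i \<in> T" "x = (\<Sum>i<e. r i * f i)" using generated[OF order_refl x] by auto
    then show ?thesis unfolding gen_ideal_def by (intro CollectI exI[of _ r]) auto
  qed
  then have "Q e = gen_ideal T ?gs" using gen_ideal_least[OF iM 1] by auto
  then show "\<exists>gs. length gs = e \<and> set gs \<subseteq> Q e \<and> Q e = gen_ideal T gs"
    using 1 by (intro exI[of _ ?gs]) auto
qed (use length_generators in auto)

end

lemma (in prime_localization) regular_chain_T: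
  assumes ch: "parameter_chain R P e q f"
  shows "regular_chain T e (\<lambda>i. ext (q i)) f"
proof -
  have qp: "prime_in R (q i)" if "i \<le> e" for i using ch that by (auto simp: parameter_chain_def)
  have qe: "q e = P" and q0: "q 0 = {0}" using ch by (auto simp: parameter_chain_def)
  have qs: "q i \<subseteq> q (Suc i)" "f i \<in> q (Suc i) - q i"
    "\<And>x. x \<in> q (Suc i) \<Longrightarrow> \<exists>s\<in>R - P. \<exists>a\<in>q i. \<exists>b\<in>R. s * x = a + b * f i" if "i < e" for i
    using ch that by (auto simp: parameter_chain_def)
  have qP: "i \<le> e \<Longrightarrow> q i \<subseteq> P" for i
    by (induction i rule: inc_induct) (use qe qs(1) in auto)
  show ?thesis
  proof (rule regular_chain.intro)
    show "sub_ring T" by (rule sub_ring_T)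
    show "ext (q 0) = {0}" unfolding q0 ext_def using one_compl by auto
    show "prime_in T (ext (q i))" if "i \<le> e" for i by (rule prime_ext[OF qp qP]) fact+
    show "ext (q i) \<subseteq> ext (q (Suc i))" if "i < e" for i by (rule ext_mono[OF qs(1)[OF that]])
    show "f i \<in> ext (q (Suc i)) - ext (q i)" if "i < e" for i
    proof -
      have "f i \<in> R" using qs(2)[OF that] ideal_inD(1)[OF prime_inD(1)[OF qp[of "Suc i"]]] that by auto
      then show ?thesis
        using qs(2)[OF that] ext_contract[OF qp qP, of i] subset_ext[of "q (Suc i)"] that by auto
    qed
    show "1 / x \<in> T" if "x \<in> T" "x \<notin> ext (q e)" for x
      using inverse_outside_ext that by (simp add: qe)
    fix i x assume i: "i < e" and "x \<in> ext (q (Suc i))"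
    then obtain y s where ys: "y \<in> q (Suc i)" "s \<in> R - P" "x = y / s" by (auto simp: ext_def)
    obtain s' a b where sab: "s' \<in> R - P" "a \<in> q i" "b \<in> R" "s' * y = a + b * f i"
      using qs(3)[OF i ys(1)] by blast
    have ss: "s * s' \<in> R - P" by (rule mult_compl) fact+
    have "x = (s' * y) / (s * s')" using ys compl_nonzero[OF sab(1)] by simp
    also have "\<dots> = a / (s * s') + b / (s * s') * f i" by (simp add: sab(4) add_divide_distrib)
    finally have "x = a / (s * s') + b / (s * s') * f i" .
    moreover have "a / (s * s') \<in> ext (q i)" using sab(2) ss by (auto simp: ext_def)
    moreover have "b / (s * s') \<in> T" using sab(3) ss by (auto simp: localize_def)
    ultimately show "\<exists>a\<in>ext (q i). \<exists>b\<in>T. x = a + b * f i" by blast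
  qed
qed

text \<open>The parameter chain yields both the lower bound for the dimension and the number of
  generators. Conversely, the top of a chain in the local ring contracts into \<open>P\<close> and
  has rank at least \<open>rank_mod P\<close>, so \<open>prime_chain_length\<close> bounds its
  length by \<open>e\<close>.\<close>

lemma (in affine_ring) regular_local_localize:
  assumes P: "prime_in (ralg K Z) P" shows "regular_local (localize (ralg K Z) P)"
proof -
  interpret R: sub_ring "ralg K Z" by (rule sub_ring_ralg[OF K])
  interpret L: prime_localization "ralg K Z" P by unfold_locales (rule P)
  define e where "e = card Z - rank_mod P"
  obtain q f where qf: "parameter_chain (ralg K Z) P e q f"
    using parameter_chain_exists[OF P] unfolding e_def by auto
  interpret C: regular_chain L.T e "\<lambda>i. L.ext (q i)" f by (rule L.regular_chain_T[OF qf])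
  have qe: "q e = P" using qf by (simp add: parameter_chain_def)
  let ?S = "{enat n | n. \<exists>c. (\<forall>i\<le>n. prime_in L.T (c i)) \<and> (\<forall>i<n. c i \<subset> c (Suc i))}"
  have "krull_dim L.T = enat e"
    unfolding krull_dim_def
  proof (rule antisym[OF Sup_least Sup_upper])
    have "enat e \<in> ?S"
      using C.prime C.mono C.f by (intro CollectI exI[of _ e] conjI refl exI[of _ "\<lambda>i. L.ext (q i)"]) blast+
    then show "enat e \<in> ?S" .
    fix N assume "N \<in> ?S"
    then obtain n c where n: "N = enat n" and c: "\<forall>i\<le>n. prime_in L.T (c i)" "\<forall>i<n. c i \<subset> c (Suc i)" by auto
    have "\<forall>i\<le>n. prime_in (ralg K Z) (c i \<inter> ralg K Z)"
      using prime_contract[OF R.sub_ring_axioms L.sub_T] c(1) by blast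
    moreover have "\<forall>i<n. c i \<inter> ralg K Z \<subset> c (Suc i) \<inter> ralg K Z"
    proof (intro allI impI)
      fix i assume "i < n"
      then show "c i \<inter> ralg K Z \<subset> c (Suc i) \<inter> ralg K Z"
        using c by (intro L.contract_strict) (auto intro: prime_inD(1))
    qed
    ultimately have "n + rank_mod (c n \<inter> ralg K Z) \<le> card Z" by (rule prime_chain_length)
    moreover have cn: "prime_in L.T (c n)" using c(1) by simp
    have "rank_mod P \<le> rank_mod (c n \<inter> ralg K Z)"
      using L.contract_subset[OF prime_inD(1,2)[OF cn]] by (rule rank_mod_antimono[OF P])
    ultimately show "N \<le> enat e" by (simp add: n e_def)
  qed
  moreover have "min_gens L.T (THE M. maximal_in L.T M) = e"
    using C.min_gens_eq by (simp add: L.maximal_iff qe)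
  ultimately show ?thesis
    unfolding regular_local_def using L.local_ring_T L.noetherian_T[OF noetherian_ralg] by simp
qed

text \<open>The denominators are units of \<open>S\<close> and so avoid every prime
  \<open>P\<close>; hence \<open>S\<close> at \<open>P\<close> and the polynomial ring at the
  contraction of \<open>P\<close> have the same localization.\<close>

lemma (in affine_ring) regular_ring_fractions:
  assumes S: "sub_ring S" "ralg K Z \<subseteq> S"
    and frac: "\<And>x. x \<in> S \<Longrightarrow> \<exists>s\<in>ralg K Z. s \<noteq> 0 \<and> 1 / s \<in> S \<and> s * x \<in> ralg K Z"
  shows "regular_ring S"
  unfolding regular_ring_def
proof (intro conjI allI impI)
  interpret R: sub_ring "ralg K Z" by (rule sub_ring_ralg[OF K])
  interpret S: sub_ring S by (rule S)
  show "noetherian S" by (rule R.noetherian_fractions[OF noetherian_ralg S frac])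
  fix P assume P: "prime_in S P"
  have unit: "s \<notin> P" if "s \<noteq> 0" "1 / s \<in> S" for s
    using ideal_inD(4)[OF prime_inD(1)[OF P] that(2), of s] that(1) prime_not_one[OF P] by auto
  have "localize S P = localize (ralg K Z) (P \<inter> ralg K Z)"
  proof
    show "localize (ralg K Z) (P \<inter> ralg K Z) \<subseteq> localize S P"
      using S(2) by (auto simp: localize_def)
    show "localize S P \<subseteq> localize (ralg K Z) (P \<inter> ralg K Z)"
    proof
      fix w assume "w \<in> localize S P"
      then obtain x y where xy: "x \<in> S" "y \<in> S - P" "w = x / y" by (auto simp: localize_def)
      obtain s where s: "s \<in> ralg K Z" "s \<noteq> 0" "1 / s \<in> S" "s * x \<in> ralg K Z" using frac[OF xy(1)] by auto
      obtain s' where s': "s' \<in> ralg K Z" "s' \<noteq> 0" "1 / s' \<in> S" "s' * y \<in> ralg K Z" using frac xy(2) by blast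
      have "s * (s' * y) \<in> ralg K Z" using s(1) s'(4) by auto
      moreover have "s * (s' * y) \<notin> P"
      proof -
        have "s \<in> S - P" "s' \<in> S - P" using unit[OF s(2,3)] unit[OF s'(2,3)] s(1) s'(1) S(2) by auto
        moreover from this(2) xy(2) have "s' * y \<in> S - P" using prime_compl_mult[OF P, of s' y] by auto
        ultimately show ?thesis using prime_compl_mult[OF P] by blast
      qed
      moreover have "s' * (s * x) \<in> ralg K Z" using s(4) s'(1) by auto
      moreover have "w = (s' * (s * x)) / (s * (s' * y))" using xy(3) s(2) s'(2) by simp
      ultimately show "w \<in> localize (ralg K Z) (P \<inter> ralg K Z)" unfolding localize_def by blast
    qed
  qed
  then show "regular_local (localize S P)"
    using regular_local_localize[OF prime_contract[OF R.sub_ring_axioms S(2) P]] by simp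
qed

section \<open>Algebraic independence through linear terms\<close>

lemma comm_ring_homI:
  assumes "f 1 = 1" "\<And>x y. f (x + y) = f x + f y" "\<And>x y. f (x * y) = f x * f y"
  shows "comm_ring_hom (f :: 'a::comm_ring_1 \<Rightarrow> 'b::comm_ring_1)"
proof -
  have "f 0 = 0" using assms(2)[of 0 0] by simp
  then show ?thesis by unfold_locales (use assms in auto)
qed

lemma comm_ring_homD:
  assumes "comm_ring_hom f"
  shows "f 0 = 0" "f 1 = 1" "f (x + y) = f x + f y" "f (x * y) = f x * f y" "f (- x) = - f x"
    "f (x - y) = f x - f y" "f (x ^ k) = f x ^ k" "f (sum g A) = (\<Sum>i\<in>A. f (g i))"
    "f (prod g A) = (\<Prod>i\<in>A. f (g i))" "f (of_int z) = of_int z"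
proof -
  interpret comm_ring_hom f by fact
  show "f 0 = 0" "f 1 = 1" "f (x + y) = f x + f y" "f (x * y) = f x * f y" "f (- x) = - f x"
    "f (x - y) = f x - f y" "f (x ^ k) = f x ^ k" "f (sum g A) = (\<Sum>i\<in>A. f (g i))"
    "f (prod g A) = (\<Prod>i\<in>A. f (g i))" "f (of_int z) = of_int z"
    by (simp_all add: hom_distribs)
qed

lemma comm_ring_hom_comp:
  "comm_ring_hom f \<Longrightarrow> comm_ring_hom g \<Longrightarrow> comm_ring_hom (\<lambda>x. f (g x))"
  by (rule comm_ring_homI) (simp_all add: comm_ring_homD)

lemma comm_ring_hom_map_poly: "comm_ring_hom f \<Longrightarrow> comm_ring_hom (map_poly f)"
proof -
  assume "comm_ring_hom f"
  then interpret map_poly_comm_ring_hom f by (rule map_poly_comm_ring_hom.intro)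
  show ?thesis by (rule comm_ring_homI) (simp_all add: hom_distribs)
qed

lemma comm_ring_hom_poly: "comm_ring_hom (\<lambda>p. poly p a)"
  by (rule comm_ring_homI) simp_all

lemma comm_ring_hom_const_poly: "comm_ring_hom (\<lambda>c. [:c:])"
  by (rule comm_ring_homI) (simp_all add: one_pCons)

lemma comm_ring_hom_Const: "comm_ring_hom Const"
  by (rule comm_ring_homI) (simp_all add: Const_def single_add mult_single)

lemma comm_ring_hom_to_fract: "comm_ring_hom to_fract"
  by (rule comm_ring_homI) simp_all

abbreviation X :: "nat \<times> nat \<Rightarrow> 'k::comm_ring_1 mpoly" where
  "X v \<equiv> Xvar (fst v) (snd v)"

definition monom_eval :: "('v \<Rightarrow> 'a::comm_ring_1) \<Rightarrow> ('v \<Rightarrow>\<^sub>0 nat) \<Rightarrow> 'a" where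
  "monom_eval g a = (\<Prod>v\<in>Poly_Mapping.keys a. g v ^ Poly_Mapping.lookup a v)"

lemma monom_eval_superset:
  assumes "finite A" "Poly_Mapping.keys a \<subseteq> A"
  shows "monom_eval g a = (\<Prod>v\<in>A. g v ^ Poly_Mapping.lookup a v)"
  unfolding monom_eval_def using assms
  by (intro prod.mono_neutral_left) (auto simp: in_keys_iff)

lemma monom_eval_add: "monom_eval g (a + b) = monom_eval g a * monom_eval g b"
proof -
  let ?A = "Poly_Mapping.keys a \<union> Poly_Mapping.keys b"
  have "Poly_Mapping.keys (a + b) \<subseteq> ?A" by (rule keys_add)
  then show ?thesis
    by (simp add: monom_eval_superset[of ?A] lookup_add power_add prod.distrib)
qed

lemma monom_eval_0: "monom_eval g 0 = 1"
  by (simp add: monom_eval_def)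

text \<open>Coefficients go through \<open>h\<close>, so that univariate polynomials over
  \<open>mpoly\<close> are possible targets: their variable plays the infinitesimal.\<close>

definition mpoly_eval ::
    "('k::comm_ring_1 \<Rightarrow> 'a::comm_ring_1) \<Rightarrow> ('v \<Rightarrow> 'a) \<Rightarrow> (('v \<Rightarrow>\<^sub>0 nat) \<Rightarrow>\<^sub>0 'k) \<Rightarrow> 'a" where
  "mpoly_eval h g p = (\<Sum>a\<in>Poly_Mapping.keys p. h (Poly_Mapping.lookup p a) * monom_eval g a)"

lemma poly_mapping_sum_single:
  "p = (\<Sum>a\<in>Poly_Mapping.keys p. Poly_Mapping.single a (Poly_Mapping.lookup p a))"
  by (intro poly_mapping_eqI) (simp add: lookup_sum lookup_single when_def in_keys_iff)

context
  fixes h :: "'k::comm_ring_1 \<Rightarrow> 'a::comm_ring_1" and g :: "'v \<Rightarrow> 'a"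
  assumes h: "comm_ring_hom h"
begin

lemma mpoly_eval_superset:
  assumes "finite A" "Poly_Mapping.keys p \<subseteq> A"
  shows "mpoly_eval h g p = (\<Sum>a\<in>A. h (Poly_Mapping.lookup p a) * monom_eval g a)"
  unfolding mpoly_eval_def using assms
  by (intro sum.mono_neutral_left) (auto simp: in_keys_iff comm_ring_homD[OF h])

lemma mpoly_eval_add: "mpoly_eval h g (p + q) = mpoly_eval h g p + mpoly_eval h g q"
proof -
  let ?A = "Poly_Mapping.keys p \<union> Poly_Mapping.keys q"
  have "Poly_Mapping.keys (p + q) \<subseteq> ?A" by (rule keys_add)
  then show ?thesis
    by (simp add: mpoly_eval_superset[of ?A] lookup_add comm_ring_homD[OF h] distrib_right sum.distrib)
qed

lemma mpoly_eval_single: "mpoly_eval h g (Poly_Mapping.single a c) = h c * monom_eval g a"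
  by (simp add: mpoly_eval_superset[of "{a}"])

lemma mpoly_eval_sum: "mpoly_eval h g (sum f A) = (\<Sum>i\<in>A. mpoly_eval h g (f i))"
proof (induction A rule: infinite_finite_induct)
  case (insert i A)
  then show ?case by (simp add: mpoly_eval_add)
qed (simp_all add: mpoly_eval_def)

lemma mpoly_eval_mult: "mpoly_eval h g (p * q) = mpoly_eval h g p * mpoly_eval h g q"
proof -
  have "mpoly_eval h g (p * q) = mpoly_eval h g
      ((\<Sum>a\<in>Poly_Mapping.keys p. Poly_Mapping.single a (Poly_Mapping.lookup p a)) *
       (\<Sum>b\<in>Poly_Mapping.keys q. Poly_Mapping.single b (Poly_Mapping.lookup q b)))"
    using poly_mapping_sum_single[of p] poly_mapping_sum_single[of q] by simp
  also have "\<dots> = mpoly_eval h g p * mpoly_eval h g q"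
    unfolding sum_product mpoly_eval_sum mult_single mpoly_eval_single
    by (simp add: mpoly_eval_def sum_product comm_ring_homD[OF h] monom_eval_add mult_ac)
  finally show ?thesis .
qed

lemma comm_ring_hom_mpoly_eval: "comm_ring_hom (mpoly_eval h g)"
proof (rule comm_ring_homI)
  show "mpoly_eval h g 1 = 1"
    using mpoly_eval_single[of 0 1] by (simp add: monom_eval_0 comm_ring_homD[OF h])
qed (simp_all add: mpoly_eval_add mpoly_eval_mult)

end

lemma mpoly_eval_Const: "comm_ring_hom h \<Longrightarrow> mpoly_eval h g (Const c) = h c"
  by (simp add: Const_def mpoly_eval_single monom_eval_0)

lemma mpoly_eval_Xvar: "comm_ring_hom h \<Longrightarrow> mpoly_eval h g (Xvar i j) = g (i, j)"
  by (simp add: Xvar_def mpoly_eval_single monom_eval_def comm_ring_homD)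

lemma single_eq_Const_monom:
  "Poly_Mapping.single a c = Const c * monom_eval X a" for c :: "'k::comm_ring_1"
proof -
  have X_power: "X v ^ e = Poly_Mapping.single (Poly_Mapping.single v e) (1::'k)" for v e
    by (induction e) (simp_all add: Xvar_def mult_single single_add[symmetric])
  have prod: "(\<Prod>v\<in>A. Poly_Mapping.single (f v) (1::'k)) = Poly_Mapping.single (sum f A) 1"
    for f :: "nat \<times> nat \<Rightarrow> (nat \<times> nat) \<Rightarrow>\<^sub>0 nat" and A
    by (induction A rule: infinite_finite_induct) (simp_all add: mult_single)
  show ?thesis
    unfolding monom_eval_def X_power prod
    by (simp add: Const_def mult_single poly_mapping_sum_single[of a, symmetric])
qed

lemma mpoly_hom_eqI:
  fixes F G :: "'k::comm_ring_1 mpoly \<Rightarrow> 'a::comm_ring_1"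
  assumes F: "comm_ring_hom F" and G: "comm_ring_hom G"
    and "\<And>c. F (Const c) = G (Const c)" "\<And>i j. F (Xvar i j) = G (Xvar i j)"
  shows "F p = G p"
proof -
  have *: "H p = (\<Sum>a\<in>Poly_Mapping.keys p. H (Const (Poly_Mapping.lookup p a)) *
      (\<Prod>v\<in>Poly_Mapping.keys a. H (X v) ^ Poly_Mapping.lookup a v))" if H: "comm_ring_hom H" for H :: "'k mpoly \<Rightarrow> 'a"
  proof -
    have "H p = H (\<Sum>a\<in>Poly_Mapping.keys p. Poly_Mapping.single a (Poly_Mapping.lookup p a))"
      using poly_mapping_sum_single[of p] by simp
    also have "\<dots> = (\<Sum>a\<in>Poly_Mapping.keys p. H (Const (Poly_Mapping.lookup p a)) *
      (\<Prod>v\<in>Poly_Mapping.keys a. H (X v) ^ Poly_Mapping.lookup a v))"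
      unfolding single_eq_Const_monom monom_eval_def by (simp only: comm_ring_homD[OF H])
    finally show ?thesis .
  qed
  show ?thesis by (simp add: *[OF F] *[OF G] assms)
qed

text \<open>If the linear terms at a point of the polynomials \<open>\<phi> v\<close> are algebraically independent
  (for which a left inverse of the linear substitution suffices), then so are the \<open>\<phi> v\<close> themselves:
  the linear terms satisfy the lowest form of every relation.\<close>
lemma mpoly_eval_injective:
  fixes \<phi> l :: "nat \<times> nat \<Rightarrow> 'k::idom mpoly" and c :: "nat \<times> nat \<Rightarrow> 'k"
    and x0 x1 :: "nat \<times> nat \<Rightarrow> 'k mpoly"
  assumes expansion: "\<And>v. \<exists>U. mpoly_eval (\<lambda>c. [:Const c:]) (\<lambda>w. [:x0 w, x1 w:]) (\<phi> v) =
      pCons (Const (c v)) (pCons (l v) U)"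
    and inverse: "\<And>v. mpoly_eval Const y (l v) = X v"
    and p: "mpoly_eval Const \<phi> p = 0"
  shows "p = 0"
proof -
  note cC = comm_ring_hom_Const
  have cP: "comm_ring_hom (\<lambda>c::'k. [:Const c:])"
    by (rule comm_ring_hom_comp[OF comm_ring_hom_const_poly cC])
  note ev = mpoly_eval_Const[OF cC] mpoly_eval_Xvar[OF cC] mpoly_eval_Const[OF cP] mpoly_eval_Xvar[OF cP]
  note hC = comm_ring_hom_mpoly_eval[OF cC] and hP = comm_ring_hom_mpoly_eval[OF cP]
  define U where "U v = (SOME U. mpoly_eval (\<lambda>c. [:Const c:]) (\<lambda>w. [:x0 w, x1 w:]) (\<phi> v) =
      pCons (Const (c v)) (pCons (l v) U))" for v
  have U: "mpoly_eval (\<lambda>c. [:Const c:]) (\<lambda>w. [:x0 w, x1 w:]) (\<phi> v) =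
      pCons (Const (c v)) (pCons (l v) (U v))" for v
    unfolding U_def by (rule someI_ex[OF expansion])
  \<comment> \<open>Translation moves the constant terms \<open>c v\<close> to zero:
    \<open>q\<close> is a relation between the differences of \<open>\<phi> v\<close> and its
    constant term.\<close>
  define q where "q = mpoly_eval Const (\<lambda>v. X v + Const (c v)) p"
  have pq: "p = mpoly_eval Const (\<lambda>v. X v - Const (c v)) q" unfolding q_def
    by (rule mpoly_hom_eqI[of "\<lambda>p. p" "\<lambda>p. mpoly_eval Const (\<lambda>v. X v - Const (c v)) (mpoly_eval Const (\<lambda>v. X v + Const (c v)) p)"])
      (auto intro!: comm_ring_hom_comp[OF hC hC] comm_ring_homI simp: ev comm_ring_homD[OF hC])
  \<comment> \<open>\<open>\<Gamma>\<close> substitutes these differences divided by the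
    infinitesimal; its value at 0 is the substitution of the \<open>l v\<close>.
    \<open>\<Theta>\<close> marks degrees: coefficient number d of \<open>\<Theta> q\<close> is the
    homogeneous part of degree d.\<close>
  define \<Gamma> where "\<Gamma> = mpoly_eval (\<lambda>c. [:Const c:]) (\<lambda>v. pCons (l v) (U v))"
  define \<Theta> where "\<Theta> = mpoly_eval (\<lambda>c. [:Const c:]) (\<lambda>v. [:0, X v:] :: 'k mpoly poly)"
  have h\<Gamma>: "comm_ring_hom \<Gamma>" unfolding \<Gamma>_def by (rule hP)
  have h\<Theta>: "comm_ring_hom \<Theta>" unfolding \<Theta>_def by (rule hP)
  have \<Gamma>s: "\<Gamma> (Const a) = [:Const a:]" "\<Gamma> (Xvar i j) = pCons (l (i, j)) (U (i, j))" for a i j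
    by (simp_all add: \<Gamma>_def ev)
  have \<Theta>s: "\<Theta> (Const a) = [:Const a:]" "\<Theta> (Xvar i j) = [:0, Xvar i j:]" for a i j
    by (simp_all add: \<Theta>_def ev)
  define \<epsilon> :: "'k mpoly poly" where "\<epsilon> = [:0, 1:]"
  have h\<epsilon>: "comm_ring_hom (\<lambda>p. poly (map_poly \<Gamma> (\<Theta> p)) \<epsilon>)"
    by (rule comm_ring_hom_comp[OF comm_ring_hom_poly comm_ring_hom_comp[OF comm_ring_hom_map_poly[OF h\<Gamma>] h\<Theta>]])
  have map_\<Gamma>: "map_poly \<Gamma> [:a, b:] = [:\<Gamma> a, \<Gamma> b:]" "map_poly \<Gamma> [:a:] = [:\<Gamma> a:]" for a b
    by (simp_all add: poly_eq_iff coeff_map_poly comm_ring_homD[OF h\<Gamma>] coeff_pCons split: nat.split)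
  \<comment> \<open>Restoring the divided factor: applying \<open>\<Gamma>\<close> to each
    homogeneous part and weighting it by the matching power of \<open>\<epsilon>\<close> gives back
    the original substitution.\<close>
  have "mpoly_eval (\<lambda>c. [:Const c:]) (\<lambda>w. [:x0 w, x1 w:]) (mpoly_eval Const \<phi> p)
      = poly (map_poly \<Gamma> (\<Theta> (mpoly_eval Const (\<lambda>v. X v + Const (c v)) p))) \<epsilon>"
  proof (rule mpoly_hom_eqI[OF comm_ring_hom_comp[OF hP hC] comm_ring_hom_comp[OF h\<epsilon> hC]])
    show "mpoly_eval (\<lambda>c. [:Const c:]) (\<lambda>w. [:x0 w, x1 w:]) (mpoly_eval Const \<phi> (Const a)) =
      poly (map_poly \<Gamma> (\<Theta> (mpoly_eval Const (\<lambda>v. X v + Const (c v)) (Const a)))) \<epsilon>" for a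
      by (simp add: ev \<Gamma>s \<Theta>s map_\<Gamma>)
    show "mpoly_eval (\<lambda>c. [:Const c:]) (\<lambda>w. [:x0 w, x1 w:]) (mpoly_eval Const \<phi> (Xvar i j)) =
      poly (map_poly \<Gamma> (\<Theta> (mpoly_eval Const (\<lambda>v. X v + Const (c v)) (Xvar i j)))) \<epsilon>" for i j
      by (simp add: ev \<Gamma>s \<Theta>s map_\<Gamma> U comm_ring_homD[OF h\<Theta>] comm_ring_homD[OF h\<Gamma>] \<epsilon>_def)
  qed
  then have 0: "poly (map_poly \<Gamma> (\<Theta> q)) \<epsilon> = 0" by (simp add: p q_def comm_ring_homD[OF hP])
  have \<Theta>1: "poly (\<Theta> q) 1 = q"
    by (rule mpoly_hom_eqI[OF comm_ring_hom_comp[OF comm_ring_hom_poly h\<Theta>]])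
      (auto intro!: comm_ring_homI simp: \<Theta>s)
  have l_inj: "s = 0" if "poly (\<Gamma> s) 0 = 0" for s
  proof -
    have "mpoly_eval Const y (poly (\<Gamma> s) 0) = s"
      by (rule mpoly_hom_eqI[OF comm_ring_hom_comp[OF hC comm_ring_hom_comp[OF comm_ring_hom_poly h\<Gamma>]]])
        (auto intro!: comm_ring_homI simp: \<Gamma>s ev inverse)
    then show ?thesis using that by (simp add: comm_ring_homD[OF hC])
  qed
  have "q = 0"
  proof (rule ccontr)
    assume "q \<noteq> 0"
    then have "\<Theta> q \<noteq> 0" using \<Theta>1 by auto
    then have ex: "\<exists>d. coeff (\<Theta> q) d \<noteq> 0" by (metis leading_coeff_0_iff)
    define d where "d = (LEAST d. coeff (\<Theta> q) d \<noteq> 0)"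
    have d: "coeff (\<Theta> q) d \<noteq> 0" unfolding d_def by (rule LeastI_ex[OF ex])
    have low: "coeff (\<Theta> q) i = 0" if "i < d" for i
      using not_less_Least[OF that[unfolded d_def]] by simp
    \<comment> \<open>\<open>d\<close> is the degree of the lowest form of \<open>q\<close>. After
      cancelling \<open>\<epsilon> ^ d\<close>, the constant term of the relation is this form at
      the \<open>l v\<close>.\<close>
    have "\<Theta> q = monom 1 d * poly_shift d (\<Theta> q)"
      by (intro poly_eqI) (auto simp: coeff_monom_mult coeff_poly_shift low)
    then have "map_poly \<Gamma> (\<Theta> q) = map_poly \<Gamma> (monom 1 d) * map_poly \<Gamma> (poly_shift d (\<Theta> q))"
      by (metis comm_ring_homD(4)[OF comm_ring_hom_map_poly[OF h\<Gamma>]])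
    moreover have "map_poly \<Gamma> (monom 1 d) = monom 1 d"
      by (simp add: poly_eq_iff coeff_map_poly comm_ring_homD[OF h\<Gamma>] coeff_monom)
    ultimately have "\<epsilon> ^ d * poly (map_poly \<Gamma> (poly_shift d (\<Theta> q))) \<epsilon> = 0"
      using 0 by (simp add: poly_monom)
    then have "poly (map_poly \<Gamma> (poly_shift d (\<Theta> q))) \<epsilon> = 0" by (simp add: \<epsilon>_def)
    then have "poly (poly (map_poly \<Gamma> (poly_shift d (\<Theta> q))) \<epsilon>) 0 = 0" by simp
    moreover have "poly (poly (map_poly \<Gamma> r) \<epsilon>) 0 = poly (\<Gamma> (coeff r 0)) 0" for r
    proof (cases r)
      case (pCons a r')
      have "map_poly \<Gamma> (pCons a r') = pCons (\<Gamma> a) (map_poly \<Gamma> r')"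
        by (simp add: poly_eq_iff coeff_map_poly comm_ring_homD[OF h\<Gamma>] coeff_pCons split: nat.split)
      then show ?thesis using pCons by (simp add: \<epsilon>_def)
    qed
    ultimately have "poly (\<Gamma> (coeff (\<Theta> q) d)) 0 = 0" by (simp add: coeff_poly_shift)
    then show False using l_inj d by blast
  qed
  then show ?thesis using pq by (simp add: comm_ring_homD[OF hC])
qed

lemma sub_ring_constants: "sub_ring (range (\<lambda>c. to_fract (Const c :: 'k::field mpoly)))"
proof -
  have h: "comm_ring_hom (\<lambda>c::'k. to_fract (Const c))"
    by (rule comm_ring_hom_comp[OF comm_ring_hom_to_fract comm_ring_hom_Const])
  show ?thesis
    by (unfold_locales; clarsimp?; metis comm_ring_homD[OF h] rangeI)
qed

lemma image_alg_gen:
  "to_fract ` alg_gen S = ralg (range (\<lambda>c. to_fract (Const c :: 'k::field mpoly))) (to_fract ` S)"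
proof (rule antisym; rule subsetI)
  fix x assume "x \<in> to_fract ` alg_gen S"
  then obtain p where "p \<in> alg_gen S" "x = to_fract p" by auto
  from this(1) have "to_fract p \<in> ralg (range (\<lambda>c. to_fract (Const c))) (to_fract ` S)"
    by induction (auto intro: ralg.intros)
  then show "x \<in> ralg (range (\<lambda>c. to_fract (Const c))) (to_fract ` S)" using \<open>x = to_fract p\<close> by simp
next
  fix x assume "x \<in> ralg (range (\<lambda>c. to_fract (Const c))) (to_fract ` S)"
  then show "x \<in> to_fract ` alg_gen S"
  proof induction
    case (base c) then show ?case by (auto intro: alg_gen.const)
  next
    case (gen z) then show ?case by (auto intro: alg_gen.gen)
  next
    case (add x y) then show ?case by (auto simp flip: to_fract_add intro: alg_gen.add)
  next
    case (mult x y) then show ?case by (auto simp flip: to_fract_mult intro: alg_gen.mult)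
  qed
qed

text \<open>A relation of \<open>\<phi> v\<close> over the algebra of the other members lifts to a
  polynomial \<open>r\<close> in the indeterminates that the substitution kills, so
  \<open>r = 0\<close>.\<close>

lemma affine_ring_if_injective:
  fixes \<phi> :: "nat \<times> nat \<Rightarrow> 'k::field mpoly"
  assumes inj: "\<And>p. mpoly_eval Const \<phi> p = 0 \<Longrightarrow> p = 0" and I: "finite I"
  shows "affine_ring (range (\<lambda>c. to_fract (Const c :: 'k mpoly))) (to_fract ` \<phi> ` I)"
proof (rule affine_ring.intro)
  let ?K = "range (\<lambda>c. to_fract (Const c :: 'k mpoly))"
  let ?\<Phi> = "mpoly_eval Const \<phi>"
  have h: "comm_ring_hom (\<lambda>c::'k. to_fract (Const c))"
    by (rule comm_ring_hom_comp[OF comm_ring_hom_to_fract comm_ring_hom_Const])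
  note h\<Phi> = comm_ring_hom_mpoly_eval[OF comm_ring_hom_Const, of \<phi>]
  note ev = mpoly_eval_Const[OF comm_ring_hom_Const] mpoly_eval_Xvar[OF comm_ring_hom_Const]
  show "sub_ring ?K" by (rule sub_ring_constants)
  then interpret K: sub_ring ?K .
  show "finite (to_fract ` \<phi> ` I)" using I by simp
  show "1 / c \<in> ?K" if c: "c \<in> ?K" "c \<noteq> 0" for c
  proof -
    from c obtain a where a: "c = to_fract (Const a)" by auto
    then have "a \<noteq> 0" using c(2) comm_ring_homD(1)[OF h] by auto
    have "c * to_fract (Const (1 / a)) = to_fract (Const (a * (1 / a)))"
      unfolding a by (simp only: comm_ring_homD(4)[OF h])
    also have "\<dots> = 1" using \<open>a \<noteq> 0\<close> comm_ring_homD(2)[OF h] by simp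
    finally have "1 / c = to_fract (Const (1 / a))" using c(2) by (simp add: field_simps)
    then show ?thesis by simp
  qed
  fix z assume "z \<in> to_fract ` \<phi> ` I"
  then obtain v where v: "v \<in> I" "z = to_fract (\<phi> v)" by auto
  let ?B = "to_fract ` \<phi> ` (I - {v})"
  have "transc (ralg ?K ?B) z"
    unfolding transc_def
  proof (intro ballI impI)
    fix u assume u: "u \<in> polys (ralg ?K ?B)" "poly u z = 0"
    have "\<exists>p. x = to_fract (?\<Phi> p) \<and> p \<in> alg_gen (X ` (I - {v}))" if "x \<in> ralg ?K ?B" for x
      using that
    proof induction
      case (base c)
      then obtain a where "c = to_fract (Const a)" by auto
      then show ?case by (intro exI[of _ "Const a"]) (auto simp: ev intro: alg_gen.const)
    next
      case (gen z)
      then obtain w where "w \<in> I - {v}" "z = to_fract (\<phi> w)" by auto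
      then show ?case by (intro exI[of _ "X w"]) (auto simp: ev intro: alg_gen.gen)
    next
      case (add x y)
      then obtain p q where "x = to_fract (?\<Phi> p)" "p \<in> alg_gen (X ` (I - {v}))"
         "y = to_fract (?\<Phi> q)" "q \<in> alg_gen (X ` (I - {v}))" by auto
      then show ?case by (intro exI[of _ "p + q"]) (auto simp: comm_ring_homD[OF h\<Phi>] intro: alg_gen.add)
    next
      case (mult x y)
      then obtain p q where "x = to_fract (?\<Phi> p)" "p \<in> alg_gen (X ` (I - {v}))"
         "y = to_fract (?\<Phi> q)" "q \<in> alg_gen (X ` (I - {v}))" by auto
      then show ?case by (intro exI[of _ "p * q"]) (auto simp: comm_ring_homD[OF h\<Phi>] intro: alg_gen.mult)
    qed
    then have "\<forall>i. \<exists>p. coeff u i = to_fract (?\<Phi> p) \<and> p \<in> alg_gen (X ` (I - {v}))"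
      using polysD[OF u(1)] by blast
    from choice[OF this] obtain p where
      "\<forall>i. coeff u i = to_fract (?\<Phi> (p i)) \<and> p i \<in> alg_gen (X ` (I - {v}))" ..
    then have p: "\<And>i. coeff u i = to_fract (?\<Phi> (p i))" "\<And>i. p i \<in> alg_gen (X ` (I - {v}))" by auto
    define r where "r = (\<Sum>i\<le>degree u. p i * X v ^ i)"
    have "to_fract (?\<Phi> r) = (\<Sum>i\<le>degree u. coeff u i * z ^ i)"
      unfolding r_def by (simp add: comm_ring_homD[OF h\<Phi>] comm_ring_homD[OF comm_ring_hom_to_fract] ev v p)
    also have "\<dots> = 0" using u(2) by (simp add: poly_altdef)
    finally have "?\<Phi> r = 0" by simp
    then have "r = 0" by (rule inj)
    have cP: "comm_ring_hom (\<lambda>c::'k. [:Const c:])"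
      by (rule comm_ring_hom_comp[OF comm_ring_hom_const_poly comm_ring_hom_Const])
    \<comment> \<open>\<open>\<Psi>\<close> reads \<open>r\<close> as a univariate polynomial in
      \<open>X v\<close>, so that the coefficients \<open>p i\<close>, which are free of
      \<open>X v\<close>, vanish separately.\<close>
    define \<Psi> where "\<Psi> = mpoly_eval (\<lambda>c. [:Const c:]) (\<lambda>w. if w = v then [:0, 1:] else [:X w:] :: 'k mpoly poly)"
    have h\<Psi>: "comm_ring_hom \<Psi>" unfolding \<Psi>_def by (rule comm_ring_hom_mpoly_eval[OF cP])
    have \<Psi>s: "\<Psi> (Const a) = [:Const a:]" "\<Psi> (X v) = [:0, 1:]"
      "(i, j) \<noteq> v \<Longrightarrow> \<Psi> (Xvar i j) = [:Xvar i j:]" for a i j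
      by (simp_all add: \<Psi>_def mpoly_eval_Const[OF cP] mpoly_eval_Xvar[OF cP])
    have \<Psi>p: "\<Psi> q = [:q:]" if "q \<in> alg_gen (X ` (I - {v}))" for q
      using that
    proof induction
      case (gen x)
      then obtain w where "w \<noteq> v" "x = X w" by auto
      then show ?case using \<Psi>s(3)[of "fst w" "snd w"] by simp
    qed (simp_all add: \<Psi>s comm_ring_homD[OF h\<Psi>])
    have "0 = \<Psi> r" using \<open>r = 0\<close> comm_ring_homD[OF h\<Psi>] by simp
    also have "\<Psi> r = (\<Sum>i\<le>degree u. monom (p i) i)"
      unfolding r_def by (simp add: comm_ring_homD[OF h\<Psi>] \<Psi>s(2) \<Psi>p[OF p(2)] monom_altdef)
    finally have 0: "coeff (\<Sum>i\<le>degree u. monom (p i) i) j = 0" for j by (metis coeff_0)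
    have "p j = 0" if "j \<le> degree u" for j
      using 0[of j] that by (simp add: coeff_sum)
    then have "lead_coeff u = 0" by (simp add: p(1) comm_ring_homD[OF h\<Phi>])
    then show "u = 0" by simp
  qed
  moreover have "ralg ?K (to_fract ` \<phi> ` I - {z}) \<subseteq> ralg ?K ?B"
    using v by (intro ralg_mono[OF sub_ring_constants]) auto
  ultimately show "transc (ralg ?K (to_fract ` \<phi> ` I - {z})) z" by (rule transc_mono)
qed

section \<open>Constant and linear terms of minors at the diagonal point\<close>

lemma coeff_prod_linear:
  assumes "finite S"
  shows "coeff (\<Prod>i\<in>S. [:a i, b i:]) 0 = (\<Prod>i\<in>S. a i)"
    "coeff (\<Prod>i\<in>S. [:a i, b i:]) 1 = (\<Sum>i\<in>S. b i * (\<Prod>j\<in>S - {i}. a j))"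
proof -
  have 0: "coeff (\<Prod>i\<in>S. [:a i, b i:]) 0 = (\<Prod>i\<in>S. a i)" if "finite S" for S
    using that by induction (simp_all add: coeff_mult)
  show "coeff (\<Prod>i\<in>S. [:a i, b i:]) 0 = (\<Prod>i\<in>S. a i)" by (rule 0[OF assms])
  show "coeff (\<Prod>i\<in>S. [:a i, b i:]) 1 = (\<Sum>i\<in>S. b i * (\<Prod>j\<in>S - {i}. a j))"
    using assms
  proof induction
    case (insert k S)
    have "(\<Sum>i\<in>S. b i * (\<Prod>j\<in>insert k S - {i}. a j)) = (\<Sum>i\<in>S. a k * (b i * (\<Prod>j\<in>S - {i}. a j)))"
    proof (intro sum.cong refl)
      fix i assume "i \<in> S"
      then have "insert k S - {i} = insert k (S - {i})" "k \<notin> S - {i}" using insert by auto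
      then show "b i * (\<Prod>j\<in>insert k S - {i}. a j) = a k * (b i * (\<Prod>j\<in>S - {i}. a j))"
        using insert by (simp add: mult_ac)
    qed
    moreover have "insert k S - {k} = S" using insert by auto
    ultimately show ?case using insert 0[OF insert(1)]
      by (simp add: sum_distrib_left add.commute)
  qed simp
qed

text \<open>A linear term takes the infinitesimal part of one factor only; the remaining factors,
  which must not vanish at the point, then determine the permutation.\<close>

lemma permutes_eq_if_eq_off_point:
  assumes "\<sigma> permutes S" "\<tau> permutes S" "\<And>j. j \<in> S - {i} \<Longrightarrow> \<sigma> j = \<tau> j"
  shows "\<sigma> = \<tau>"
proof
  fix k
  have "\<sigma> i = \<tau> i"
  proof (cases "i \<in> S")
    case True
    have "\<sigma> i \<in> S - \<sigma> ` (S - {i})"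
      using assms(1) True by (auto simp: permutes_in_image inj_eq[OF permutes_inj])
    also have "\<sigma> ` (S - {i}) = \<tau> ` (S - {i})" using assms(3) by auto
    also have "S - \<tau> ` (S - {i}) = {\<tau> i}"
      using assms(2) True permutes_image[OF assms(2)] by (auto simp: inj_eq[OF permutes_inj])
    finally show ?thesis by simp
  next
    case False
    then show ?thesis using assms(1,2) by (auto simp: permutes_def)
  qed
  then show "\<sigma> k = \<tau> k"
    using assms by (cases "k \<in> S"; cases "k = i") (auto simp: permutes_not_in)
qed

lemma sign_square: "sign \<sigma> * sign \<sigma> = (1::int)"
  by (auto simp: sign_def)

lemma bij_betw_sorted_list_of_set:
  "finite R \<Longrightarrow> bij_betw ((!) (sorted_list_of_set R)) {..<card R} R"
  by (intro bij_betw_nth) auto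

text \<open>Substitution of the point \<open>X = diag(1, \<dots>, 1, 0, \<dots>)\<close> with \<open>t + 1\<close> ones plus an infinitesimal.\<close>
definition perturb :: "nat \<Rightarrow> 'k::idom mpoly \<Rightarrow> 'k mpoly poly" where
  "perturb t = mpoly_eval (\<lambda>c. [:Const c:])
     (\<lambda>w. [:(if fst w = snd w \<and> fst w \<le> t + 1 then 1 else 0), X w:])"

lemma comm_ring_hom_perturb: "comm_ring_hom (perturb t)"
  unfolding perturb_def
  by (rule comm_ring_hom_mpoly_eval[OF comm_ring_hom_comp[OF comm_ring_hom_const_poly comm_ring_hom_Const]])

lemma perturb_Xvar: "perturb t (Xvar i j) = [:(if i = j \<and> i \<le> t + 1 then 1 else 0), Xvar i j:]"
  unfolding perturb_def
  by (simp add: mpoly_eval_Xvar[OF comm_ring_hom_comp[OF comm_ring_hom_const_poly comm_ring_hom_Const]])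

lemma coeff_of_int_mult: "coeff (of_int z * p) n = of_int z * coeff p n"
  by (simp add: of_int_poly)

lemma coeff_perturb_minor:
  fixes t :: nat and R C :: "nat set"
  defines "\<rho> \<equiv> (!) (sorted_list_of_set R)" and "\<kappa> \<equiv> (!) (sorted_list_of_set C)"
  defines "a \<equiv> \<lambda>\<sigma> i. if \<rho> i = \<kappa> (\<sigma> i) \<and> \<rho> i \<le> t + 1 then 1 else 0 :: 'k::idom mpoly"
  shows "coeff (perturb t (minor R C)) 0 =
      (\<Sum>\<sigma> | \<sigma> permutes {..<card R}. of_int (sign \<sigma>) * (\<Prod>i<card R. a \<sigma> i))"
    "coeff (perturb t (minor R C)) 1 =
      (\<Sum>\<sigma> | \<sigma> permutes {..<card R}. of_int (sign \<sigma>) *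
         (\<Sum>i<card R. Xvar (\<rho> i) (\<kappa> (\<sigma> i)) * (\<Prod>j\<in>{..<card R} - {i}. a \<sigma> j)))"
  unfolding minor_def
  by (simp_all only: comm_ring_homD[OF comm_ring_hom_perturb] perturb_Xvar coeff_sum coeff_of_int_mult
      coeff_prod_linear[OF finite_lessThan] a_def \<rho>_def \<kappa>_def)

text \<open>The submatrix at the point is the identity. A permutation other than the identity moves
  at least two indices, so its summand vanishes to order two; what remains begins with 1 plus the
  trace.\<close>

lemma perturb_principal_minor:
  assumes "R \<subseteq> {1..t + 1}"
  shows "coeff (perturb t (minor R R)) 0 = (1 :: 'k::idom mpoly)"
    "coeff (perturb t (minor R R)) 1 = (\<Sum>k\<in>R. Xvar k k :: 'k::idom mpoly)"
proof -
  have fin: "finite R" using assms finite_subset by blast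
  define k where "k = card R"
  define \<rho> where "\<rho> = (!) (sorted_list_of_set R)"
  have bij: "bij_betw \<rho> {..<k} R" unfolding \<rho>_def k_def by (rule bij_betw_sorted_list_of_set[OF fin])
  define a where "a \<sigma> i = (if \<rho> i = \<rho> (\<sigma> i) \<and> \<rho> i \<le> t + 1 then 1 else 0 :: 'k mpoly)" for \<sigma> i
  have \<rho>t: "\<rho> i \<le> t + 1" if "i < k" for i
    using bij_betw_apply[OF bij, of i] that assms by auto
  have a: "a \<sigma> i = (if \<sigma> i = i then 1 else 0)" if "\<sigma> permutes {..<k}" "i < k" for \<sigma> i
  proof -
    have "\<sigma> i < k" using that permutes_in_image[OF that(1), of i] by simp
    then have "\<rho> i = \<rho> (\<sigma> i) \<longleftrightarrow> \<sigma> i = i"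
      using that(2) bij_betw_imp_inj_on[OF bij] by (auto simp: inj_on_def)
    then show ?thesis using \<rho>t[OF that(2)] by (simp add: a_def)
  qed
  have fp: "finite {\<sigma>. \<sigma> permutes {..<k}}" by (rule finite_permutations) simp
  have id: "id \<in> {\<sigma>. \<sigma> permutes {..<k}}" by (simp add: permutes_id)
  have "coeff (perturb t (minor R R)) 0 =
      (\<Sum>\<sigma> | \<sigma> permutes {..<k}. of_int (sign \<sigma>) * (\<Prod>i<k. a \<sigma> i))"
    unfolding coeff_perturb_minor by (simp add: a_def \<rho>_def k_def)
  also have "\<dots> = (\<Sum>\<sigma> | \<sigma> permutes {..<k}. if \<sigma> = id then 1 else 0)"
  proof (intro sum.cong refl)
    fix \<sigma> assume "\<sigma> \<in> {\<sigma>. \<sigma> permutes {..<k}}"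
    then have s: "\<sigma> permutes {..<k}" by simp
    show "of_int (sign \<sigma>) * (\<Prod>i<k. a \<sigma> i) = (if \<sigma> = id then 1 else 0)"
    proof (cases "\<sigma> = id")
      case True
      then show ?thesis using a[OF s] by simp
    next
      case False
      then obtain i where "\<sigma> i \<noteq> i" by (metis eq_id_iff)
      then have "i < k" "a \<sigma> i = 0" using s a[OF s, of i] permutes_not_in[OF s, of i] by auto
      then have "(\<Prod>i<k. a \<sigma> i) = 0" by (intro prod_zero) auto
      then show ?thesis using False by simp
    qed
  qed
  also have "\<dots> = 1" using fp id by simp
  finally show "coeff (perturb t (minor R R)) 0 = (1 :: 'k mpoly)" .
  have "coeff (perturb t (minor R R)) 1 =
      (\<Sum>\<sigma> | \<sigma> permutes {..<k}. of_int (sign \<sigma>) * (\<Sum>i<k. Xvar (\<rho> i) (\<rho> (\<sigma> i)) * (\<Prod>j\<in>{..<k} - {i}. a \<sigma> j)))"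
    unfolding coeff_perturb_minor by (simp add: a_def \<rho>_def k_def)
  also have "\<dots> = (\<Sum>\<sigma> | \<sigma> permutes {..<k}. if \<sigma> = id then \<Sum>i<k. Xvar (\<rho> i) (\<rho> i) else 0)"
  proof (intro sum.cong refl)
    fix \<sigma> assume "\<sigma> \<in> {\<sigma>. \<sigma> permutes {..<k}}"
    then have s: "\<sigma> permutes {..<k}" by simp
    show "of_int (sign \<sigma>) * (\<Sum>i<k. Xvar (\<rho> i) (\<rho> (\<sigma> i)) * (\<Prod>j\<in>{..<k} - {i}. a \<sigma> j))
        = (if \<sigma> = id then \<Sum>i<k. Xvar (\<rho> i) (\<rho> i) else 0)"
    proof (cases "\<sigma> = id")
      case True
      then show ?thesis using a[OF s] by simp
    next
      case False
      have z: "(\<Prod>j\<in>{..<k} - {i}. a \<sigma> j) = 0" for i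
      proof -
        obtain j where "j \<in> {..<k} - {i}" "\<sigma> j \<noteq> id j"
          using permutes_eq_if_eq_off_point[OF s permutes_id, of i] False by metis
        then show ?thesis using a[OF s, of j] by (intro prod_zero) auto
      qed
      have "(\<Sum>i<k. Xvar (\<rho> i) (\<rho> (\<sigma> i)) * (\<Prod>j\<in>{..<k} - {i}. a \<sigma> j)) = 0"
        by (intro sum.neutral ballI) (simp only: z mult_zero_right)
      then show ?thesis using False by simp
    qed
  qed
  also have "\<dots> = (\<Sum>i<k. Xvar (\<rho> i) (\<rho> i))" using fp id by simp
  also have "\<dots> = (\<Sum>k\<in>R. Xvar k k)" by (rule sum.reindex_bij_betw[OF bij])
  finally show "coeff (perturb t (minor R R)) 1 = (\<Sum>k\<in>R. Xvar k k :: 'k mpoly)" .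
qed

text \<open>At the point, row \<open>r\<close> of the submatrix is zero, so its factor must supply
  the infinitesimal. All other rows then have to meet the column of the same index, which leaves
  column \<open>c\<close> for row \<open>r\<close>.\<close>

lemma perturb_bordered_minor:
  assumes D: "D \<subseteq> {1..t + 1}" "r \<notin> D" "c \<notin> D" and rc: "r \<noteq> c \<or> t + 1 < r"
  shows "coeff (perturb t (minor (insert r D) (insert c D))) 0 = (0 :: 'k::idom mpoly)"
    "\<exists>s::'k. s * s = 1 \<and>
       coeff (perturb t (minor (insert r D) (insert c D))) 1 = Const s * Xvar r c"
proof -
  let ?R = "insert r D" and ?C = "insert c D"
  have fin: "finite D" using D finite_subset by blast
  define k where "k = card ?R"
  have kC: "card ?C = k" using fin D by (simp add: k_def)
  define \<rho> where "\<rho> = (!) (sorted_list_of_set ?R)"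
  define \<kappa> where "\<kappa> = (!) (sorted_list_of_set ?C)"
  have b\<rho>: "bij_betw \<rho> {..<k} ?R"
    unfolding \<rho>_def k_def by (rule bij_betw_sorted_list_of_set) (use fin in simp)
  have b\<kappa>: "bij_betw \<kappa> {..<k} ?C"
    unfolding \<kappa>_def kC[symmetric] by (rule bij_betw_sorted_list_of_set) (use fin in simp)
  define a where "a \<sigma> i = (if \<rho> i = \<kappa> (\<sigma> i) \<and> \<rho> i \<le> t + 1 then 1 else 0 :: 'k mpoly)" for \<sigma> i
  obtain i0 where i0: "i0 < k" "\<rho> i0 = r"
    using b\<rho> unfolding bij_betw_def by (metis image_iff insertI1 lessThan_iff)
  have \<rho>D: "\<rho> i \<in> D" if "i < k" "i \<noteq> i0" for i
  proof -
    have "\<rho> i \<noteq> r" using that i0 bij_betw_imp_inj_on[OF b\<rho>] by (auto simp: inj_on_def)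
    then show ?thesis using bij_betw_apply[OF b\<rho>, of i] that by auto
  qed
  have a0: "a \<sigma> i0 = 0" if "\<sigma> permutes {..<k}" for \<sigma>
  proof -
    have "\<kappa> (\<sigma> i0) \<in> ?C" using bij_betw_apply[OF b\<kappa>] permutes_in_image[OF that, of i0] i0 by auto
    then show ?thesis using i0 D(2) rc by (auto simp: a_def)
  qed
  \<comment> \<open>The surviving permutation \<open>\<sigma>0\<close> is \<open>\<beta>\<close>
    (indices of \<open>D\<close> stay, \<open>r\<close> goes to \<open>c\<close>) transported to
    positions in the sorted lists; this transport is the source of the sign.\<close>
  define \<beta> where "\<beta> x = (if x = r then c else x)" for x
  have b\<beta>: "bij_betw \<beta> ?R ?C" using D by (auto simp: bij_betw_def inj_on_def \<beta>_def)
  define \<sigma>0 where "\<sigma>0 i = (if i < k then inv_into {..<k} \<kappa> (\<beta> (\<rho> i)) else i)" for i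
  have "bij_betw (inv_into {..<k} \<kappa> \<circ> (\<beta> \<circ> \<rho>)) {..<k} {..<k}"
    by (intro bij_betw_trans[OF bij_betw_trans[OF b\<rho> b\<beta>] bij_betw_inv_into[OF b\<kappa>]])
  then have "bij_betw \<sigma>0 {..<k} {..<k}"
    by (rule bij_betw_cong[THEN iffD1, rotated]) (simp add: \<sigma>0_def)
  then have s0: "\<sigma>0 permutes {..<k}" by (rule bij_imp_permutes) (simp add: \<sigma>0_def)
  have \<kappa>\<sigma>0: "\<kappa> (\<sigma>0 i) = \<beta> (\<rho> i)" if "i < k" for i
    using that bij_betw_apply[OF b\<beta>, of "\<rho> i"] bij_betw_apply[OF b\<rho>, of i]
    by (simp add: \<sigma>0_def bij_betw_inv_into_right[OF b\<kappa>])
  have fp: "finite {\<sigma>. \<sigma> permutes {..<k}}" by (rule finite_permutations) simp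
  have c0: "coeff (perturb t (minor ?R ?C)) 0 =
      (\<Sum>\<sigma> | \<sigma> permutes {..<k}. of_int (sign \<sigma>) * (\<Prod>i<k. a \<sigma> i))"
    unfolding coeff_perturb_minor by (simp add: a_def \<rho>_def \<kappa>_def k_def)
  also have "\<dots> = 0"
  proof (intro sum.neutral ballI)
    fix \<sigma> assume "\<sigma> \<in> {\<sigma>. \<sigma> permutes {..<k}}"
    then have "(\<Prod>i<k. a \<sigma> i) = 0" using a0 i0 by (intro prod_zero) auto
    then show "of_int (sign \<sigma>) * (\<Prod>i<k. a \<sigma> i) = 0" by simp
  qed
  finally show "coeff (perturb t (minor ?R ?C)) 0 = (0 :: 'k mpoly)" .
  have "coeff (perturb t (minor ?R ?C)) 1 =
      (\<Sum>\<sigma> | \<sigma> permutes {..<k}. of_int (sign \<sigma>) * (\<Sum>i<k. Xvar (\<rho> i) (\<kappa> (\<sigma> i)) * (\<Prod>j\<in>{..<k} - {i}. a \<sigma> j)))"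
    unfolding coeff_perturb_minor by (simp add: a_def \<rho>_def \<kappa>_def k_def)
  also have "\<dots> = (\<Sum>\<sigma> | \<sigma> permutes {..<k}. if \<sigma> = \<sigma>0 then of_int (sign \<sigma>0) * Xvar r c else 0)"
  proof (intro sum.cong refl)
    fix \<sigma> assume "\<sigma> \<in> {\<sigma>. \<sigma> permutes {..<k}}"
    then have s: "\<sigma> permutes {..<k}" by simp
    have z: "(\<Prod>j\<in>{..<k} - {i}. a \<sigma> j) = 0" if "i \<noteq> i0" for i
      using a0[OF s] i0 that by (intro prod_zero) auto
    have e: "(\<Sum>i<k. Xvar (\<rho> i) (\<kappa> (\<sigma> i)) * (\<Prod>j\<in>{..<k} - {i}. a \<sigma> j))
       = Xvar r (\<kappa> (\<sigma> i0)) * (\<Prod>j\<in>{..<k} - {i0}. a \<sigma> j)"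
    proof -
      have "(\<Sum>i\<in>{..<k} - {i0}. Xvar (\<rho> i) (\<kappa> (\<sigma> i)) * (\<Prod>j\<in>{..<k} - {i}. a \<sigma> j)) = 0"
      proof (intro sum.neutral ballI)
        fix i assume "i \<in> {..<k} - {i0}"
        then have "i \<noteq> i0" by auto
        then show "Xvar (\<rho> i) (\<kappa> (\<sigma> i)) * (\<Prod>j\<in>{..<k} - {i}. a \<sigma> j) = 0"
          using z[of i] by (metis mult_zero_right)
      qed
      then show ?thesis by (subst sum.remove[of _ i0]) (simp_all add: i0)
    qed
    show "of_int (sign \<sigma>) * (\<Sum>i<k. Xvar (\<rho> i) (\<kappa> (\<sigma> i)) * (\<Prod>j\<in>{..<k} - {i}. a \<sigma> j))
       = (if \<sigma> = \<sigma>0 then of_int (sign \<sigma>0) * Xvar r c else 0)"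
    proof (cases "\<sigma> = \<sigma>0")
      case True
      have "a \<sigma> j = 1" if "j \<in> {..<k} - {i0}" for j
        using that \<rho>D[of j] \<kappa>\<sigma>0[of j] D by (auto simp: a_def \<beta>_def True)
      then have "(\<Prod>j\<in>{..<k} - {i0}. a \<sigma> j) = 1" by (intro prod.neutral) auto
      then show ?thesis unfolding e using True i0 \<kappa>\<sigma>0[of i0] by (simp add: \<beta>_def)
    next
      case False
      then obtain j where j: "j \<in> {..<k} - {i0}" "\<sigma> j \<noteq> \<sigma>0 j"
        using permutes_eq_if_eq_off_point[OF s s0, of i0] by metis
      have "\<sigma> j < k" "\<sigma>0 j < k" using permutes_in_image[OF s, of j] permutes_in_image[OF s0, of j] j by auto
      then have "\<kappa> (\<sigma> j) \<noteq> \<kappa> (\<sigma>0 j)" using j bij_betw_imp_inj_on[OF b\<kappa>] by (auto simp: inj_on_def)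
      moreover have "\<kappa> (\<sigma>0 j) = \<rho> j" using \<kappa>\<sigma>0[of j] \<rho>D[of j] j D by (auto simp: \<beta>_def)
      ultimately have "a \<sigma> j = 0" by (auto simp: a_def)
      then have "(\<Prod>j\<in>{..<k} - {i0}. a \<sigma> j) = 0" using j by (intro prod_zero) auto
      then show ?thesis unfolding e using False by simp
    qed
  qed
  also have "\<dots> = of_int (sign \<sigma>0) * Xvar r c" using fp s0 by simp
  also have "(of_int (sign \<sigma>0) :: 'k mpoly) = Const (of_int (sign \<sigma>0))"
    by (simp add: comm_ring_homD[OF comm_ring_hom_Const])
  finally show "\<exists>s::'k. s * s = 1 \<and> coeff (perturb t (minor ?R ?C)) 1 = Const s * Xvar r c"
    by (intro exI[of _ "of_int (sign \<sigma>0)"] conjI) (simp_all flip: of_int_mult add: sign_square)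
qed

text \<open>The indices shared by rows and columns of the minor whose linear term is to be the entry
  (r, c). The branches realize conditions (i), (iii), (iv), (ii) in this order. There are t - 1
  shared indices, except for r = c \<le> t + 1, where the principal minor omitting r replaces a
  bordered one.\<close>

definition core_set :: "nat \<Rightarrow> nat \<Rightarrow> nat \<Rightarrow> nat set" where
  "core_set t r c = (if r \<le> t + 1 \<and> c \<le> t + 1 then {1..t + 1} - {r, c}
     else if r \<le> t then {1..t} - {r} else if c \<le> t then {1..t} - {c} else {1..t - 1})"

definition row_set :: "nat \<Rightarrow> nat \<Rightarrow> nat \<Rightarrow> nat set" where
  "row_set t r c = (if r = c \<and> r \<le> t + 1 then {1..t + 1} - {r} else insert r (core_set t r c))"

definition col_set :: "nat \<Rightarrow> nat \<Rightarrow> nat \<Rightarrow> nat set" where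
  "col_set t r c = (if r = c \<and> r \<le> t + 1 then {1..t + 1} - {r} else insert c (core_set t r c))"

lemma core_set:
  assumes "0 < t" "1 \<le> r" "1 \<le> c"
  shows "core_set t r c \<subseteq> {1..t + 1}" "r \<notin> core_set t r c" "c \<notin> core_set t r c"
    "r = c \<and> r \<le> t + 1 \<or> card (core_set t r c) = t - 1"
proof -
  have "card {r, c} = 2" if "r \<noteq> c" using that by simp
  then show "core_set t r c \<subseteq> {1..t + 1}" "r \<notin> core_set t r c" "c \<notin> core_set t r c"
    "r = c \<and> r \<le> t + 1 \<or> card (core_set t r c) = t - 1"
    using assms by (cases "r = c"; auto simp: core_set_def card_Diff_subset)+
qed

text \<open>Indexes \<open>\<Phi>0\<close> by the positions of the matrix: the linear term of a minor at the point
  of \<open>perturb\<close> is, up to sign, the entry at its position, except for the principal minors of the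
  leading block of size \<open>t + 1\<close>. Outside the matrix the variables themselves are taken,
  so that the family is indexed by all variables.\<close>
definition minor_at :: "nat \<Rightarrow> nat \<Rightarrow> nat \<Rightarrow> nat \<times> nat \<Rightarrow> 'k::comm_ring_1 mpoly" where
  "minor_at m n t v = (if v \<in> {1..m} \<times> {1..n} then minor (row_set t (fst v) (snd v)) (col_set t (fst v) (snd v))
     else X v)"

lemma minor_at_injective:
  fixes p :: "'k::field_char_0 mpoly"
  assumes t: "0 < t" "t < m" "m \<le> n" and p: "mpoly_eval Const (minor_at m n t) p = 0"
  shows "p = 0"
proof -
  let ?I = "{1..m} \<times> {1..n}"
  define diag :: "nat \<times> nat \<Rightarrow> bool" where "diag v \<longleftrightarrow> fst v = snd v \<and> 1 \<le> fst v \<and> fst v \<le> t + 1" for v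
  have diag_I: "v \<in> ?I" if "diag v" for v using that t by (cases v) (auto simp: diag_def)
  have off: "row_set t (fst v) (snd v) = insert (fst v) (core_set t (fst v) (snd v))"
    "col_set t (fst v) (snd v) = insert (snd v) (core_set t (fst v) (snd v))"
    "core_set t (fst v) (snd v) \<subseteq> {1..t + 1}" "fst v \<notin> core_set t (fst v) (snd v)"
    "snd v \<notin> core_set t (fst v) (snd v)" "fst v \<noteq> snd v \<or> t + 1 < fst v"
    if "\<not> diag v" "v \<in> ?I" for v
  proof -
    have 1: "1 \<le> fst v" "1 \<le> snd v" using that(2) by auto
    show "core_set t (fst v) (snd v) \<subseteq> {1..t + 1}" "fst v \<notin> core_set t (fst v) (snd v)"
      "snd v \<notin> core_set t (fst v) (snd v)" by (rule core_set[OF t(1) 1])+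
    show "row_set t (fst v) (snd v) = insert (fst v) (core_set t (fst v) (snd v))"
      "col_set t (fst v) (snd v) = insert (snd v) (core_set t (fst v) (snd v))"
      "fst v \<noteq> snd v \<or> t + 1 < fst v"
      using that(1) 1 by (auto simp: diag_def row_set_def col_set_def)
  qed
  have "\<exists>s::'k. s * s = 1 \<and> (v \<in> ?I \<and> \<not> diag v \<longrightarrow> coeff (perturb t (minor_at m n t v)) 1 = Const s * X v)" for v
    using perturb_bordered_minor(2)[OF off(3-6), of v] by (cases "v \<in> ?I \<and> \<not> diag v") (auto simp: minor_at_def off intro: exI[of _ 1])
  then obtain s :: "nat \<times> nat \<Rightarrow> 'k" where s: "\<And>v. s v * s v = 1"
    "\<And>v. v \<in> ?I \<Longrightarrow> \<not> diag v \<Longrightarrow> coeff (perturb t (minor_at m n t v)) 1 = Const (s v) * X v" by metis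
  define l :: "nat \<times> nat \<Rightarrow> 'k mpoly" where
    "l v = (if diag v then \<Sum>k\<in>{1..t + 1} - {fst v}. Xvar k k else if v \<in> ?I then Const (s v) * X v else X v)" for v
  \<comment> \<open>\<open>perturb\<close> also puts a one at (0, 0), outside the matrix; the second
    disjunct singles out just this position.\<close>
  define c :: "nat \<times> nat \<Rightarrow> 'k" where "c v = (if diag v \<or> (v \<notin> ?I \<and> fst v = snd v \<and> fst v \<le> t + 1) then 1 else 0)" for v
  \<comment> \<open>On the first t + 1 diagonal variables the linear terms form J - I, with J the
    all-ones matrix, and the inverse is J / t - I; the division by t uses characteristic 0.
    Elsewhere the signs are their own inverses.\<close>
  define y :: "nat \<times> nat \<Rightarrow> 'k mpoly" where
    "y v = (if diag v then Const (1 / of_nat t) * (\<Sum>k\<in>{1..t + 1}. Xvar k k) - X v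
       else if v \<in> ?I then Const (s v) * X v else X v)" for v
  note hC = comm_ring_homD[OF comm_ring_hom_Const]
  note hy = comm_ring_homD[OF comm_ring_hom_mpoly_eval[OF comm_ring_hom_Const, of y]]
  note ev = mpoly_eval_Const[OF comm_ring_hom_Const] mpoly_eval_Xvar[OF comm_ring_hom_Const]
  show ?thesis
  proof (rule mpoly_eval_injective[OF _ _ p])
    fix v
    show "\<exists>U. mpoly_eval (\<lambda>c. [:Const c:]) (\<lambda>w. [:(if fst w = snd w \<and> fst w \<le> t + 1 then 1 else 0), X w:])
        (minor_at m n t v) = pCons (Const (c v)) (pCons (l v) U)"
    proof -
      let ?P = "perturb t (minor_at m n t v) :: 'k mpoly poly"
      have co: "coeff ?P 0 = Const (c v) \<and> coeff ?P 1 = l v"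
      proof (cases "diag v")
        case True
        have 1: "row_set t (fst v) (snd v) = {1..t + 1} - {fst v}" "col_set t (fst v) (snd v) = {1..t + 1} - {fst v}"
          using True by (auto simp: diag_def row_set_def col_set_def)
        have 2: "{1..t + 1} - {fst v} \<subseteq> {1..t + 1}" by auto
        show ?thesis
          using True diag_I[OF True] perturb_principal_minor[OF 2]
          by (simp add: minor_at_def 1 c_def l_def hC)
      next
        case False
        show ?thesis
        proof (cases "v \<in> ?I")
          case True
          show ?thesis
            using s(2)[OF True False] perturb_bordered_minor(1)[OF off(3-6)[OF False True]] True False
            by (auto simp: minor_at_def off(1,2)[OF False True] c_def l_def hC)
        next
          case False
          then show ?thesis using \<open>\<not> diag v\<close>
            by (simp add: minor_at_def perturb_Xvar c_def l_def hC del: mem_Sigma_iff)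
        qed
      qed
      have "?P = pCons (coeff ?P 0) (pCons (coeff ?P 1) (poly_shift 2 ?P))"
        by (simp add: poly_eq_iff coeff_pCons coeff_poly_shift numeral_2_eq_2 split: nat.split)
      then have "?P = pCons (Const (c v)) (pCons (l v) (poly_shift 2 ?P))"
        unfolding conjunct1[OF co] conjunct2[OF co] .
      then show ?thesis unfolding perturb_def by (rule exI)
    qed
    show "mpoly_eval Const y (l v) = X v"
    proof (cases "diag v")
      case True
      define S where "S = (\<Sum>k\<in>{1..t + 1}. Xvar k k :: 'k mpoly)"
      have v: "v = (fst v, fst v)" "1 \<le> fst v" "fst v \<le> t + 1" using True by (auto simp: diag_def prod_eq_iff)
      have "mpoly_eval Const y (l v) = (\<Sum>k\<in>{1..t + 1} - {fst v}. Const (1 / of_nat t) * S - Xvar k k)"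
        using True by (simp add: l_def hy ev) (intro sum.cong, auto simp: y_def diag_def S_def)
      also have "\<dots> = of_nat t * (Const (1 / of_nat t) * S) - (\<Sum>k\<in>{1..t + 1} - {fst v}. Xvar k k)"
        using v(2,3) by (simp add: sum_subtractf)
      also have "(\<Sum>k\<in>{1..t + 1} - {fst v}. Xvar k k) = S - Xvar (fst v) (fst v)"
        unfolding S_def using v(2,3) by (subst sum.remove[of _ "fst v"]) auto
      also have "of_nat t * (Const (1 / of_nat t) * S) = S"
      proof -
        have e: "(of_nat t :: 'k mpoly) = Const (of_nat t)"
          using hC(10)[of "int t", symmetric] by simp
        have "(of_nat t :: 'k mpoly) * Const (1 / of_nat t) = Const (of_nat t * (1 / of_nat t))"
          by (simp only: e hC(4))
        also have "\<dots> = 1" using t(1) hC(2) by simp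
        finally show ?thesis by (simp add: mult.assoc[symmetric])
      qed
      finally show ?thesis using v(1) by (simp add: True[unfolded diag_def])
    next
      case False
      have "Const (s v) * (Const (s v) * X v) = X v"
        using s(1)[of v] by (simp add: mult.assoc[symmetric] hC(2) flip: hC(4))
      then show ?thesis using False by (auto simp: l_def hy ev y_def)
    qed
  qed
qed

section \<open>The index pairs of \<open>\<Phi>\<^sub>0\<close>\<close>

text \<open>Order statistics become counts here, and through counts the conditions of
  \<open>Phi0_cond\<close> turn into inclusions.\<close>

lemma nth_le_iff_card:
  fixes xs :: "nat list"
  assumes "sorted xs" "distinct xs" "i < length xs"
  shows "xs ! i \<le> s \<longleftrightarrow> i < card {x \<in> set xs. x \<le> s}"
proof
  have c: "card ((!) xs ` A) = card A" if "A \<subseteq> {..<length xs}" for A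
    by (rule card_image, rule inj_onI) (use that assms(2) nth_eq_iff_index_eq in blast)
  show "i < card {x \<in> set xs. x \<le> s}" if "xs ! i \<le> s"
  proof -
    have "(!) xs ` {..i} \<subseteq> {x \<in> set xs. x \<le> s}"
      using that assms(1,3) by (auto intro: order_trans[OF sorted_nth_mono])
    then have "card ((!) xs ` {..i}) \<le> card {x \<in> set xs. x \<le> s}" by (intro card_mono) auto
    moreover have "{..i} \<subseteq> {..<length xs}" using assms(3) by auto
    ultimately show ?thesis using c[of "{..i}"] by simp
  qed
  show "xs ! i \<le> s" if "i < card {x \<in> set xs. x \<le> s}"
  proof (rule ccontr)
    assume n: "\<not> xs ! i \<le> s"
    have "{x \<in> set xs. x \<le> s} \<subseteq> (!) xs ` {..<i}"
    proof
      fix x assume "x \<in> {x \<in> set xs. x \<le> s}"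
      then obtain j where j: "j < length xs" "x = xs ! j" "x \<le> s" by (auto simp: in_set_conv_nth)
      then have "j < i" using n sorted_nth_mono[OF assms(1), of i j] by (meson leI order_trans)
      then show "x \<in> (!) xs ` {..<i}" using j by auto
    qed
    from card_mono[OF _ this] c[of "{..<i}"] assms(3) that show False by auto
  qed
qed

lemma sel_le_iff:
  assumes "finite R" "k \<le> card R"
  shows "sel R k \<le> s \<longleftrightarrow> k \<le> card (R \<inter> {..s})"
proof (cases "k = 0")
  case False
  have "{x \<in> R. x \<le> s} = R \<inter> {..s}" by auto
  then show ?thesis
    using False assms nth_le_iff_card[of "sorted_list_of_set R" "k - 1" s] by (auto simp: sel_def)
qed (simp add: sel_def)

lemma sel_eq_iff:
  assumes "finite R" "R \<subseteq> {1..}" "k \<le> card R"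
  shows "sel R k = k \<longleftrightarrow> {1..k} \<subseteq> R"
proof -
  have sub: "R \<inter> {..s} \<subseteq> {1..s}" for s using assms(2) by auto
  have le: "sel R k \<le> k \<longleftrightarrow> {1..k} \<subseteq> R"
  proof
    assume "sel R k \<le> k"
    then have "card {1..k} \<le> card (R \<inter> {..k})" using sel_le_iff[OF assms(1,3)] by simp
    from card_seteq[OF _ sub this] show "{1..k} \<subseteq> R" by auto
  next
    assume "{1..k} \<subseteq> R"
    then have "{1..k} \<subseteq> R \<inter> {..k}" by auto
    from card_mono[OF _ this] assms(1) show "sel R k \<le> k"
      using sel_le_iff[OF assms(1,3)] by simp
  qed
  have "\<not> sel R k < k"
  proof
    assume a: "sel R k < k"
    then have "sel R k \<le> k - 1" by simp
    then have "k \<le> card (R \<inter> {..k - 1})" using sel_le_iff[OF assms(1,3)] by simp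
    also have "\<dots> \<le> card {1..k - 1}" by (rule card_mono[OF _ sub]) simp
    finally show False using a by simp
  qed
  then show ?thesis using le by linarith
qed

lemma sel_card_le_iff:
  assumes "finite R" "R \<subseteq> {1..}"
  shows "sel R (card R) \<le> s \<longleftrightarrow> R \<subseteq> {1..s}"
proof -
  have "sel R (card R) \<le> s \<longleftrightarrow> card R \<le> card (R \<inter> {..s})" using sel_le_iff[OF assms(1)] by simp
  also have "\<dots> \<longleftrightarrow> R \<inter> {..s} = R"
  proof
    assume "card R \<le> card (R \<inter> {..s})"
    from card_seteq[OF assms(1) _ this] show "R \<inter> {..s} = R" by simp
  qed simp
  also have "\<dots> \<longleftrightarrow> R \<subseteq> {..s}" by (rule inf.absorb_iff1[symmetric])
  also have "\<dots> \<longleftrightarrow> R \<subseteq> {1..s}" using assms(2) by auto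
  finally show ?thesis .
qed

text \<open>An index set whose k-th element is k contains \<open>{1..k}\<close>, and equals it when
  k is its size; bounds on the last element are inclusions.\<close>

lemma Phi0_cond_iff:
  assumes t: "0 < t" and R: "R \<subseteq> {1..}" "finite R" "card R = t" and C: "C \<subseteq> {1..}" "finite C" "card C = t"
  shows "Phi0_cond t R C \<longleftrightarrow>
     R \<subseteq> {1..t + 1} \<and> C \<subseteq> {1..t + 1} \<or> {1..t - 1} \<subseteq> R \<and> {1..t - 1} \<subseteq> C \<or>
     R = {1..t} \<and> t - 1 \<le> card (C \<inter> {..t}) \<or> t - 1 \<le> card (R \<inter> {..t}) \<and> C = {1..t}"
proof -
  have full: "{1..t} \<subseteq> S \<longleftrightarrow> S = {1..t}" if "finite S" "card S = t" for S :: "nat set"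
    using card_seteq[of S "{1..t}"] that by auto
  have "sel S t = t \<longleftrightarrow> S = {1..t}" "sel S (t - 1) = t - 1 \<longleftrightarrow> {1..t - 1} \<subseteq> S"
    "sel S t \<le> t + 1 \<longleftrightarrow> S \<subseteq> {1..t + 1}" "sel S (t - 1) \<le> t \<longleftrightarrow> t - 1 \<le> card (S \<inter> {..t})"
    if "S \<subseteq> {1..}" "finite S" "card S = t" for S
    using sel_eq_iff[OF that(2,1), of t] sel_eq_iff[OF that(2,1), of "t - 1"] full[OF that(2,3)]
      sel_card_le_iff[OF that(2,1), of "t + 1"] sel_le_iff[OF that(2), of "t - 1" t] that(3) by auto
  from this[OF R] this[OF C] show ?thesis unfolding Phi0_cond_def by simp
qed

lemma insert_decompose:
  assumes "finite S" "card S = t" "T \<subseteq> S" "card T = t - 1" "0 < t"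
  obtains x where "x \<notin> T" "S = insert x T"
proof -
  have "card (S - T) = 1" using assms card_Diff_subset[of T S] finite_subset by auto
  then obtain x where "S - T = {x}" by (auto simp: card_1_singleton_iff)
  then have "x \<notin> T" "S = insert x T" using assms(3) by auto
  then show ?thesis by (rule that)
qed

lemma remove_decompose:
  assumes "S \<subseteq> {1..t + 1}" "card S = t"
  obtains x where "x \<in> {1..t + 1}" "S = {1..t + 1} - {x}"
proof -
  have "card ({1..t + 1} - S) = 1" using assms card_Diff_subset[of S "{1..t + 1}"] finite_subset by auto
  then obtain x where x: "{1..t + 1} - S = {x}" by (auto simp: card_1_singleton_iff)
  then have "x \<in> {1..t + 1}" "S = {1..t + 1} - {x}" using assms(1) by auto
  then show ?thesis by (rule that)
qed

lemma row_col_set_small: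
  assumes "1 \<le> r" "1 \<le> c" "r \<le> t + 1" "c \<le> t + 1"
  shows "row_set t r c = {1..t + 1} - {c}" "col_set t r c = {1..t + 1} - {r}"
  using assms by (cases "r = c"; auto simp: row_set_def col_set_def core_set_def)+

lemma row_col_set_right:
  assumes "1 \<le> r" "r \<le> t" "t + 1 < c"
  shows "row_set t r c = {1..t}" "col_set t r c = insert c ({1..t} - {r})"
  using assms by (auto simp: row_set_def col_set_def core_set_def)

lemma row_col_set_below:
  assumes "1 \<le> c" "c \<le> t" "t + 1 < r"
  shows "row_set t r c = insert r ({1..t} - {c})" "col_set t r c = {1..t}"
  using assms by (auto simp: row_set_def col_set_def core_set_def)

lemma row_col_set_far:
  assumes "t < r" "t < c" "t + 1 < r \<or> t + 1 < c"
  shows "row_set t r c = insert r {1..t - 1}" "col_set t r c = insert c {1..t - 1}"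
  using assms by (auto simp: row_set_def col_set_def core_set_def)

text \<open>Each set omits one index of \<open>{1..t + 1}\<close>. The position is crossed: the rows
  omit \<open>c\<close> and the columns omit \<open>r\<close>.\<close>

lemma index_exists_small:
  assumes "R \<subseteq> {1..t + 1}" "card R = t" "C \<subseteq> {1..t + 1}" "card C = t"
  shows "\<exists>r c. 1 \<le> r \<and> 1 \<le> c \<and> r \<le> t + 1 \<and> c \<le> t + 1 \<and> R = row_set t r c \<and> C = col_set t r c"
proof -
  obtain c where c: "c \<in> {1..t + 1}" "R = {1..t + 1} - {c}" using remove_decompose[OF assms(1,2)] .
  obtain r where r: "r \<in> {1..t + 1}" "C = {1..t + 1} - {r}" using remove_decompose[OF assms(3,4)] .
  have rc: "1 \<le> r" "1 \<le> c" "r \<le> t + 1" "c \<le> t + 1" using r(1) c(1) by auto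
  then have "R = row_set t r c" "C = col_set t r c"
    unfolding r(2) c(2) using row_col_set_small[OF rc] by auto
  with rc show ?thesis by blast
qed

text \<open>If \<open>C\<close> does not fit into \<open>{1..t + 1}\<close>, exactly one element
  \<open>c\<close> lies beyond, in place of some \<open>x\<close> of \<open>{1..t}\<close>; the
  position is (x, c), and (c, x) for the transpose.\<close>

lemma index_exists_bordered:
  assumes t: "0 < t" and C: "C \<subseteq> {1..n}" "finite C" "card C = t" and h: "t - 1 \<le> card (C \<inter> {..t})"
    and n: "t + 1 \<le> n"
  shows "\<exists>r c. 1 \<le> r \<and> 1 \<le> c \<and> r \<le> t + 1 \<and> c \<le> n \<and> {1..t} = row_set t r c \<and> C = col_set t r c"
    "\<exists>r c. 1 \<le> r \<and> 1 \<le> c \<and> r \<le> n \<and> c \<le> t + 1 \<and> C = row_set t r c \<and> {1..t} = col_set t r c"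
proof -
  have "(\<exists>r c. 1 \<le> r \<and> 1 \<le> c \<and> r \<le> t + 1 \<and> c \<le> n \<and> {1..t} = row_set t r c \<and> C = col_set t r c) \<and>
    (\<exists>r c. 1 \<le> r \<and> 1 \<le> c \<and> r \<le> n \<and> c \<le> t + 1 \<and> C = row_set t r c \<and> {1..t} = col_set t r c)"
  proof (cases "C \<subseteq> {1..t + 1}")
    case True
    have "{1..t} \<subseteq> {1..t + 1}" "card {1..t} = t" by auto
    from index_exists_small[OF this True C(3)] index_exists_small[OF True C(3) this] 
    obtain r c r' c' where "1 \<le> r" "1 \<le> c" "r \<le> t + 1" "c \<le> t + 1" "{1..t} = row_set t r c" "C = col_set t r c"
      "1 \<le> r'" "1 \<le> c'" "r' \<le> t + 1" "c' \<le> t + 1" "C = row_set t r' c'" "{1..t} = col_set t r' c'" by blast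
    moreover from this n have "c \<le> n" "r' \<le> n" by linarith+
    ultimately show ?thesis by blast
  next
    case False
    then obtain c where c: "c \<in> C" "c > t + 1" using C(1) by force
    have sub: "C \<inter> {..t} \<subseteq> C - {c}" using c by auto
    have "card (C - {c}) = t - 1" using C c by simp
    then have "C \<inter> {..t} = C - {c}" using card_seteq[OF _ sub] h C(2) by simp
    moreover have "C \<inter> {..t} \<subseteq> {1..t}" using C(1) by auto
    ultimately have Cc: "C - {c} \<subseteq> {1..t}" by simp
    have "card (C - {c}) = t - 1" using C c by simp
    from insert_decompose[OF _ _ Cc this t] obtain x where x: "x \<notin> C - {c}" "{1..t} = insert x (C - {c})"
      by auto
    have x1: "1 \<le> x" "x \<le> t" using x by auto
    have "C - {c} = {1..t} - {x}" using x by auto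
    then have Ce: "C = insert c ({1..t} - {x})" using c by auto
    have cn: "c \<le> n" using c C(1) by auto
    have "\<exists>r c. 1 \<le> r \<and> 1 \<le> c \<and> r \<le> t + 1 \<and> c \<le> n \<and> {1..t} = row_set t r c \<and> C = col_set t r c"
      using row_col_set_right[OF x1 c(2)] x1 c(2) cn Ce by (intro exI[of _ x] exI[of _ c]) simp
    moreover have "\<exists>r c. 1 \<le> r \<and> 1 \<le> c \<and> r \<le> n \<and> c \<le> t + 1 \<and> C = row_set t r c \<and> {1..t} = col_set t r c"
      using row_col_set_below[OF x1 c(2)] x1 c(2) cn Ce by (intro exI[of _ c] exI[of _ x]) simp
    ultimately show ?thesis ..
  qed
  then show "\<exists>r c. 1 \<le> r \<and> 1 \<le> c \<and> r \<le> t + 1 \<and> c \<le> n \<and> {1..t} = row_set t r c \<and> C = col_set t r c"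
    "\<exists>r c. 1 \<le> r \<and> 1 \<le> c \<and> r \<le> n \<and> c \<le> t + 1 \<and> C = row_set t r c \<and> {1..t} = col_set t r c" by auto
qed

text \<open>The four conditions overlap. Pairs inside \<open>{1..t + 1}\<close> are always treated
  as the first case, as in \<open>core_set\<close>.\<close>

lemma index_exists:
  assumes t: "0 < t" "t < m" "m \<le> n" and R: "is_index_set t m R" and C: "is_index_set t n C"
    and cond: "Phi0_cond t R C"
  shows "\<exists>r\<in>{1..m}. \<exists>c\<in>{1..n}. R = row_set t r c \<and> C = col_set t r c"
proof -
  have R': "R \<subseteq> {1..m}" "R \<subseteq> {1..}" "finite R" "card R = t" and C': "C \<subseteq> {1..n}" "C \<subseteq> {1..}" "finite C" "card C = t"
    using R C finite_subset unfolding is_index_set_def by fastforce+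
  have small: ?thesis if "R \<subseteq> {1..t + 1}" "C \<subseteq> {1..t + 1}"
    using index_exists_small[OF that(1) R'(4) that(2) C'(4)] t by fastforce
  from cond[unfolded Phi0_cond_iff[OF t(1) R'(2-4) C'(2-4)]] show ?thesis
  proof (elim disjE conjE)
    assume "{1..t - 1} \<subseteq> R" "{1..t - 1} \<subseteq> C"
    then obtain r c where rc: "r \<notin> {1..t - 1}" "R = insert r {1..t - 1}" "c \<notin> {1..t - 1}" "C = insert c {1..t - 1}"
      using insert_decompose[OF R'(3,4) _ _ t(1), of "{1..t - 1}"] insert_decompose[OF C'(3,4) _ _ t(1), of "{1..t - 1}"]
      by (metis card_atLeastAtMost diff_Suc_1)
    have b: "t \<le> r" "r \<le> m" "t \<le> c" "c \<le> n" using rc R'(1) C'(1) by auto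
    show ?thesis
    proof (cases "r \<le> t + 1 \<and> c \<le> t + 1")
      case True
      have "R \<subseteq> {1..t + 1}" "C \<subseteq> {1..t + 1}" unfolding rc(2,4) using True b t(1) by auto
      then show ?thesis by (rule small)
    next
      case False
      have e: "{1..t} - {t} = {1..t - 1}" "insert t {1..t - 1} = {1..t}" using t(1) by auto
      have "R = row_set t r c \<and> C = col_set t r c"
      proof -
        consider "r = t" "t + 1 < c" | "c = t" "t + 1 < r" | "t < r" "t < c" "t + 1 < r \<or> t + 1 < c"
          using b False by linarith
        then show ?thesis
        proof cases
          case 1
          then show ?thesis using row_col_set_right[of t t c] t(1) rc e by simp
        next
          case 2
          then show ?thesis using row_col_set_below[of t t r] t(1) rc e by simp
        next
          case 3
          then show ?thesis using row_col_set_far[OF 3] rc by simp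
        qed
      qed
      then show ?thesis using b t(1) by (intro bexI[of _ r] bexI[of _ c]) auto
    qed
  next
    assume a: "R = {1..t}" "t - 1 \<le> card (C \<inter> {..t})"
    from index_exists_bordered(1)[OF t(1) C'(1,3,4) a(2)] t a(1) show ?thesis by fastforce
  next
    assume a: "C = {1..t}" "t - 1 \<le> card (R \<inter> {..t})"
    from index_exists_bordered(2)[OF t(1) R'(1,3,4) a(2)] t a(1) show ?thesis by fastforce
  qed (rule small)
qed

lemma index_sets:
  assumes t: "0 < t" "t < m" "m \<le> n" and r: "r \<in> {1..m}" and c: "c \<in> {1..n}"
  shows "is_index_set t m (row_set t r c)" "is_index_set t n (col_set t r c)"
    "Phi0_cond t (row_set t r c) (col_set t r c)"
proof -
  have rc: "1 \<le> r" "1 \<le> c" using r c by auto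
  note core = core_set[OF t(1) rc]
  have fin: "finite (core_set t r c)" using core(1) finite_subset by blast
  have sub: "row_set t r c \<subseteq> {1..m}" "col_set t r c \<subseteq> {1..n}"
    using core(1) r c t by (auto simp: row_set_def col_set_def)
  have card: "card (row_set t r c) = t" "card (col_set t r c) = t"
    using core fin rc t(1) by (auto simp: row_set_def col_set_def card_Diff_subset)
  show "is_index_set t m (row_set t r c)" "is_index_set t n (col_set t r c)"
    using sub card by (auto simp: is_index_set_def)
  have fins: "finite (row_set t r c)" "finite (col_set t r c)" using sub finite_subset by blast+
  have pos: "row_set t r c \<subseteq> {1..}" "col_set t r c \<subseteq> {1..}" using sub by auto
  show "Phi0_cond t (row_set t r c) (col_set t r c)"
    unfolding Phi0_cond_iff[OF t(1) pos(1) fins(1) card(1) pos(2) fins(2) card(2)]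
  proof (cases "r \<le> t + 1 \<and> c \<le> t + 1")
    case True
    then have "row_set t r c \<subseteq> {1..t + 1}" "col_set t r c \<subseteq> {1..t + 1}"
      using row_col_set_small[OF rc] by auto
    then show "row_set t r c \<subseteq> {1..t + 1} \<and> col_set t r c \<subseteq> {1..t + 1} \<or>
     {1..t - 1} \<subseteq> row_set t r c \<and> {1..t - 1} \<subseteq> col_set t r c \<or>
     row_set t r c = {1..t} \<and> t - 1 \<le> card (col_set t r c \<inter> {..t}) \<or>
     t - 1 \<le> card (row_set t r c \<inter> {..t}) \<and> col_set t r c = {1..t}" by blast
  next
    case False
    consider "r \<le> t" | "r > t" "c \<le> t" | "r > t" "c > t" by linarith
    then show "row_set t r c \<subseteq> {1..t + 1} \<and> col_set t r c \<subseteq> {1..t + 1} \<or>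
     {1..t - 1} \<subseteq> row_set t r c \<and> {1..t - 1} \<subseteq> col_set t r c \<or>
     row_set t r c = {1..t} \<and> t - 1 \<le> card (col_set t r c \<inter> {..t}) \<or>
     t - 1 \<le> card (row_set t r c \<inter> {..t}) \<and> col_set t r c = {1..t}"
    proof cases
      case 1
      then have "t + 1 < c" using False by simp
      note s = row_col_set_right[OF rc(1) 1 this]
      have "t - 1 = card ({1..t} - {r})" using 1 rc by simp
      also have "\<dots> \<le> card (col_set t r c \<inter> {..t})" using fins by (intro card_mono) (auto simp: s)
      finally show ?thesis using s(1) by simp
    next
      case 2
      then have "t + 1 < r" using False by simp
      note s = row_col_set_below[OF rc(2) 2(2) this]
      have "t - 1 = card ({1..t} - {c})" using 2 rc by simp
      also have "\<dots> \<le> card (row_set t r c \<inter> {..t})" using fins by (intro card_mono) (auto simp: s)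
      finally show ?thesis using s(2) by simp
    next
      case 3
      then have "t + 1 < r \<or> t + 1 < c" using False by linarith
      from row_col_set_far[OF 3 this] show ?thesis by auto
    qed
  qed
qed

lemma Phi0_eq_image:
  assumes t: "0 < t" "t < m" "m \<le> n"
  shows "Phi0 m n t = minor_at m n t ` ({1..m} \<times> {1..n})"
proof
  show "Phi0 m n t \<subseteq> minor_at m n t ` ({1..m} \<times> {1..n})"
  proof
    fix x assume "x \<in> Phi0 m n t"
    then obtain R C where RC: "x = minor R C" "is_index_set t m R" "is_index_set t n C" "Phi0_cond t R C"
      by (auto simp: Phi0_def)
    from index_exists[OF t RC(2-4)] obtain r c where
      "r \<in> {1..m}" "c \<in> {1..n}" "R = row_set t r c" "C = col_set t r c" by blast
    then show "x \<in> minor_at m n t ` ({1..m} \<times> {1..n})"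
      by (intro image_eqI[of _ _ "(r, c)"]) (auto simp: minor_at_def RC(1))
  qed
  show "minor_at m n t ` ({1..m} \<times> {1..n}) \<subseteq> Phi0 m n t"
    using index_sets[OF t] by (force simp: Phi0_def minor_at_def)
qed

lemma Xvar_eq_iff: "Xvar i j = (Xvar i' j' :: 'k::comm_ring_1 mpoly) \<longleftrightarrow> i = i' \<and> j = j'"
proof
  assume "Xvar i j = (Xvar i' j' :: 'k mpoly)"
  then have "Poly_Mapping.keys (Xvar i j :: 'k mpoly) = Poly_Mapping.keys (Xvar i' j' :: 'k mpoly)" by simp
  then have "Poly_Mapping.single (i, j) (1::nat) = Poly_Mapping.single (i', j') 1" by (simp add: Xvar_def)
  then have "Poly_Mapping.keys (Poly_Mapping.single (i, j) (1::nat)) = Poly_Mapping.keys (Poly_Mapping.single (i', j') (1::nat))"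
    by simp
  then show "i = i' \<and> j = j'" by simp
qed simp

text \<open>Two equal members would give the relation \<open>X v - X w\<close>, so independence also
  yields distinctness.\<close>

lemma card_Phi0:
  assumes t: "0 < t" "t < m" "m \<le> n"
  shows "card (Phi0 m n t :: 'k::field_char_0 mpoly set) = m * n"
proof -
  note h\<Phi> = comm_ring_homD[OF comm_ring_hom_mpoly_eval[OF comm_ring_hom_Const, of "minor_at m n t :: _ \<Rightarrow> 'k mpoly"]]
  have "inj (minor_at m n t :: _ \<Rightarrow> 'k mpoly)"
  proof (rule injI)
    fix v w assume "minor_at m n t v = (minor_at m n t w :: 'k mpoly)"
    then have "mpoly_eval Const (minor_at m n t) (X v - X w :: 'k mpoly) = 0"
      by (simp add: h\<Phi> mpoly_eval_Xvar[OF comm_ring_hom_Const])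
    from minor_at_injective[OF t this] have "X v = (X w :: 'k mpoly)" by simp
    then show "v = w" by (simp add: Xvar_eq_iff prod_eq_iff)
  qed
  then show ?thesis
    unfolding Phi0_eq_image[OF t] by (subst card_image) (auto intro: inj_on_subset)
qed

lemma affine_ring_Phi0:
  assumes t: "0 < t" "t < m" "m \<le> n"
  shows "affine_ring (range (\<lambda>c. to_fract (Const c :: 'k::field_char_0 mpoly))) (to_fract ` Phi0 m n t)"
  unfolding Phi0_eq_image[OF t] by (rule affine_ring_if_injective[OF minor_at_injective[OF t]]) auto

section \<open>Expressing minors through \<open>\<Phi>\<^sub>0\<close>\<close>

text \<open>Lists instead of sets allow replacing one index in place, as Cramer's rule demands;
  \<open>det_submat_sort\<close> returns to sorted index sets at the cost of a sign.\<close>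

definition submat :: "(nat \<Rightarrow> nat \<Rightarrow> 'a) \<Rightarrow> nat list \<Rightarrow> nat list \<Rightarrow> 'a mat" where
  "submat x rs cs = mat (length rs) (length cs) (\<lambda>(i, j). x (rs ! i) (cs ! j))"

lemma submat_carrier [simp]: "submat x rs cs \<in> carrier_mat (length rs) (length cs)"
  by (simp add: submat_def)

lemma submat_index [simp]:
  "i < length rs \<Longrightarrow> j < length cs \<Longrightarrow> submat x rs cs $$ (i, j) = x (rs ! i) (cs ! j)"
  "dim_row (submat x rs cs) = length rs" "dim_col (submat x rs cs) = length cs"
  by (auto simp: submat_def)

lemma det_submat_transpose:
  assumes "length rs = length cs"
  shows "det (submat x rs cs) = det (submat (\<lambda>r c. x c r) cs rs :: 'a::comm_ring_1 mat)"
proof -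
  have "submat (\<lambda>r c. x c r) cs rs = transpose_mat (submat x rs cs)"
    by (intro eq_matI) auto
  then show ?thesis using det_transpose[of "submat x rs cs" "length rs"] assms
    by (metis submat_carrier)
qed

lemma det_submat_sort_rows:
  fixes x :: "nat \<Rightarrow> nat \<Rightarrow> 'a::comm_ring_1"
  assumes "distinct rs" "length cs = length rs"
  shows "\<exists>s::int. (s = 1 \<or> s = -1) \<and>
    det (submat x rs cs) = of_int s * det (submat x (sorted_list_of_set (set rs)) cs)"
proof -
  let ?sl = "sorted_list_of_set (set rs)"
  have len: "length ?sl = length rs" using assms(1) by (simp add: distinct_card)
  have "mset rs = mset ?sl" using assms(1) by (intro set_eq_iff_mset_eq_distinct[THEN iffD1]) auto
  then obtain p where p: "p permutes {..<length ?sl}" "permute_list p ?sl = rs"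
    by (rule mset_eq_permutation)
  have nth: "rs ! i = ?sl ! p i" if "i < length rs" for i
    using permute_list_nth[OF p(1), of i] that p(2) len by simp
  have pl: "p i < length rs" if "i < length rs" for i
    using permutes_in_image[OF p(1), of i] that len by simp
  have "submat x rs cs = mat (length rs) (length rs) (\<lambda>(i, j). submat x ?sl cs $$ (p i, j))"
    by (intro eq_matI) (use assms len nth pl in auto)
  moreover have "submat x ?sl cs \<in> carrier_mat (length rs) (length rs)"
    using len assms(2) submat_carrier[of x ?sl cs] by simp
  ultimately have "det (submat x rs cs) = of_int (sign p) * det (submat x ?sl cs)"
    using det_permute_rows[of _ "length rs" p] p(1) len by (simp add: atLeast0LessThan)
  then show ?thesis by (intro exI[of _ "sign p"]) (auto simp: sign_def)
qed

lemma det_submat_sort: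
  fixes x :: "nat \<Rightarrow> nat \<Rightarrow> 'a::comm_ring_1"
  assumes "distinct rs" "distinct cs" "length cs = length rs"
  shows "\<exists>s::int. det (submat x rs cs) =
    of_int s * det (submat x (sorted_list_of_set (set rs)) (sorted_list_of_set (set cs)))"
proof -
  let ?r = "sorted_list_of_set (set rs)" and ?c = "sorted_list_of_set (set cs)"
  have len: "length ?r = length rs" "length ?c = length cs" using assms by (simp_all add: distinct_card)
  obtain s where s: "det (submat x rs cs) = of_int s * det (submat x ?r cs)"
    using det_submat_sort_rows[OF assms(1,3)] by blast
  obtain s' where s': "det (submat (\<lambda>r c. x c r) cs ?r) = of_int s' * det (submat (\<lambda>r c. x c r) ?c ?r)"
    using det_submat_sort_rows[OF assms(2), of ?r "\<lambda>r c. x c r"] len assms(3) by auto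
  have "det (submat x ?r cs) = of_int s' * det (submat x ?r ?c)"
    using s' det_submat_transpose[of ?r cs x] det_submat_transpose[of ?r ?c x] len assms(3) by simp
  then show ?thesis using s by (intro exI[of _ "s * s'"]) (simp add: mult.assoc)
qed

lemma (in sub_ring) det_closed:
  assumes "A \<in> carrier_mat n n" "\<And>i j. i < n \<Longrightarrow> j < n \<Longrightarrow> A $$ (i, j) \<in> R"
  shows "det A \<in> R"
  unfolding det_def'[OF assms(1)]
proof (intro sum mult prod of_int)
  fix p i assume "p \<in> {p. p permutes {0..<n}}" "i \<in> {0..<n}"
  then show "A $$ (i, p i) \<in> R" using assms(2)[of i "p i"] permutes_in_image[of p "{0..<n}" i] by simp
qed

text \<open>Block factorization: lower triangular with diagonal blocks \<open>A\<close> and 1, times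
  upper triangular with diagonal blocks 1 and the Schur complement.\<close>

lemma det_schur:
  fixes A :: "'a::field mat"
  assumes A: "A \<in> carrier_mat n n" and Ai: "Ai \<in> carrier_mat n n" "A * Ai = 1\<^sub>m n"
    and B: "B \<in> carrier_mat n k" and C: "C \<in> carrier_mat k n" and D: "D \<in> carrier_mat k k"
  shows "det (four_block_mat A B C D) = det A * det (D - C * (Ai * B))"
proof -
  let ?S = "D - C * (Ai * B)"
  have AiB: "Ai * B \<in> carrier_mat n k" using Ai B by simp
  have CAB: "C * (Ai * B) \<in> carrier_mat k k" using C AiB by simp
  have S: "?S \<in> carrier_mat k k" using CAB by (rule minus_carrier_mat)
  have e: "four_block_mat A (0\<^sub>m n k) C (1\<^sub>m k) * four_block_mat (1\<^sub>m n) (Ai * B) (0\<^sub>m k n) ?S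
     = four_block_mat (A * 1\<^sub>m n + 0\<^sub>m n k * 0\<^sub>m k n) (A * (Ai * B) + 0\<^sub>m n k * ?S)
         (C * 1\<^sub>m n + 1\<^sub>m k * 0\<^sub>m k n) (C * (Ai * B) + 1\<^sub>m k * ?S)"
    by (rule mult_four_block_mat[OF A zero_carrier_mat C one_carrier_mat one_carrier_mat AiB zero_carrier_mat S])
  have "A * (Ai * B) = A * Ai * B" using A Ai(1) B by (rule assoc_mult_mat[symmetric])
  then have AB: "A * (Ai * B) = B" using B by (simp add: Ai(2))
  have "A * 1\<^sub>m n + 0\<^sub>m n k * 0\<^sub>m k n = A" "A * (Ai * B) + 0\<^sub>m n k * ?S = B" "C * 1\<^sub>m n + 1\<^sub>m k * 0\<^sub>m k n = C"
    unfolding AB using A B C S by auto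
  moreover have "M + 1\<^sub>m k * (D - M) = D" if M: "M \<in> carrier_mat k k" for M
    using M D left_mult_one_mat[OF minus_carrier_mat[OF M, of D]] by (intro eq_matI) auto
  note this[OF CAB]
  ultimately have "four_block_mat A B C D =
      four_block_mat A (0\<^sub>m n k) C (1\<^sub>m k) * four_block_mat (1\<^sub>m n) (Ai * B) (0\<^sub>m k n) ?S"
    using e by simp
  moreover have "det (four_block_mat A (0\<^sub>m n k) C (1\<^sub>m k)) = det A"
    using det_four_block_mat_upper_right_zero[OF A refl C one_carrier_mat] by simp
  moreover have "det (four_block_mat (1\<^sub>m n) (Ai * B) (0\<^sub>m k n) ?S) = det ?S"
    using det_four_block_mat_lower_left_zero[OF one_carrier_mat AiB refl S] by simp
  ultimately show ?thesis
    using det_mult[OF four_block_carrier_mat[OF A one_carrier_mat] four_block_carrier_mat[OF one_carrier_mat S]]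
    by simp
qed

text \<open>Expand along the last row: its cofactors do not see the changed entry.\<close>

lemma det_change_corner:
  fixes A B :: "'a::comm_ring_1 mat"
  assumes A: "A \<in> carrier_mat (Suc n) (Suc n)" and B: "B \<in> carrier_mat (Suc n) (Suc n)"
    and eq: "\<And>i j. i \<le> n \<Longrightarrow> j \<le> n \<Longrightarrow> (i, j) \<noteq> (n, n) \<Longrightarrow> A $$ (i, j) = B $$ (i, j)"
  shows "det A - det B = (A $$ (n, n) - B $$ (n, n)) * det (mat_delete A n n)"
proof -
  have del: "mat_delete A n j = mat_delete B n j" for j
    using A B by (intro eq_matI) (auto simp: mat_delete_def intro!: eq)
  then have cof: "cofactor B n j = cofactor A n j" for j by (simp add: cofactor_def)
  have "det A - det B = (\<Sum>j<Suc n. A $$ (n, j) * cofactor A n j) - (\<Sum>j<Suc n. B $$ (n, j) * cofactor A n j)"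
    using laplace_expansion_row[OF A, of n] laplace_expansion_row[OF B, of n] by (simp add: cof)
  also have "\<dots> = (A $$ (n, n) - B $$ (n, n)) * cofactor A n n"
    using eq[of n] by (simp add: algebra_simps)
  finally show ?thesis by (simp add: cofactor_def)
qed

definition initial :: "nat \<Rightarrow> nat list" where
  "initial k = [1..<Suc k]"

lemma initial [simp]:
  "length (initial k) = k" "i < k \<Longrightarrow> initial k ! i = Suc i" "set (initial k) = {1..k}" "distinct (initial k)"
  by (auto simp: initial_def simp del: upt_Suc)

lemma sorted_list_initial: "sorted_list_of_set {1..k} = initial k"
  unfolding initial_def by (metis atLeastLessThanSuc_atLeastAtMost sorted_list_of_set_range)

lemma mat_delete_initial:
  "mat_delete (submat x (initial k @ [r]) (initial k @ [c])) k k = submat x (initial k) (initial k)"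
  by (intro eq_matI) (auto simp: mat_delete_def nth_append)

text \<open>Notation of this locale: \<open>Y\<close> is the leading block of size \<open>t\<close> of the matrix \<open>x\<close>,
  \<open>P = Y\<^sup>-\<^sup>1 x\<close> and \<open>Q = x Y\<^sup>-\<^sup>1\<close> (restricted to the first rows and columns of \<open>x\<close>, respectively),
  and \<open>res\<close> is the Schur complement of \<open>Y\<close>.\<close>
locale leading_block =
  fixes x :: "nat \<Rightarrow> nat \<Rightarrow> 'f::field" and t :: nat
  assumes det_nonzero: "det (submat x (initial t) (initial t)) \<noteq> 0"
begin

definition Y where "Y = submat x (initial t) (initial t)"

definition Yi where "Yi = (1 / det Y) \<cdot>\<^sub>m adj_mat Y"

definition P where "P i c = (\<Sum>j<t. Yi $$ (i, j) * x (Suc j) c)"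

definition Q where "Q r j = (\<Sum>i<t. x r (Suc i) * Yi $$ (i, j))"

definition res where "res r c = x r c - (\<Sum>i<t. Q r i * x (Suc i) c)"

lemma Y [simp]: "Y \<in> carrier_mat t t"
  using submat_carrier[of x "initial t" "initial t"] by (simp add: Y_def)

lemma Yi [simp]: "Yi \<in> carrier_mat t t"
  using adj_mat(1)[OF Y] by (simp add: Yi_def)

lemma Y_index [simp]:
  "i < t \<Longrightarrow> j < t \<Longrightarrow> Y $$ (i, j) = x (Suc i) (Suc j)" "dim_row Y = t" "dim_col Y = t"
  "dim_row Yi = t" "dim_col Yi = t"
  using carrier_matD[OF Yi] by (auto simp: Y_def)

lemma Y_inverse: "Y * Yi = 1\<^sub>m t" "Yi * Y = 1\<^sub>m t"
proof -
  have d: "det Y \<noteq> 0" using det_nonzero by (simp add: Y_def)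
  have "Y * Yi = (1 / det Y) \<cdot>\<^sub>m (det Y \<cdot>\<^sub>m 1\<^sub>m t)"
    unfolding Yi_def using adj_mat[OF Y] by (simp add: mult_smult_distrib[OF Y adj_mat(1)[OF Y]])
  also have "\<dots> = 1\<^sub>m t" using d by (intro eq_matI) auto
  finally show "Y * Yi = 1\<^sub>m t" .
  have "Yi * Y = (1 / det Y) \<cdot>\<^sub>m (det Y \<cdot>\<^sub>m 1\<^sub>m t)"
    unfolding Yi_def using adj_mat[OF Y] by (simp add: mult_smult_assoc_mat[OF adj_mat(1)[OF Y] Y])
  also have "\<dots> = 1\<^sub>m t" using d by (intro eq_matI) auto
  finally show "Yi * Y = 1\<^sub>m t" .
qed

lemma det_Yi: "det Y * det Yi = 1"
  using det_mult[OF Y Yi] Y_inverse(1) by simp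

lemma Y_inverse_entries:
  assumes "i < t" "k < t"
  shows "(\<Sum>j<t. x (Suc i) (Suc j) * Yi $$ (j, k)) = (if i = k then 1 else 0)"
    "(\<Sum>j<t. Yi $$ (i, j) * x (Suc j) (Suc k)) = (if i = k then 1 else 0)"
proof -
  have "(Y * Yi) $$ (i, k) = (\<Sum>j<t. x (Suc i) (Suc j) * Yi $$ (j, k))"
    using assms by (simp add: scalar_prod_def atLeast0LessThan)
  then show "(\<Sum>j<t. x (Suc i) (Suc j) * Yi $$ (j, k)) = (if i = k then 1 else 0)"
    using assms by (simp add: Y_inverse)
  have "(Yi * Y) $$ (i, k) = (\<Sum>j<t. Yi $$ (i, j) * x (Suc j) (Suc k))"
    using assms by (simp add: scalar_prod_def atLeast0LessThan)
  then show "(\<Sum>j<t. Yi $$ (i, j) * x (Suc j) (Suc k)) = (if i = k then 1 else 0)"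
    using assms by (simp add: Y_inverse)
qed

lemma P_initial: "i < t \<Longrightarrow> k < t \<Longrightarrow> P i (Suc k) = (if i = k then 1 else 0)"
  unfolding P_def by (rule Y_inverse_entries(2))

lemma Q_initial: "i < t \<Longrightarrow> k < t \<Longrightarrow> Q (Suc i) k = (if i = k then 1 else 0)"
  unfolding Q_def by (rule Y_inverse_entries(1))

lemma Y_P: "i < t \<Longrightarrow> (\<Sum>j<t. x (Suc i) (Suc j) * P j c) = x (Suc i) c"
proof -
  assume i: "i < t"
  have "(\<Sum>j<t. x (Suc i) (Suc j) * P j c) = (\<Sum>j<t. \<Sum>k<t. x (Suc i) (Suc j) * Yi $$ (j, k) * x (Suc k) c)"
    by (simp add: P_def sum_distrib_left mult.assoc)
  also have "\<dots> = (\<Sum>k<t. (\<Sum>j<t. x (Suc i) (Suc j) * Yi $$ (j, k)) * x (Suc k) c)"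
    by (subst sum.swap) (simp add: sum_distrib_right)
  also have "\<dots> = (\<Sum>k<t. if i = k then x (Suc k) c else 0)"
    using i by (intro sum.cong refl) (simp add: Y_inverse_entries)
  finally show ?thesis using i by simp
qed

lemma Q_Y: "j < t \<Longrightarrow> (\<Sum>i<t. Q r i * x (Suc i) (Suc j)) = x r (Suc j)"
proof -
  assume j: "j < t"
  have "(\<Sum>i<t. Q r i * x (Suc i) (Suc j)) = (\<Sum>i<t. \<Sum>k<t. x r (Suc k) * (Yi $$ (k, i) * x (Suc i) (Suc j)))"
    by (simp add: Q_def sum_distrib_right mult.assoc)
  also have "\<dots> = (\<Sum>k<t. x r (Suc k) * (\<Sum>i<t. Yi $$ (k, i) * x (Suc i) (Suc j)))"
    by (subst sum.swap) (simp add: sum_distrib_left)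
  also have "\<dots> = (\<Sum>k<t. if k = j then x r (Suc k) else 0)"
    using j by (intro sum.cong refl) (simp add: Y_inverse_entries)
  finally show ?thesis using j by simp
qed

lemma res_initial: "i < t \<Longrightarrow> res (Suc i) c = 0" "j < t \<Longrightarrow> res r (Suc j) = 0"
proof -
  assume i: "i < t"
  have "(\<Sum>k<t. Q (Suc i) k * x (Suc k) c) = (\<Sum>k<t. if i = k then x (Suc k) c else 0)"
    using i by (intro sum.cong refl) (simp add: Q_initial)
  then show "res (Suc i) c = 0" using i by (simp add: res_def)
qed (simp add: res_def Q_Y)

text \<open>Cramer's rule for the system with matrix \<open>Y\<close>, whose solution is column
  \<open>c\<close> of P.\<close>

lemma det_replace_column:
  assumes i: "i < t"
  shows "det (submat x (initial t) ((initial t)[i := c])) = P i c * det Y"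
proof -
  let ?v = "vec t (\<lambda>i. P i c)"
  have "Y *\<^sub>v ?v = vec t (\<lambda>i. x (Suc i) c)"
  proof (intro eq_vecI)
    fix k assume "k < dim_vec (vec t (\<lambda>i. x (Suc i) c))"
    then have k: "k < t" by simp
    then have "(Y *\<^sub>v ?v) $ k = (\<Sum>j<t. x (Suc k) (Suc j) * P j c)"
      by (simp add: scalar_prod_def atLeast0LessThan)
    then show "(Y *\<^sub>v ?v) $ k = vec t (\<lambda>i. x (Suc i) c) $ k" using k by (simp add: Y_P)
  qed auto
  moreover have "replace_col Y (vec t (\<lambda>i. x (Suc i) c)) i = submat x (initial t) ((initial t)[i := c])"
    by (intro eq_matI) (auto simp: replace_col_def Y_def nth_list_update)
  ultimately show ?thesis using cramer_lemma_mat[OF Y, of ?v i] i by simp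
qed

lemma det_replace_row:
  assumes j: "j < t"
  shows "det (submat x ((initial t)[j := r]) (initial t)) = Q r j * det Y"
proof -
  let ?v = "vec t (\<lambda>i. Q r i)"
  have YT: "transpose_mat Y \<in> carrier_mat t t" using Y by simp
  have "transpose_mat Y *\<^sub>v ?v = vec t (\<lambda>i. x r (Suc i))"
  proof (intro eq_vecI)
    fix k assume "k < dim_vec (vec t (\<lambda>i. x r (Suc i)))"
    then have k: "k < t" by simp
    then have "(transpose_mat Y *\<^sub>v ?v) $ k = (\<Sum>i<t. Q r i * x (Suc i) (Suc k))"
      by (simp add: scalar_prod_def atLeast0LessThan mult.commute)
    then show "(transpose_mat Y *\<^sub>v ?v) $ k = vec t (\<lambda>i. x r (Suc i)) $ k" using k by (simp add: Q_Y)
  qed auto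
  moreover have "replace_col (transpose_mat Y) (vec t (\<lambda>i. x r (Suc i))) j =
      submat (\<lambda>r c. x c r) (initial t) ((initial t)[j := r])"
    by (intro eq_matI) (auto simp: replace_col_def Y_def nth_list_update)
  ultimately show ?thesis
    using cramer_lemma_mat[OF YT, of ?v j] j det_transpose[OF Y]
      det_submat_transpose[of "(initial t)[j := r]" "initial t" x] by simp
qed

definition Qmat where "Qmat rs = mat (length rs) t (\<lambda>(a, j). Q (rs ! a) j)"

definition Pmat where "Pmat cs = mat t (length cs) (\<lambda>(i, b). P i (cs ! b))"

definition Rmat where "Rmat rs cs = submat res rs cs"

lemma mats [simp]: "Qmat rs \<in> carrier_mat (length rs) t" "Pmat cs \<in> carrier_mat t (length cs)"
  "Rmat rs cs \<in> carrier_mat (length rs) (length cs)"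
  by (auto simp: Qmat_def Pmat_def Rmat_def)

lemma Y_Pmat: "Y * Pmat cs = submat x (initial t) cs"
proof (intro eq_matI)
  fix i b assume ib: "i < dim_row (submat x (initial t) cs)" "b < dim_col (submat x (initial t) cs)"
  then have "(Y * Pmat cs) $$ (i, b) = (\<Sum>j<t. x (Suc i) (Suc j) * P j (cs ! b))"
    by (simp add: scalar_prod_def atLeast0LessThan Pmat_def)
  then show "(Y * Pmat cs) $$ (i, b) = submat x (initial t) cs $$ (i, b)" using ib by (simp add: Y_P)
qed (auto simp: Pmat_def)

lemma Qmat_mult: "Qmat rs * submat x (initial t) cs =
    mat (length rs) (length cs) (\<lambda>(a, b). \<Sum>i<t. Q (rs ! a) i * x (Suc i) (cs ! b))"
  by (intro eq_matI) (simp_all add: scalar_prod_def atLeast0LessThan Qmat_def)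

lemma Qmat_Y: "Qmat rs * Y = submat x rs (initial t)"
  unfolding Y_def Qmat_mult by (intro eq_matI) (simp_all add: Q_Y)

lemma submat_eq: "submat x rs cs = Qmat rs * (Y * Pmat cs) + Rmat rs cs"
  unfolding Y_Pmat Qmat_mult Rmat_def by (intro eq_matI) (simp_all add: res_def)

lemma det_bordered:
  "det (submat x (initial t @ [r]) (initial t @ [c])) = det Y * res r c"
proof -
  let ?B = "submat x (initial t) [c]" and ?C = "submat x [r] (initial t)" and ?D = "submat x [r] [c]"
  have B: "?B \<in> carrier_mat t 1" using submat_carrier[of x "initial t" "[c]"] by simp
  have C: "?C \<in> carrier_mat 1 t" using submat_carrier[of x "[r]" "initial t"] by simp
  have D: "?D \<in> carrier_mat 1 1" using submat_carrier[of x "[r]" "[c]"] by simp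
  have "submat x (initial t @ [r]) (initial t @ [c]) = four_block_mat Y ?B ?C ?D"
    by (intro eq_matI) (auto simp: Y_def nth_append)
  then have "det (submat x (initial t @ [r]) (initial t @ [c])) = det Y * det (?D - ?C * (Yi * ?B))"
    using det_schur[OF Y Yi Y_inverse(1) B C D] by simp
  also have "?C = Qmat [r] * Y" by (simp add: Qmat_Y)
  also have "Qmat [r] * Y * (Yi * ?B) = Qmat [r] * (Y * (Yi * ?B))"
    by (rule assoc_mult_mat[OF mats(1) Y mult_carrier_mat[OF Yi B]])
  also have "Y * (Yi * ?B) = Y * Yi * ?B" by (rule assoc_mult_mat[OF Y Yi B, symmetric])
  also have "\<dots> = ?B" using B by (simp add: Y_inverse)
  also have "det (?D - Qmat [r] * ?B) = res r c"
    unfolding Qmat_mult by (subst det_single) (auto simp: res_def)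
  finally show ?thesis .
qed

text \<open>As \<open>res\<close> vanishes in the first t rows and columns, the bordered submatrix
  differs from \<open>Qmat\<close>, \<open>Y\<close>, \<open>Pmat\<close> multiplied together only
  in the corner, by \<open>res r c\<close>. The determinant of that product, times
  \<open>det Y\<close>, splits into the two mixed minors.\<close>

lemma sylvester:
  assumes t: "t = Suc k"
  shows "det Y * det (submat x (initial k @ [r]) (initial k @ [c])) -
      det (submat x (initial k @ [r]) (initial t)) * det (submat x (initial t) (initial k @ [c]))
    = det Y * det (submat x (initial k) (initial k)) * res r c"
proof -
  let ?rs = "initial k @ [r]" and ?cs = "initial k @ [c]"
  have len: "length ?rs = t" "length ?cs = t" by (simp_all add: t)
  note m = mats[of ?rs, unfolded len] mats(2)[of ?cs, unfolded len] mats(3)[of ?rs ?cs, unfolded len]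
  let ?M = "Qmat ?rs * (Y * Pmat ?cs)"
  have M: "?M \<in> carrier_mat t t" using m Y by (meson mult_carrier_mat)
  have A: "submat x ?rs ?cs \<in> carrier_mat t t" using submat_carrier[of x ?rs ?cs] by (simp add: t)
  have sm: "submat x ?rs ?cs $$ (i, j) = ?M $$ (i, j) + res (?rs ! i) (?cs ! j)" if "i < t" "j < t" for i j
  proof -
    have "submat x ?rs ?cs $$ (i, j) = (?M + Rmat ?rs ?cs) $$ (i, j)" by (subst submat_eq) (rule refl)
    then show ?thesis using that m(5) len by (simp add: Rmat_def)
  qed
  have "det (submat x ?rs ?cs) - det ?M = (submat x ?rs ?cs $$ (k, k) - ?M $$ (k, k)) *
      det (mat_delete (submat x ?rs ?cs) k k)"
  proof (rule det_change_corner)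
    fix i j assume ij: "i \<le> k" "j \<le> k" "(i, j) \<noteq> (k, k)"
    then have "res (?rs ! i) (?cs ! j) = 0"
      using res_initial(1)[of i] res_initial(2)[of j] by (auto simp: nth_append t)
    then show "submat x ?rs ?cs $$ (i, j) = ?M $$ (i, j)" using sm[of i j] ij t by simp
  qed (use A M in \<open>simp_all only: t\<close>)
  also have "submat x ?rs ?cs $$ (k, k) - ?M $$ (k, k) = res r c"
    using sm[of k k] by (simp add: t nth_append del: submat_index)
  finally have 1: "det (submat x ?rs ?cs) - det ?M = res r c * det (submat x (initial k) (initial k))"
    by (simp add: mat_delete_initial)
  have "det ?M = det (Qmat ?rs) * det (Y * Pmat ?cs)"
    by (rule det_mult[OF m(1) mult_carrier_mat[OF Y m(4)]])
  then have "det Y * det ?M = det (Qmat ?rs * Y) * det (Y * Pmat ?cs)"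
    using det_mult[OF m(1) Y] by simp
  then have 2: "det Y * det ?M = det (submat x ?rs (initial t)) * det (submat x (initial t) ?cs)"
    by (simp add: Qmat_Y Y_Pmat)
  show ?thesis using arg_cong[OF 1, of "\<lambda>u. det Y * u"] 2 by (simp add: algebra_simps)
qed

end

lemma smult_inverse_mat:
  assumes "A \<in> carrier_mat n n" "B \<in> carrier_mat n n" "A * B = 1\<^sub>m n" "\<rho> \<noteq> (0 :: 'a::field)"
  shows "(\<rho> \<cdot>\<^sub>m A) * ((1 / \<rho>) \<cdot>\<^sub>m B) = 1\<^sub>m n"
proof -
  have "(\<rho> \<cdot>\<^sub>m A) * ((1 / \<rho>) \<cdot>\<^sub>m B) = \<rho> \<cdot>\<^sub>m ((1 / \<rho>) \<cdot>\<^sub>m (A * B))"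
    using mult_smult_assoc_mat[OF assms(1) smult_carrier_mat[OF assms(2)], of \<rho> "1 / \<rho>"]
      mult_smult_distrib[OF assms(1,2)] by simp
  also have "\<dots> = 1\<^sub>m n" unfolding assms(3) by (intro eq_matI) (use assms(4) in auto)
  finally show ?thesis .
qed

text \<open>The Schur complement of \<open>\<rho> Y\<^sup>-\<^sup>1\<close> in this block matrix is \<open>x / \<rho>\<close> restricted to the given rows and columns.\<close>
lemma (in leading_block) det_submat_eq:
  assumes len: "length rs = t" "length cs = t" and \<rho>: "\<rho> \<noteq> 0"
  shows "det (submat x rs cs) = det Y *
    det (four_block_mat (\<rho> \<cdot>\<^sub>m Yi) (Pmat cs) (- Qmat rs) ((1 / \<rho>) \<cdot>\<^sub>m Rmat rs cs))"
proof -
  note m = mats(1)[of rs, unfolded len] mats(2)[of cs, unfolded len] mats(3)[of rs cs, unfolded len]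
  let ?W = "\<rho> \<cdot>\<^sub>m Yi" and ?Wi = "(1 / \<rho>) \<cdot>\<^sub>m Y" and ?N = "(1 / \<rho>) \<cdot>\<^sub>m Rmat rs cs"
  have YP: "Y * Pmat cs \<in> carrier_mat t t" by (rule mult_carrier_mat[OF Y m(2)])
  have QYP: "Qmat rs * (Y * Pmat cs) \<in> carrier_mat t t" by (rule mult_carrier_mat[OF m(1) YP])
  have W: "?W \<in> carrier_mat t t" "?Wi \<in> carrier_mat t t" "?N \<in> carrier_mat t t" "- Qmat rs \<in> carrier_mat t t"
    using m by simp_all
  have "?Wi * Pmat cs = (1 / \<rho>) \<cdot>\<^sub>m (Y * Pmat cs)" by (rule mult_smult_assoc_mat[OF Y m(2)])
  then have "(- Qmat rs) * (?Wi * Pmat cs) = (1 / \<rho>) \<cdot>\<^sub>m ((- Qmat rs) * (Y * Pmat cs))"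
    using mult_smult_distrib[OF W(4) YP] by simp
  also have "(- Qmat rs) * (Y * Pmat cs) = - (Qmat rs * (Y * Pmat cs))"
    using m(1) YP by (intro eq_matI) (auto simp: scalar_prod_def sum_negf)
  finally have "?N - (- Qmat rs) * (?Wi * Pmat cs) = (1 / \<rho>) \<cdot>\<^sub>m submat x rs cs"
    unfolding submat_eq[of rs cs] using QYP m(3) \<rho> by (intro eq_matI) (auto simp del: index_mult_mat simp: algebra_simps)
  then have "det (four_block_mat ?W (Pmat cs) (- Qmat rs) ?N) = det ?W * det ((1 / \<rho>) \<cdot>\<^sub>m submat x rs cs)"
    using det_schur[OF W(1,2) smult_inverse_mat[OF Yi Y Y_inverse(2) \<rho>] m(2) W(4) W(3)] by simp
  also have "\<dots> = det Yi * det (submat x rs cs)"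
    using \<rho> len by (simp add: power_one_over)
  finally show ?thesis using det_Yi by (simp add: mult.assoc[symmetric])
qed

text \<open>\<open>S\<close> is left open since two rings are needed: the algebra of
  \<open>\<Phi>\<^sub>0\<close> itself, to see that F lies in it, and later its localization at
  F.\<close>

locale minor_ring = sub_ring S for S :: "'f::field set" +
  fixes x :: "nat \<Rightarrow> nat \<Rightarrow> 'f" and t m n :: nat
  assumes t: "0 < t" "t < m" "t < n"
    and minor_at: "r \<in> {1..m} \<Longrightarrow> c \<in> {1..n} \<Longrightarrow>
      det (submat x (sorted_list_of_set (row_set t r c)) (sorted_list_of_set (col_set t r c))) \<in> S"
begin

abbreviation \<delta> where "\<delta> k \<equiv> det (submat x (initial k) (initial k))"

lemma minor_in:
  assumes "distinct rs" "distinct cs" "length cs = length rs"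
    and "set rs = row_set t r c" "set cs = col_set t r c" "r \<in> {1..m}" "c \<in> {1..n}"
  shows "det (submat x rs cs) \<in> S"
proof -
  obtain s :: int where "det (submat x rs cs) =
    of_int s * det (submat x (sorted_list_of_set (set rs)) (sorted_list_of_set (set cs)))"
    using det_submat_sort[OF assms(1-3)] by blast
  then show ?thesis using minor_at[OF assms(6,7)] assms(4,5) by auto
qed

lemma leading_minor_in: "\<delta> t \<in> S"
proof (rule minor_in)
  have "row_set t (t + 1) (t + 1) = {1..t}" "col_set t (t + 1) (t + 1) = {1..t}"
    by (subst row_col_set_small; use t in force)+
  then show "set (initial t) = row_set t (t + 1) (t + 1)" "set (initial t) = col_set t (t + 1) (t + 1)"
    by simp_all
qed (use t in auto)

text \<open>This minor sits at position \<open>(Suc i, c)\<close>, by condition (i) for c = t + 1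
  and by (iii) beyond.\<close>

lemma column_minor_in:
  assumes i: "i < t" and c: "t < c" "c \<le> n"
  shows "det (submat x (initial t) ((initial t)[i := c])) \<in> S"
proof (rule minor_in)
  have s: "set ((initial t)[i := c]) = insert c ({1..t} - {Suc i})"
    using set_update_distinct[of "initial t" i c] i by simp
  show "distinct ((initial t)[i := c])" using c by (intro distinct_list_update) auto
  have "row_set t (Suc i) c = {1..t} \<and> col_set t (Suc i) c = insert c ({1..t} - {Suc i})"
  proof (cases "c = t + 1")
    case True
    then have p: "1 \<le> Suc i" "1 \<le> c" "Suc i \<le> t + 1" "c \<le> t + 1" using i by auto
    show ?thesis unfolding row_col_set_small[OF p] using True i by auto
  next
    case False
    then show ?thesis using row_col_set_right[of "Suc i" t c] i c by auto
  qed
  then show "set (initial t) = row_set t (Suc i) c" "set ((initial t)[i := c]) = col_set t (Suc i) c"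
    using s by simp_all
qed (use i c t in auto)

lemma row_minor_in:
  assumes j: "j < t" and r: "t < r" "r \<le> m"
  shows "det (submat x ((initial t)[j := r]) (initial t)) \<in> S"
proof (rule minor_in)
  have s: "set ((initial t)[j := r]) = insert r ({1..t} - {Suc j})"
    using set_update_distinct[of "initial t" j r] j by simp
  show "distinct ((initial t)[j := r])" using r by (intro distinct_list_update) auto
  have "col_set t r (Suc j) = {1..t} \<and> row_set t r (Suc j) = insert r ({1..t} - {Suc j})"
  proof (cases "r = t + 1")
    case True
    then have p: "1 \<le> r" "1 \<le> Suc j" "r \<le> t + 1" "Suc j \<le> t + 1" using j by auto
    show ?thesis unfolding row_col_set_small[OF p] using True j by auto
  next
    case False
    then show ?thesis using row_col_set_below[of "Suc j" t r] j r by auto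
  qed
  then show "set (initial t) = col_set t r (Suc j)" "set ((initial t)[j := r]) = row_set t r (Suc j)"
    using s by simp_all
qed (use j r t in auto)

lemma corner_minor_in:
  assumes r: "t < r" "r \<le> m" and c: "t < c" "c \<le> n"
  shows "det (submat x (initial (t - 1) @ [r]) (initial (t - 1) @ [c])) \<in> S"
proof (cases "r = t + 1 \<and> c = t + 1")
  case True
  \<comment> \<open>Position (t + 1, t + 1) is taken by \<open>\<delta> t\<close>; the minor with t
    + 1 in place of t on both sides sits at (t, t).\<close>
  have "{1..t + 1} - {t} = insert (t + 1) {1..t - 1}" using t(1) by auto
  then show ?thesis
    using True t row_col_set_small[of t t t]
    by (intro minor_in[of _ _ t t]) auto
next
  case False
  then have "t + 1 < r \<or> t + 1 < c" using r c by linarith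
  then show ?thesis
    using row_col_set_far[of t r c] r c by (intro minor_in[of _ _ r c]) auto
qed

lemma initial_update: "(initial t)[t - 1 := r] = initial (t - 1) @ [r]"
proof -
  obtain k where k: "t = Suc k" using t(1) by (cases t) auto
  show ?thesis by (simp add: k initial_def list_update_append)
qed

lemma initial_snoc: "initial k @ [Suc k] = initial (Suc k)"
  by (simp add: initial_def)

text \<open>Up to sign these are the entries of the adjugate of the leading block of size t + 1. The
  position is \<open>(Suc j, Suc i)\<close>, transposed, because \<open>row_set\<close> omits the
  column index.\<close>

lemma adjugate_minor_in:
  assumes "i \<le> t" "j \<le> t"
  shows "det (mat_delete (submat x (initial (Suc t)) (initial (Suc t))) i j) \<in> S"
proof -
  define l where "l i = map (\<lambda>a. if a < i then Suc a else Suc (Suc a)) [0..<t]" for i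
  have e: "mat_delete (submat x (initial (Suc t)) (initial (Suc t))) i j = submat x (l i) (l j)"
    by (intro eq_matI) (auto simp: mat_delete_def l_def)
  have s: "set (l i) = {1..t + 1} - {Suc i}" if "i \<le> t" for i
  proof -
    have *: "k \<in> (\<lambda>a. if a < i then Suc a else Suc (Suc a)) ` {0..<t}" if k: "k \<in> {1..t + 1} - {Suc i}" for k
    proof (cases "k \<le> i")
      case True
      then show ?thesis using k \<open>i \<le> t\<close> by (intro image_eqI[of _ _ "k - 1"]) auto
    next
      case False
      then show ?thesis using k by (intro image_eqI[of _ _ "k - 2"]) auto
    qed
    show ?thesis
    proof
      show "set (l i) \<subseteq> {1..t + 1} - {Suc i}" using that unfolding l_def by (auto split: if_splits)
      show "{1..t + 1} - {Suc i} \<subseteq> set (l i)" using * unfolding l_def set_map set_upt by blast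
    qed
  qed
  have d: "distinct (l i)" for i unfolding l_def by (auto simp: distinct_map inj_on_def)
  show ?thesis
    unfolding e using s[OF assms(1)] s[OF assms(2)] d row_col_set_small[of "Suc j" "Suc i" t] assms t
    by (intro minor_in[of _ _ "Suc j" "Suc i"]) (auto simp: l_def)
qed

end

locale minor_ring_inverse = minor_ring S x t m n + leading_block x t
  for S :: "'f::field set" and x t m n
begin

lemma det_Y: "det Y = \<delta> t"
  by (simp add: Y_def)

lemma det_next: "\<delta> (Suc t) = \<delta> t * res (Suc t) (Suc t)"
  using det_bordered[of "Suc t" "Suc t"] by (simp add: det_Y initial_snoc)

text \<open>Every determinant on the left of \<open>sylvester\<close> belongs to \<open>S\<close>,
  so the right side does too, without any inverse.\<close>

lemma corner_res_in:
  assumes r: "t < r" "r \<le> m" and c: "t < c" "c \<le> n"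
  shows "\<delta> t * \<delta> (t - 1) * res r c \<in> S"
proof -
  obtain k where k: "t = Suc k" using t(1) by (cases t) auto
  have "det (submat x (initial k @ [r]) (initial t)) \<in> S" "det (submat x (initial t) (initial k @ [c])) \<in> S"
  proof -
    have u: "(initial t)[k := a] = initial k @ [a]" for a using initial_update[of a] by (simp add: k)
    have "k < t" using k by simp
    from row_minor_in[OF this r] column_minor_in[OF this c]
    show "det (submat x (initial k @ [r]) (initial t)) \<in> S" "det (submat x (initial t) (initial k @ [c])) \<in> S"
      unfolding u .
  qed
  then show ?thesis
    using sylvester[OF k, of r c] corner_minor_in[OF r c] leading_minor_in k
    by (metis det_Y diff mult diff_Suc_1)
qed

text \<open>At r = c = t + 1 the factor \<open>\<delta> t * res r c\<close> is
  \<open>\<delta> (Suc t)\<close>: the outer factors of F enter \<open>S\<close> as a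
  product.\<close>

lemma outer_product_in: "\<delta> (t - 1) * \<delta> (Suc t) \<in> S"
  using corner_res_in[of "Suc t" "Suc t"] t by (simp add: det_next mult_ac)

context
  assumes prev: "\<delta> (t - 1) \<noteq> 0" and succ: "\<delta> (Suc t) \<noteq> 0"
    and inverse: "1 / (\<delta> (t - 1) * \<delta> t * \<delta> (Suc t)) \<in> S"
begin

lemma inverse_leading: "1 / \<delta> t \<in> S"
proof -
  have e: "1 / \<delta> t = 1 / (\<delta> (t - 1) * \<delta> t * \<delta> (Suc t)) * (\<delta> (t - 1) * \<delta> (Suc t))"
    using prev succ by simp
  show ?thesis unfolding e by (rule mult[OF inverse outer_product_in])
qed

lemma inverse_outer: "1 / (\<delta> (t - 1) * \<delta> (Suc t)) \<in> S"
proof -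
  have e: "1 / (\<delta> (t - 1) * \<delta> (Suc t)) = 1 / (\<delta> (t - 1) * \<delta> t * \<delta> (Suc t)) * \<delta> t"
    using det_nonzero by simp
  show ?thesis unfolding e by (rule mult[OF inverse leading_minor_in])
qed

lemma P_in: assumes i: "i < t" and c: "1 \<le> c" "c \<le> n" shows "P i c \<in> S"
proof (cases "c \<le> t")
  case True
  then obtain k where "c = Suc k" "k < t" using c by (cases c) auto
  then show ?thesis using P_initial[OF i] by auto
next
  case False
  have e: "P i c = det (submat x (initial t) ((initial t)[i := c])) * (1 / \<delta> t)"
    using det_replace_column[OF i, of c] det_nonzero by (simp add: det_Y)
  show ?thesis
    unfolding e using column_minor_in[OF i, of c] False c by (intro mult inverse_leading) auto
qed

lemma Q_in: assumes j: "j < t" and r: "1 \<le> r" "r \<le> m" shows "Q r j \<in> S"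
proof (cases "r \<le> t")
  case True
  then obtain k where "r = Suc k" "k < t" using r by (cases r) auto
  then show ?thesis using Q_initial[of k j] j by auto
next
  case False
  have e: "Q r j = det (submat x ((initial t)[j := r]) (initial t)) * (1 / \<delta> t)"
    using det_replace_row[OF j, of r] det_nonzero by (simp add: det_Y)
  show ?thesis
    unfolding e using row_minor_in[OF j, of r] False r by (intro mult inverse_leading) auto
qed

lemma res_in:
  assumes r: "1 \<le> r" "r \<le> m" and c: "1 \<le> c" "c \<le> n"
  shows "1 / res (Suc t) (Suc t) * res r c \<in> S"
proof (cases "r \<le> t \<or> c \<le> t")
  case True
  then have "res r c = 0"
    using r c res_initial(1)[of "r - 1" c] res_initial(2)[of "c - 1" r] by auto
  then show ?thesis by simp
next
  case False
  have e: "1 / res (Suc t) (Suc t) * res r c = \<delta> t * \<delta> (t - 1) * res r c * (1 / (\<delta> (t - 1) * \<delta> (Suc t)))"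
    using prev det_nonzero by (simp add: det_next)
  have "\<delta> t * \<delta> (t - 1) * res r c \<in> S" using False r c by (intro corner_res_in) auto
  then show ?thesis unfolding e by (rule mult[OF _ inverse_outer])
qed

text \<open>With \<open>A\<close> the adjugate of the leading block \<open>Y'\<close> of size \<open>t + 1\<close>, multiply the first \<open>t\<close> rows of the equation
  \<open>Y' A = \<delta>\<^sub>t\<^sub>+\<^sub>1 I\<close> by \<open>Y\<^sup>-\<^sup>1\<close>.\<close>
lemma inverse_entry_in:
  assumes l: "l < t" and j: "j < t"
  shows "res (Suc t) (Suc t) * Yi $$ (l, j) \<in> S"
proof -
  let ?Y' = "submat x (initial (Suc t)) (initial (Suc t))"
  define A where "A = adj_mat ?Y'"
  have Y': "?Y' \<in> carrier_mat (Suc t) (Suc t)" using submat_carrier[of x "initial (Suc t)" "initial (Suc t)"] by simp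
  have A: "A \<in> carrier_mat (Suc t) (Suc t)" "?Y' * A = det ?Y' \<cdot>\<^sub>m 1\<^sub>m (Suc t)"
    unfolding A_def by (rule adj_mat[OF Y'])+
  have A_in: "A $$ (a, b) \<in> S" if "a \<le> t" "b \<le> t" for a b
    using that adjugate_minor_in[of b a] power[OF uminus[OF one], of "b + a"]
    by (auto simp: A_def adj_mat_def cofactor_def)
  have row: "(\<Sum>k<t. x (Suc i) (Suc k) * A $$ (k, j)) + x (Suc i) (Suc t) * A $$ (t, j)
      = (if i = j then \<delta> (Suc t) else 0)" if i: "i < t" for i
  proof -
    have 1: "(?Y' * A) $$ (i, j) = (\<Sum>k<Suc t. x (Suc i) (Suc k) * A $$ (k, j))"
      using A(1) i j by (simp add: scalar_prod_def atLeast0LessThan)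
    have 2: "(?Y' * A) $$ (i, j) = (if i = j then \<delta> (Suc t) else 0)"
      unfolding A(2) using i j by simp
    from trans[OF 1[symmetric] 2] show ?thesis by simp
  qed
  \<comment> \<open>Row \<open>l\<close> of \<open>Yi\<close> turns the first t columns of the
    enlarged block into a unit row and its last column into \<open>P l (Suc t)\<close>, so only
    adjugate entries and P remain.\<close>
  have "(\<Sum>i<t. Yi $$ (l, i) * ((\<Sum>k<t. x (Suc i) (Suc k) * A $$ (k, j)) + x (Suc i) (Suc t) * A $$ (t, j)))
      = (\<Sum>i<t. if i = j then Yi $$ (l, i) * \<delta> (Suc t) else 0)"
    using row by (intro sum.cong refl) auto
  also have "\<dots> = \<delta> (Suc t) * Yi $$ (l, j)" using j by simp
  finally have "\<delta> (Suc t) * Yi $$ (l, j) = (\<Sum>i<t. Yi $$ (l, i) * (\<Sum>k<t. x (Suc i) (Suc k) * A $$ (k, j)))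
      + P l (Suc t) * A $$ (t, j)"
    by (simp add: P_def distrib_left sum.distrib sum_distrib_right mult.assoc)
  also have "(\<Sum>i<t. Yi $$ (l, i) * (\<Sum>k<t. x (Suc i) (Suc k) * A $$ (k, j)))
      = (\<Sum>k<t. (\<Sum>i<t. Yi $$ (l, i) * x (Suc i) (Suc k)) * A $$ (k, j))"
    unfolding sum_distrib_left sum_distrib_right by (subst sum.swap) (simp add: mult.assoc)
  also have "\<dots> = (\<Sum>k<t. if l = k then A $$ (k, j) else 0)"
    using l by (intro sum.cong refl) (simp add: Y_inverse_entries)
  also have "\<dots> = A $$ (l, j)" using l by simp
  finally have "res (Suc t) (Suc t) * Yi $$ (l, j) = (A $$ (l, j) + P l (Suc t) * A $$ (t, j)) * (1 / \<delta> t)"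
    using det_nonzero by (simp add: det_next field_simps)
  moreover have "(A $$ (l, j) + P l (Suc t) * A $$ (t, j)) * (1 / \<delta> t) \<in> S"
    using A_in P_in[OF l, of "Suc t"] l j t inverse_leading by (intro mult add) auto
  ultimately show ?thesis by simp
qed

lemma det_submat_in:
  assumes rs: "length rs = t" "set rs \<subseteq> {1..m}" and cs: "length cs = t" "set cs \<subseteq> {1..n}"
  shows "det (submat x rs cs) \<in> S"
proof -
  let ?\<rho> = "res (Suc t) (Suc t)"
  have \<rho>: "?\<rho> \<noteq> 0" using succ det_next by auto
  have rs_nth: "1 \<le> rs ! a" "rs ! a \<le> m" if "a < t" for a
    using subsetD[OF rs(2) nth_mem[of a rs]] that rs(1) by auto
  have cs_nth: "1 \<le> cs ! b" "cs ! b \<le> n" if "b < t" for b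
    using subsetD[OF cs(2) nth_mem[of b cs]] that cs(1) by auto
  have "det (four_block_mat (?\<rho> \<cdot>\<^sub>m Yi) (Pmat cs) (- Qmat rs) ((1 / ?\<rho>) \<cdot>\<^sub>m Rmat rs cs)) \<in> S"
  proof (rule det_closed[of _ "t + t"])
    show "four_block_mat (?\<rho> \<cdot>\<^sub>m Yi) (Pmat cs) (- Qmat rs) ((1 / ?\<rho>) \<cdot>\<^sub>m Rmat rs cs) \<in> carrier_mat (t + t) (t + t)"
      using mats(3)[of rs cs] rs(1) cs(1) by (intro four_block_carrier_mat) auto
    fix i j assume ij: "i < t + t" "j < t + t"
    have dims: "dim_row (Qmat rs) = t" "dim_col (Qmat rs) = t" "dim_row (Rmat rs cs) = t" "dim_col (Rmat rs cs) = t"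
      using rs(1) cs(1) by (auto simp: Qmat_def Rmat_def)
    consider "i < t" "j < t" | "i < t" "t \<le> j" | "t \<le> i" "j < t" | "t \<le> i" "t \<le> j" by linarith
    then show "four_block_mat (?\<rho> \<cdot>\<^sub>m Yi) (Pmat cs) (- Qmat rs) ((1 / ?\<rho>) \<cdot>\<^sub>m Rmat rs cs) $$ (i, j) \<in> S"
    proof cases
      case 1
      then show ?thesis using inverse_entry_in[of i j] dims by simp
    next
      case 2
      then have "j - t < t" using ij by simp
      then show ?thesis using 2 ij P_in[OF 2(1)] cs_nth[of "j - t"] cs(1) dims by (simp add: Pmat_def)
    next
      case 3
      then have i': "i - t < t" using ij by simp
      then show ?thesis using 3 ij Q_in[OF 3(2)] rs_nth[OF i'] rs(1) dims uminus by (simp add: Qmat_def)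
    next
      case 4
      then have "i - t < t" "j - t < t" using ij by auto
      then show ?thesis using 4 ij res_in[of "rs ! (i - t)" "cs ! (j - t)"] rs_nth[of "i - t"] cs_nth[of "j - t"] rs(1) cs(1) dims
        by (simp add: Rmat_def)
    qed
  qed
  then show ?thesis
    using det_submat_eq[OF rs(1) cs(1) \<rho>] leading_minor_in by (simp add: det_Y mult)
qed

end

end

section \<open>Transfer to the polynomial ring and its fractions\<close>

lemma to_fract_minor:
  assumes "card R = card C" "finite R" "finite C"
  shows "to_fract (minor R C :: 'k::idom mpoly) =
    det (submat (\<lambda>i j. to_fract (Xvar i j)) (sorted_list_of_set R) (sorted_list_of_set C))"
proof -
  note h = comm_ring_homD[OF comm_ring_hom_to_fract]
  have s: "submat (\<lambda>i j. to_fract (Xvar i j :: 'k mpoly)) (sorted_list_of_set R) (sorted_list_of_set C)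
      \<in> carrier_mat (card R) (card R)"
    using submat_carrier[of _ "sorted_list_of_set R" "sorted_list_of_set C"] assms by simp
  have "to_fract (minor R C :: 'k mpoly) = (\<Sum>\<sigma> | \<sigma> permutes {..<card R}. of_int (sign \<sigma>) *
      (\<Prod>i<card R. to_fract (Xvar (sorted_list_of_set R ! i) (sorted_list_of_set C ! \<sigma> i))))"
    unfolding minor_def by (simp only: h)
  also have "\<dots> = det (submat (\<lambda>i j. to_fract (Xvar i j)) (sorted_list_of_set R) (sorted_list_of_set C))"
    unfolding det_def'[OF s] atLeast0LessThan
  proof (intro sum.cong refl arg_cong2[of _ _ _ _ "(*)"] prod.cong)
    fix \<sigma> i assume "\<sigma> \<in> {\<sigma>. \<sigma> permutes {..<card R}}" "i \<in> {..<card R}"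
    then have "i < card R" "\<sigma> i < card R" using permutes_in_image[of \<sigma> "{..<card R}" i] by auto
    then show "to_fract (Xvar (sorted_list_of_set R ! i) (sorted_list_of_set C ! \<sigma> i)) =
      submat (\<lambda>i j. to_fract (Xvar i j)) (sorted_list_of_set R) (sorted_list_of_set C) $$ (i, \<sigma> i)"
      using assms by simp
  qed
  finally show ?thesis .
qed

lemma to_fract_delta:
  "to_fract (delta k :: 'k::idom mpoly) = det (submat (\<lambda>i j. to_fract (Xvar i j)) (initial k) (initial k))"
  unfolding delta_def by (subst to_fract_minor) (simp_all only: sorted_list_initial finite_atLeastAtMost)

text \<open>The minor takes the value 1 at the diagonal point.\<close>

lemma delta_nonzero: "delta k \<noteq> (0 :: 'k::idom mpoly)"
proof
  assume "delta k = (0 :: 'k mpoly)"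
  then have "perturb k (minor {1..k} {1..k} :: 'k mpoly) = 0"
    using comm_ring_homD(1)[OF comm_ring_hom_perturb] unfolding delta_def by simp
  moreover have "coeff (perturb k (minor {1..k} {1..k})) 0 = (1 :: 'k mpoly)"
    by (rule perturb_principal_minor) auto
  ultimately show False by simp
qed

lemma minor_ring_inverse_Phi0:
  fixes S :: "'k::idom mpoly fract set"
  assumes t: "0 < t" "t < m" "m \<le> n" and S: "sub_ring S" "to_fract ` Phi0 m n t \<subseteq> S"
  shows "minor_ring_inverse S (\<lambda>i j. to_fract (Xvar i j)) t m n"
proof -
  interpret sub_ring S by (rule S)
  show ?thesis
  proof
    show "0 < t" "t < m" "t < n" using t by auto
    fix r c assume rc: "r \<in> {1..m}" "c \<in> {1..n}"
    note ix = index_sets[OF t rc]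
    have "minor (row_set t r c) (col_set t r c) \<in> (Phi0 m n t :: 'k mpoly set)"
      using ix unfolding Phi0_def by blast
    moreover have "card (row_set t r c) = card (col_set t r c)" "finite (row_set t r c)" "finite (col_set t r c)"
      using ix(1,2) finite_subset unfolding is_index_set_def by auto
    ultimately show "det (submat (\<lambda>i j. to_fract (Xvar i j :: 'k mpoly)) (sorted_list_of_set (row_set t r c))
        (sorted_list_of_set (col_set t r c))) \<in> S"
      using to_fract_minor[of "row_set t r c" "col_set t r c", where 'k = 'k] S(2) by fastforce
  next
    show "det (submat (\<lambda>i j. to_fract (Xvar i j :: 'k mpoly)) (initial t) (initial t)) \<noteq> 0"
      using delta_nonzero[of t, where 'k = 'k] by (simp flip: to_fract_delta)
  qed
qed

text \<open>\<open>outer_product_in\<close> involves no inverses, so it applies to the image of the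
  algebra itself. Membership of F is what makes the set \<open>invert\<close> a ring.\<close>

lemma Fpoly_in_alg_gen_Phi0:
  assumes t: "0 < t" "t < m" "m \<le> n"
  shows "Fpoly t \<in> alg_gen (Phi0 m n t :: 'k::field mpoly set)"
proof -
  let ?S = "to_fract ` alg_gen (Phi0 m n t :: 'k mpoly set)"
  have S: "sub_ring ?S" unfolding image_alg_gen by (rule sub_ring_ralg[OF sub_ring_constants])
  interpret minor_ring_inverse ?S "\<lambda>i j. to_fract (Xvar i j)" t m n
    by (rule minor_ring_inverse_Phi0[OF t S]) (auto intro: alg_gen.gen)
  have "to_fract (Fpoly t :: 'k mpoly) = (\<delta> (t - 1) * \<delta> (Suc t)) * \<delta> t"
    unfolding Fpoly_def to_fract_mult to_fract_delta by simp
  also have "\<dots> \<in> ?S" using outer_product_in leading_minor_in by (rule mult)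
  finally show ?thesis by (auto simp: to_fract_eq_iff)
qed

lemma invert_eq_quotients: "f \<noteq> 0 \<Longrightarrow> invert A f = {to_fract a / to_fract f ^ k | a k. a \<in> A}"
proof -
  assume "f \<noteq> 0"
  then have "Fract a (f ^ k) = to_fract a / to_fract f ^ k" for a k
    by (simp add: Fract_conv_to_fract comm_ring_homD(7)[OF comm_ring_hom_to_fract])
  then show ?thesis unfolding invert_def by simp
qed

lemma sub_ring_invert:
  assumes f: "f \<in> alg_gen G" "f \<noteq> (0 :: 'k::field mpoly)"
  shows "sub_ring (invert (alg_gen G) f)"
proof
  note inv = invert_eq_quotients[OF f(2), of "alg_gen G"]
  have C: "Const (1::'k) = 1" "Const (0::'k) = 0" by (rule comm_ring_homD[OF comm_ring_hom_Const])+
  have pow: "f ^ k \<in> alg_gen G" for k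
  proof (induction k)
    case 0
    show ?case using alg_gen.const[of 1 G] C by simp
  qed (auto intro: alg_gen.mult f)
  have F0: "to_fract f \<noteq> 0" using f(2) by simp
  note h = comm_ring_homD[OF comm_ring_hom_to_fract]
  have base: "to_fract a \<in> invert (alg_gen G) f" if "a \<in> alg_gen G" for a
    unfolding inv using that by (intro CollectI exI[of _ a] exI[of _ 0]) simp
  show "0 \<in> invert (alg_gen G) f" using base[OF alg_gen.const[of 0]] C by simp
  show "1 \<in> invert (alg_gen G) f" using base[OF alg_gen.const[of 1]] C by simp
  fix u v assume "u \<in> invert (alg_gen G) f" "v \<in> invert (alg_gen G) f"
  then obtain a k b l where ab: "a \<in> alg_gen G" "u = to_fract a / to_fract f ^ k"
    "b \<in> alg_gen G" "v = to_fract b / to_fract f ^ l" unfolding inv by blast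
  have "u + v = to_fract (a * f ^ l + b * f ^ k) / to_fract f ^ (k + l)"
    using F0 by (simp add: ab h add_frac_eq power_add)
  then show "u + v \<in> invert (alg_gen G) f"
    unfolding inv using ab pow by (blast intro: alg_gen.add alg_gen.mult)
  have "u * v = to_fract (a * b) / to_fract f ^ (k + l)" by (simp add: ab power_add)
  then show "u * v \<in> invert (alg_gen G) f" unfolding inv using ab by (blast intro: alg_gen.mult)
  have "- u = to_fract (Const (-1) * a) / to_fract f ^ k"
    by (simp only: ab h comm_ring_homD[OF comm_ring_hom_Const]) simp
  then show "- u \<in> invert (alg_gen G) f"
    unfolding inv using ab by (blast intro: alg_gen.mult alg_gen.const)
qed

lemma Phi0_subset_tminors: "Phi0 m n t \<subseteq> tminors m n t"
  by (auto simp: Phi0_def tminors_def)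

lemma alg_gen_mono: "G \<subseteq> H \<Longrightarrow> alg_gen G \<subseteq> alg_gen H"
proof
  fix a assume "G \<subseteq> H" "a \<in> alg_gen G"
  from this(2) show "a \<in> alg_gen H" by induction (use \<open>G \<subseteq> H\<close> in \<open>auto intro: alg_gen.intros\<close>)
qed

lemma invert_Phi0_eq:
  assumes t: "0 < t" "t < m" "m \<le> n"
  shows "invert (alg_gen (Phi0 m n t :: 'k::field mpoly set)) (Fpoly t) = invert (alg_gen (tminors m n t)) (Fpoly t)"
proof
  let ?F = "Fpoly t :: 'k mpoly"
  let ?S = "invert (alg_gen (Phi0 m n t :: 'k mpoly set)) ?F"
  show "?S \<subseteq> invert (alg_gen (tminors m n t)) ?F"
    using alg_gen_mono[OF Phi0_subset_tminors, of m n t] unfolding invert_def by blast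
  have F: "?F \<noteq> 0" unfolding Fpoly_def by (simp add: delta_nonzero)
  note inv = invert_eq_quotients[OF F]
  have S: "sub_ring ?S" by (rule sub_ring_invert[OF Fpoly_in_alg_gen_Phi0[OF t] F])
  have base: "to_fract a \<in> ?S" if "a \<in> alg_gen (Phi0 m n t)" for a
    unfolding inv using that by (intro CollectI exI[of _ a] exI[of _ 0]) simp
  have inverse: "1 / to_fract ?F \<in> ?S"
    unfolding inv using alg_gen.const[of 1 "Phi0 m n t"]
    by (intro CollectI exI[of _ 1] exI[of _ 1]) (simp add: comm_ring_homD[OF comm_ring_hom_Const])
  interpret minor_ring_inverse ?S "\<lambda>i j. to_fract (Xvar i j)" t m n
    by (rule minor_ring_inverse_Phi0[OF t S]) (auto intro: base alg_gen.gen)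
  have nz: "\<delta> k \<noteq> 0" for k using delta_nonzero[of k, where 'k = 'k] by (simp flip: to_fract_delta)
  have "1 / (\<delta> (t - 1) * \<delta> t * \<delta> (Suc t)) \<in> ?S"
    using inverse unfolding Fpoly_def to_fract_mult to_fract_delta by simp
  note minors = det_submat_in[OF nz nz this]
  have gen: "to_fract a \<in> ?S" if "a \<in> alg_gen (tminors m n t)" for a
    using that
  proof induction
    case (gen a)
    then obtain R C where RC: "a = minor R C" "R \<subseteq> {1..m}" "card R = t" "C \<subseteq> {1..n}" "card C = t"
      by (auto simp: tminors_def is_index_set_def)
    then have fin: "finite R" "finite C" using finite_subset by blast+
    have "det (submat (\<lambda>i j. to_fract (Xvar i j)) (sorted_list_of_set R) (sorted_list_of_set C)) \<in> ?S"
      by (rule minors) (use RC(2-5) fin in simp_all)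
    then show ?case unfolding RC(1) using RC(3,5) fin by (subst to_fract_minor) simp_all
  next
    case (const c)
    show ?case by (rule base[OF alg_gen.const])
  qed auto
  show "invert (alg_gen (tminors m n t)) ?F \<subseteq> ?S"
  proof
    fix u assume "u \<in> invert (alg_gen (tminors m n t)) ?F"
    then obtain a k where "a \<in> alg_gen (tminors m n t)" "u = to_fract a * (1 / to_fract ?F) ^ k"
      unfolding inv by (auto simp: power_one_over)
    then show "u \<in> ?S" using gen inverse by auto
  qed
qed

lemma regular_ring_invert_Phi0:
  assumes t: "0 < t" "t < m" "m \<le> n"
  shows "regular_ring (invert (alg_gen (Phi0 m n t :: 'k::field_char_0 mpoly set)) (Fpoly t))"
proof -
  let ?F = "Fpoly t :: 'k mpoly" and ?A = "alg_gen (Phi0 m n t :: 'k mpoly set)"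
  have F: "?F \<noteq> 0" unfolding Fpoly_def by (simp add: delta_nonzero)
  note FA = Fpoly_in_alg_gen_Phi0[OF t, where 'k = 'k]
  note inv = invert_eq_quotients[OF F]
  interpret affine_ring "range (\<lambda>c. to_fract (Const c :: 'k mpoly))" "to_fract ` Phi0 m n t"
    by (rule affine_ring_Phi0[OF t])
  interpret A: sub_ring "to_fract ` ?A"
    unfolding image_alg_gen by (rule sub_ring_ralg[OF K])
  show ?thesis
  proof (rule regular_ring_fractions[folded image_alg_gen])
    show "sub_ring (invert ?A ?F)" by (rule sub_ring_invert[OF FA F])
    show "to_fract ` ?A \<subseteq> invert ?A ?F"
    proof
      fix u assume "u \<in> to_fract ` ?A"
      then obtain a where "a \<in> ?A" "u = to_fract a" by auto
      then show "u \<in> invert ?A ?F"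
        unfolding inv by (intro CollectI exI[of _ a] exI[of _ 0]) simp
    qed
    fix u assume "u \<in> invert ?A ?F"
    then obtain a k where a: "a \<in> ?A" "u = to_fract a / to_fract ?F ^ k" unfolding inv by blast
    have "1 / to_fract ?F ^ k \<in> invert ?A ?F"
      unfolding inv using alg_gen.const[of 1 "Phi0 m n t"]
      by (intro CollectI exI[of _ 1] exI[of _ k]) (simp add: comm_ring_homD[OF comm_ring_hom_Const])
    then show "\<exists>s\<in>to_fract ` ?A. s \<noteq> 0 \<and> 1 / s \<in> invert ?A ?F \<and> s * u \<in> to_fract ` ?A"
      using a F A.power[of "to_fract ?F" k] FA by (intro bexI[of _ "to_fract ?F ^ k"]) auto
  qed
qed

theorem theorem6p4:
  fixes m n t :: nat
  assumes "alg_closed TYPE('k::field_char_0)"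
    and "0 < t" and "t < m" and "m \<le> n"
  shows "card (Phi0 m n t :: 'k mpoly set) = m * n \<and>
         invert (alg_gen (Phi0 m n t :: 'k mpoly set)) (Fpoly t)
         = invert (alg_gen (tminors m n t)) (Fpoly t) \<and>
         regular_ring (invert (alg_gen (tminors m n t :: 'k mpoly set)) (Fpoly t))"
  \<comment> \<open>Regularity is proved for fractions of the polynomial ring on
    \<open>\<Phi>\<^sub>0\<close> and carried over by the equality of the two localizations.\<close>
  using card_Phi0[OF assms(2-4)] invert_Phi0_eq[OF assms(2-4)] regular_ring_invert_Phi0[OF assms(2-4)]
  by metis

end
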